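(* Let $i\neq 0$ be a fixed real number. Every second order ODE given modulo point transformations, represented by real 1-forms $(\lambda,\mu,\bar\mu)$ on a 3-manifold $N$ (see context), uniquely defines an 8-dimensional manifold $P$ (fibred over $N$), real 1-forms $\theta^1,\theta^2,\theta^3,\Omega_2,\bar\Omega_2,\Omega_3,\bar\Omega_3,\Omega_4$ on $P$ and real functions $\mathcal R,\bar{\mathcal R},\mathcal S,\bar{\mathcal S}$ on $P$ such that (1) $\theta^1=b\mu+c\lambda$, $\theta^2=\bar b\bar\mu+\bar c\lambda$, $\theta^3=a\lambda$ (pullbacks to $P$ being understood) for some real functions $a,b,\bar b,c,\bar c$ on $P$ with $ab\bar b\neq 0$; (2) $\theta^1\wedge\theta^2\wedge\theta^3\wedge\Omega_2\wedge\bar\Omega_2\wedge\Omega_3\wedge\bar\Omega_3\wedge\Omega_4\neq 0$ at each point of $P$. The forms satisfy the equations $$d\theta^1=\Omega_2\wedge\theta^1+\Omega_3\wedge\theta^3,$$ $$d\theta^2=\bar\Omega_2\wedge\theta^2+\bar\Omega_3\wedge\theta^3,$$ $$d\theta^3=i\theta^1\wedge\theta^2+(\Omega_2+\bar\Omega_2)\wedge\theta^3,$$ $$d\Omega_2=2i\theta^1\wedge\bar\Omega_3+i\theta^2\wedge\Omega_3+\Omega_4\wedge\theta^3,$$ $$d\bar\Omega_2=-2i\theta^2\wedge\Omega_3-i\theta^1\wedge\bar\Omega_3+\Omega_4\wedge\theta^3,$$ $$d\Omega_3=\Omega_4\wedge\theta^1+\Omega_3\wedge\bar\Omega_2+\mathcal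 R\,\theta^2\wedge\theta^3,$$ $$d\bar\Omega_3=\Omega_4\wedge\theta^2+\bar\Omega_3\wedge\Omega_2+\bar{\mathcal R}\,\theta^1\wedge\theta^3,$$ $$d\Omega_4=i\Omega_3\wedge\bar\Omega_3+\Omega_4\wedge(\Omega_2+\bar\Omega_2)+\bar{\mathcal S}\,\theta^1\wedge\theta^3+\mathcal S\,\theta^2\wedge\theta^3.$$ The functions $\mathcal R,\bar{\mathcal R},\mathcal S,\bar{\mathcal S}$ satisfy in addition $$d\mathcal R=-\mathcal R(\Omega_2+3\bar\Omega_2)-\mathcal S\theta^1+\mathcal R_2\theta^2+\mathcal R_3\theta^3,$$ $$d\bar{\mathcal R}=-\bar{\mathcal R}(\bar\Omega_2+3\Omega_2)-\bar{\mathcal S}\theta^2+\bar{\mathcal R}_2\theta^1+\bar{\mathcal R}_3\theta^3,$$ $$d\mathcal S=-\mathcal S(2\Omega_2+3\bar\Omega_2)-i\mathcal R\bar\Omega_3+\mathcal S_1\theta^1+\mathcal S_2\theta^2+\mathcal S_3\theta^3,$$ $$d\bar{\mathcal S}=-\bar{\mathcal S}(2\bar\Omega_2+3\Omega_2)+i\bar{\mathcal R}\Omega_3+\bar{\mathcal S}_2\theta^1+\bar{\mathcal S}_1\theta^2+\bar{\mathcal S}_3\theta^3,$$ with appropriate real functions $\mathcal R_2,\bar{\mathcal R}_2,\mathcal R_3,\bar{\mathcal R}_3,\mathcal S_1,\bar{\mathcal S}_1,\mathcal S_2,\bar{\mathcal S}_2,\mathcal S_3,\bar{\mathcal S}_3$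 on $P$, and $\mathcal S_1=\bar{\mathcal S}_1$.
   Context: All considerations are local and concern nonsingular points. Here $i$ denotes a fixed nonzero REAL constant, everything is real, and the bar does not denote complex conjugation: a barred symbol is an object independent of its unbarred counterpart. A second order ODE $y''=Q(x,y,y')$ is encoded on the first jet space $N=J^1$ with coordinates $(x,y,p)$ by the real 1-forms $\lambda=-i(dy-p\,dx)$, $\mu=dp-Q(x,y,p)\,dx$, $\bar\mu=dx$. They satisfy $\lambda\wedge\mu\wedge\bar\mu\neq 0$ and $d\lambda\wedge\lambda\neq 0$. A point transformation is a diffeomorphism $(x,y)\mapsto(\tilde x(x,y),\tilde y(x,y))$. A second order ODE given modulo point transformations is represented by the class of triples of real 1-forms $(\lambda,\mu,\bar\mu)$ on a 3-manifold $N$ with $\lambda\wedge\mu\wedge\bar\mu\neq 0$ and $d\lambda\wedge\lambda\neq 0$, given up to the transformations $\lambda\to a\lambda$, $\mu\to b\mu+c\lambda$, $\bar\mu\to\bar b\bar\mu+\bar c\lambda$ with real functions $a,b,\bar b,c,\bar c$ on $N$ such that $ab\bar b\neq 0$. Two such ODEs, on $N$ and $N'$, are point equivalent iff there is a local diffeomorphism $\phi:N\to N'$ with $\phi^*\lambda'=a\lambda$, $\phi^*\mu'=b\mu+c\lambda$, $\phi^*\bar\mu'=\bar b\bar\mu+\bar c\lambda$ for such functions. *)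

theory Defs
  imports "HOL-Analysis.Analysis"
begin

section \<open>Smooth maps and differential forms on open subsets of Euclidean spaces\<close>

primrec Ck_on :: "nat \<Rightarrow> ('a::real_normed_vector \<Rightarrow> 'b::real_normed_vector) \<Rightarrow> 'a set \<Rightarrow> bool" where
  "Ck_on 0 f U \<longleftrightarrow> continuous_on U f"
| "Ck_on (Suc k) f U \<longleftrightarrow>
     (\<forall>x\<in>U. f differentiable (at x)) \<and>
     (\<forall>v. Ck_on k (\<lambda>x. frechet_derivative f (at x) v) U)"

definition smooth_on :: "('a::real_normed_vector \<Rightarrow> 'b::real_normed_vector) \<Rightarrow> 'a set \<Rightarrow> bool" where
  "smooth_on f U \<longleftrightarrow> (\<forall>k. Ck_on k f U)"

definition local_diffeo ::
  "('a::real_normed_vector \<Rightarrow> 'b::real_normed_vector) \<Rightarrow> 'a set \<Rightarrow> 'b set \<Rightarrow> bool" where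
  "local_diffeo f U V \<longleftrightarrow> f ` U \<subseteq> V \<and>
     (\<forall>x\<in>U. \<exists>W. open W \<and> x \<in> W \<and> W \<subseteq> U \<and> open (f ` W) \<and> inj_on f W \<and>
        smooth_on f W \<and> smooth_on (inv_into W f) (f ` W))"

type_synonym 'a covector = "'a \<Rightarrow>\<^sub>L real"

text \<open>A 1-form is a map from points to covectors. Wedge products and the exterior derivative follow
  the convention \<open>(\<alpha> \<and> \<beta>)(u,v) = \<alpha>(u)\<beta>(v) - \<alpha>(v)\<beta>(u)\<close>, i.e. a product of k covectors evaluated on
  k vectors is a determinant, without factor \<open>1/k!\<close>.\<close>

type_synonym 'a one_form = "'a \<Rightarrow> 'a covector"

definition wedge :: "'a::real_normed_vector covector \<Rightarrow> 'a covector \<Rightarrow> 'a \<Rightarrow> 'a \<Rightarrow> real"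
    (infix "\<curlywedge>" 75) where
  "(\<alpha> \<curlywedge> \<beta>) u v = \<alpha> u * \<beta> v - \<alpha> v * \<beta> u"

text \<open>Product of a 2-covector with a covector.\<close>

definition wedge21 ::
  "('a::real_normed_vector \<Rightarrow> 'a \<Rightarrow> real) \<Rightarrow> 'a covector \<Rightarrow> 'a \<Rightarrow> 'a \<Rightarrow> 'a \<Rightarrow> real" where
  "wedge21 \<omega> \<alpha> u v w = \<omega> u v * \<alpha> w + \<omega> v w * \<alpha> u + \<omega> w u * \<alpha> v"

definition wedge_list :: "'a::real_normed_vector covector list \<Rightarrow> (nat \<Rightarrow> 'a) \<Rightarrow> real" where
  "wedge_list \<alpha>s v =
     (\<Sum>\<sigma> | \<sigma> permutes {..<length \<alpha>s}.
        of_int (sign \<sigma>) * (\<Prod>j<length \<alpha>s. (\<alpha>s ! j) (v (\<sigma> j))))"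

definition ext_d :: "'a::real_normed_vector one_form \<Rightarrow> 'a \<Rightarrow> 'a \<Rightarrow> 'a \<Rightarrow> real" where
  "ext_d \<alpha> x u v =
     frechet_derivative \<alpha> (at x) u v - frechet_derivative \<alpha> (at x) v u"

definition pullback ::
  "('a::real_normed_vector \<Rightarrow> 'b::real_normed_vector) \<Rightarrow> 'b one_form \<Rightarrow> 'a one_form" where
  "pullback f \<alpha> x = \<alpha> (f x) o\<^sub>L Blinfun (frechet_derivative f (at x))"


section \<open>Second order ODEs modulo point transformations\<close>

text \<open>A bar in the usual notation is rendered by a trailing \<open>b\<close>; it has nothing to do
  with complex conjugation. The 3-manifold is taken inside a chart.\<close>

definition ode_structure ::
  "(real^3) set \<Rightarrow> (real^3) one_form \<Rightarrow> (real^3) one_form \<Rightarrow> (real^3) one_form \<Rightarrow> bool" where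
  "ode_structure N lam \<mu> \<mu>b \<longleftrightarrow>
     open N \<and> smooth_on lam N \<and> smooth_on \<mu> N \<and> smooth_on \<mu>b N \<and>
     (\<forall>x\<in>N. (\<exists>v. wedge_list [lam x, \<mu> x, \<mu>b x] v \<noteq> 0) \<and>
             (\<exists>u v w. wedge21 (ext_d lam x) (lam x) u v w \<noteq> 0))"

definition point_equivalence ::
  "(real^3 \<Rightarrow> real^3) \<Rightarrow>
   (real^3) set \<Rightarrow> (real^3) one_form \<Rightarrow> (real^3) one_form \<Rightarrow> (real^3) one_form \<Rightarrow>
   (real^3) set \<Rightarrow> (real^3) one_form \<Rightarrow> (real^3) one_form \<Rightarrow> (real^3) one_form \<Rightarrow> bool" where
  "point_equivalence \<phi> N lam \<mu> \<mu>b N' lam' \<mu>' \<mu>b' \<longleftrightarrow>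
     local_diffeo \<phi> N N' \<and>
     (\<exists>a b bb c cb :: real^3 \<Rightarrow> real.
        (\<forall>f\<in>{a, b, bb, c, cb}. smooth_on f N) \<and>
        (\<forall>x\<in>N. a x * b x * bb x \<noteq> 0 \<and>
           pullback \<phi> lam' x = a x *\<^sub>R lam x \<and>
           pullback \<phi> \<mu>' x = b x *\<^sub>R \<mu> x + c x *\<^sub>R lam x \<and>
           pullback \<phi> \<mu>b' x = bb x *\<^sub>R \<mu>b x + cb x *\<^sub>R lam x))"


section \<open>The 8-dimensional bundle and its invariant coframe\<close>

text \<open>\<open>base_proj\<close> is the projection of the total space \<open>total_space\<close> to the 3-manifold.\<close>

record bundle_data =
  total_space :: "(real^8) set"
  base_proj :: "real^8 \<Rightarrow> real^3"
  theta1 :: "(real^8) one_form"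
  theta2 :: "(real^8) one_form"
  theta3 :: "(real^8) one_form"
  Omega2 :: "(real^8) one_form"
  Omega2b :: "(real^8) one_form"
  Omega3 :: "(real^8) one_form"
  Omega3b :: "(real^8) one_form"
  Omega4 :: "(real^8) one_form"
  curvR :: "real^8 \<Rightarrow> real"
  curvRb :: "real^8 \<Rightarrow> real"
  curvS :: "real^8 \<Rightarrow> real"
  curvSb :: "real^8 \<Rightarrow> real"

definition forms_of :: "bundle_data \<Rightarrow> (real^8) one_form list" where
  "forms_of B = [theta1 B, theta2 B, theta3 B, Omega2 B, Omega2b B, Omega3 B, Omega3b B, Omega4 B]"

definition functions_of :: "bundle_data \<Rightarrow> (real^8 \<Rightarrow> real) list" where
  "functions_of B = [curvR B, curvRb B, curvS B, curvSb B]"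

definition fibred_over :: "bundle_data \<Rightarrow> (real^3) set \<Rightarrow> bool" where
  "fibred_over B N \<longleftrightarrow>
     open (total_space B) \<and> smooth_on (base_proj B) (total_space B) \<and> base_proj B ` total_space B = N \<and>
     (\<forall>p\<in>total_space B. surj (frechet_derivative (base_proj B) (at p)))"

definition adapted_coframe ::
  "bundle_data \<Rightarrow> (real^3) one_form \<Rightarrow> (real^3) one_form \<Rightarrow> (real^3) one_form \<Rightarrow> bool" where
  "adapted_coframe B lam \<mu> \<mu>b \<longleftrightarrow>
     (\<forall>\<alpha>\<in>set (forms_of B). smooth_on \<alpha> (total_space B)) \<and>
     (\<exists>a b bb c cb :: real^8 \<Rightarrow> real.
        (\<forall>f\<in>{a, b, bb, c, cb}. smooth_on f (total_space B)) \<and>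
        (\<forall>p\<in>total_space B. a p * b p * bb p \<noteq> 0 \<and>
           theta1 B p =
             b p *\<^sub>R pullback (base_proj B) \<mu> p + c p *\<^sub>R pullback (base_proj B) lam p \<and>
           theta2 B p =
             bb p *\<^sub>R pullback (base_proj B) \<mu>b p + cb p *\<^sub>R pullback (base_proj B) lam p \<and>
           theta3 B p = a p *\<^sub>R pullback (base_proj B) lam p)) \<and>
     (\<forall>p\<in>total_space B. \<exists>v. wedge_list (map (\<lambda>\<alpha>. \<alpha> p) (forms_of B)) v \<noteq> 0)"

definition structure_equations ::
  "real \<Rightarrow> (real^8) set \<Rightarrow>
   (real^8) one_form \<Rightarrow> (real^8) one_form \<Rightarrow> (real^8) one_form \<Rightarrow>
   (real^8) one_form \<Rightarrow> (real^8) one_form \<Rightarrow> (real^8) one_form \<Rightarrow> (real^8) one_form \<Rightarrow>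
   (real^8) one_form \<Rightarrow>
   (real^8 \<Rightarrow> real) \<Rightarrow> (real^8 \<Rightarrow> real) \<Rightarrow> (real^8 \<Rightarrow> real) \<Rightarrow> (real^8 \<Rightarrow> real) \<Rightarrow> bool" where
  "structure_equations i P \<theta>1 \<theta>2 \<theta>3 \<Omega>2 \<Omega>2b \<Omega>3 \<Omega>3b \<Omega>4 R Rb S Sb \<longleftrightarrow>
     (\<forall>p\<in>P. \<forall>u v.
        ext_d \<theta>1 p u v = (\<Omega>2 p \<curlywedge> \<theta>1 p) u v + (\<Omega>3 p \<curlywedge> \<theta>3 p) u v \<and>
        ext_d \<theta>2 p u v = (\<Omega>2b p \<curlywedge> \<theta>2 p) u v + (\<Omega>3b p \<curlywedge> \<theta>3 p) u v \<and>
        ext_d \<theta>3 p u v = i * (\<theta>1 p \<curlywedge> \<theta>2 p) u v + ((\<Omega>2 p + \<Omega>2b p) \<curlywedge> \<theta>3 p) u v \<and>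
        ext_d \<Omega>2 p u v =
          2 * i * (\<theta>1 p \<curlywedge> \<Omega>3b p) u v + i * (\<theta>2 p \<curlywedge> \<Omega>3 p) u v + (\<Omega>4 p \<curlywedge> \<theta>3 p) u v \<and>
        ext_d \<Omega>2b p u v =
          - 2 * i * (\<theta>2 p \<curlywedge> \<Omega>3 p) u v - i * (\<theta>1 p \<curlywedge> \<Omega>3b p) u v + (\<Omega>4 p \<curlywedge> \<theta>3 p) u v \<and>
        ext_d \<Omega>3 p u v =
          (\<Omega>4 p \<curlywedge> \<theta>1 p) u v + (\<Omega>3 p \<curlywedge> \<Omega>2b p) u v + R p * (\<theta>2 p \<curlywedge> \<theta>3 p) u v \<and>
        ext_d \<Omega>3b p u v =
          (\<Omega>4 p \<curlywedge> \<theta>2 p) u v + (\<Omega>3b p \<curlywedge> \<Omega>2 p) u v + Rb p * (\<theta>1 p \<curlywedge> \<theta>3 p) u v \<and>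
        ext_d \<Omega>4 p u v =
          i * (\<Omega>3 p \<curlywedge> \<Omega>3b p) u v + (\<Omega>4 p \<curlywedge> (\<Omega>2 p + \<Omega>2b p)) u v
          + Sb p * (\<theta>1 p \<curlywedge> \<theta>3 p) u v + S p * (\<theta>2 p \<curlywedge> \<theta>3 p) u v)"

definition curvature_equations ::
  "real \<Rightarrow> (real^8) set \<Rightarrow>
   (real^8) one_form \<Rightarrow> (real^8) one_form \<Rightarrow> (real^8) one_form \<Rightarrow>
   (real^8) one_form \<Rightarrow> (real^8) one_form \<Rightarrow> (real^8) one_form \<Rightarrow> (real^8) one_form \<Rightarrow>
   (real^8 \<Rightarrow> real) \<Rightarrow> (real^8 \<Rightarrow> real) \<Rightarrow> (real^8 \<Rightarrow> real) \<Rightarrow> (real^8 \<Rightarrow> real) \<Rightarrow> bool" where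
  "curvature_equations i P \<theta>1 \<theta>2 \<theta>3 \<Omega>2 \<Omega>2b \<Omega>3 \<Omega>3b R Rb S Sb \<longleftrightarrow>
     (\<forall>f\<in>{R, Rb, S, Sb}. smooth_on f P) \<and>
     (\<exists>R2 Rb2 R3 Rb3 S1 Sb1 S2 Sb2 S3 Sb3 :: real^8 \<Rightarrow> real.
        (\<forall>f\<in>{R2, Rb2, R3, Rb3, S1, Sb1, S2, Sb2, S3, Sb3}. smooth_on f P) \<and>
        (\<forall>p\<in>P.
           (R has_derivative
              blinfun_apply (- R p *\<^sub>R (\<Omega>2 p + 3 *\<^sub>R \<Omega>2b p) - S p *\<^sub>R \<theta>1 p
                + R2 p *\<^sub>R \<theta>2 p + R3 p *\<^sub>R \<theta>3 p)) (at p) \<and>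
           (Rb has_derivative
              blinfun_apply (- Rb p *\<^sub>R (\<Omega>2b p + 3 *\<^sub>R \<Omega>2 p) - Sb p *\<^sub>R \<theta>2 p
                + Rb2 p *\<^sub>R \<theta>1 p + Rb3 p *\<^sub>R \<theta>3 p)) (at p) \<and>
           (S has_derivative
              blinfun_apply (- S p *\<^sub>R (2 *\<^sub>R \<Omega>2 p + 3 *\<^sub>R \<Omega>2b p) - (i * R p) *\<^sub>R \<Omega>3b p
                + S1 p *\<^sub>R \<theta>1 p + S2 p *\<^sub>R \<theta>2 p + S3 p *\<^sub>R \<theta>3 p)) (at p) \<and>
           (Sb has_derivative
              blinfun_apply (- Sb p *\<^sub>R (2 *\<^sub>R \<Omega>2b p + 3 *\<^sub>R \<Omega>2 p) + (i * Rb p) *\<^sub>R \<Omega>3 p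
                + Sb2 p *\<^sub>R \<theta>1 p + Sb1 p *\<^sub>R \<theta>2 p + Sb3 p *\<^sub>R \<theta>3 p)) (at p) \<and>
           S1 p = Sb1 p))"

definition cartan_bundle ::
  "real \<Rightarrow> (real^3) set \<Rightarrow> (real^3) one_form \<Rightarrow> (real^3) one_form \<Rightarrow> (real^3) one_form \<Rightarrow>
   bundle_data \<Rightarrow> bool" where
  "cartan_bundle i N lam \<mu> \<mu>b B \<longleftrightarrow>
     fibred_over B N \<and>
     adapted_coframe B lam \<mu> \<mu>b \<and>
     structure_equations i (total_space B) (theta1 B) (theta2 B) (theta3 B)
       (Omega2 B) (Omega2b B) (Omega3 B) (Omega3b B) (Omega4 B)
       (curvR B) (curvRb B) (curvS B) (curvSb B) \<and>
     curvature_equations i (total_space B) (theta1 B) (theta2 B) (theta3 B)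
       (Omega2 B) (Omega2b B) (Omega3 B) (Omega3b B)
       (curvR B) (curvRb B) (curvS B) (curvSb B)"

text \<open>\<open>\<Phi>\<close> lifts \<open>\<phi>\<close> and identifies the two sets of forms and functions. A global diffeomorphism
  cannot be required here: \<open>cartan_bundle\<close> is inherited by open subsets of the total space that
  still cover the base, and by suitable coverings.\<close>

definition bundle_lift :: "(real^3 \<Rightarrow> real^3) \<Rightarrow> bundle_data \<Rightarrow> bundle_data \<Rightarrow> (real^8 \<Rightarrow> real^8) \<Rightarrow> bool"
  where
  "bundle_lift \<phi> B B' \<Phi> \<longleftrightarrow>
     local_diffeo \<Phi> (total_space B) (total_space B') \<and>
     (\<forall>p\<in>total_space B.
        base_proj B' (\<Phi> p) = \<phi> (base_proj B p) \<and>
        map (\<lambda>\<alpha>. pullback \<Phi> \<alpha> p) (forms_of B') = map (\<lambda>\<alpha>. \<alpha> p) (forms_of B) \<and>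
        map (\<lambda>f. f (\<Phi> p)) (functions_of B') = map (\<lambda>f. f p) (functions_of B))"

end

theory Submission
  imports Defs
begin

text \<open>
  On \<open>N\<close> rescale \<open>lam\<close> so that \<open>d\<theta>\<^sup>3 = i \<theta>\<^sup>1 \<and> \<theta>\<^sup>2\<close> modulo \<open>\<theta>\<^sup>3\<close>. Comparing coefficients in this coframe, the
  structure equations determine the remaining forms on \<open>N\<close> by linear equations, up to one function
  which is normalized; the equations that are not used for solving hold because \<open>d\<^sup>2 = 0\<close>. The
  structure equations are those of a connection with values in \<open>sl(3)\<close>, so they are preserved by gauge
  transformations with values in a five-dimensional Borel group. The bundle is \<open>N\<close> times this group, and its
  coframe is the pulled back solution transformed by the tautological group element. The equations for
  \<open>dR\<close> and \<open>dS\<close> are the Bianchi identities.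

  Any other such bundle over an equivalent structure carries, besides its own forms, the pullback
  of the solution on \<open>N\<close>. The forms \<open>\<theta>\<^sup>1, \<theta>\<^sup>2, \<theta>\<^sup>3\<close> of the two differ by a unique gauge
  transformation with four parameters, and Cartan's lemma shows that the rest then differs only by the fifth one.
  These five functions, together with the base point, are the lift; it maps one coframe to the other,
  hence is a local diffeomorphism.
\<close>


section \<open>Smooth maps\<close>


text \<open>Working on the three-dimensional base turns the problem into a count. With the
  12-coefficient of \<open>d e3\<close> normalized to \<open>i\<close>, the components of the eight
  structure equations leave 23 scalar equations for 19 unknown functions: five connection forms and
  four curvatures. One unknown is set to 0, 18 equations are solved one after the other for the
  rest, and the remaining five are what d^2 = 0, applied to the three coframe elements and to the
  two diagonal connection forms, provides. The divisors met on the way are \<open>2 * i\<close> and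
  \<open>3 * i\<close>; the latter appears again in the uniqueness argument. Splitting the gauge
  group into simple factors makes the invariance of the structure equations, for each factor, an
  algebraic identity between values of the forms at two vectors. In comparing two solutions, an
  equality of forms can be differentiated only where it holds on an open set. The comparison
  therefore proceeds form by form over the whole total space, each agreement feeding the next
  structure equation.\<close>

abbreviation D :: "('a::real_normed_vector \<Rightarrow> 'b::real_normed_vector) \<Rightarrow> 'a \<Rightarrow> 'a \<Rightarrow> 'b" where
  "D f x \<equiv> frechet_derivative f (at x)"

lemma D_eqI: "(f has_derivative f') (at x) \<Longrightarrow> D f x = f'"
  by (rule frechet_derivative_at [symmetric])

lemma D_cong:
  assumes "open U" "x \<in> U" "\<And>y. y \<in> U \<Longrightarrow> f y = g y"
  shows "D f x = D g x"
proof -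
  have "(f has_derivative f') (at x) \<longleftrightarrow> (g has_derivative f') (at x)" for f'
    using has_derivative_transform_within_open[OF _ assms(1,2), of f f' UNIV g]
      has_derivative_transform_within_open[OF _ assms(1,2), of g f' UNIV f] assms(3) by auto
  then show ?thesis
    by (simp add: frechet_derivative_def)
qed

lemma differentiable_cong_open:
  assumes "open U" "x \<in> U" "\<And>y. y \<in> U \<Longrightarrow> f y = g y" "f differentiable (at x)"
  shows "g differentiable (at x)"
  using assms has_derivative_transform_within_open[OF _ assms(1,2), of f _ UNIV g]
  unfolding differentiable_def by blast

lemma Ck_on_cong:
  assumes "open U" "\<And>x. x \<in> U \<Longrightarrow> f x = g x" "Ck_on k f U"
  shows "Ck_on k g U"
  using assms(2,3)
proof (induction k arbitrary: f g)
  case 0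
  then show ?case by (auto cong: continuous_on_cong)
next
  case (Suc k)
  have "D f x = D g x" if "x \<in> U" for x
    using D_cong[OF assms(1) that] Suc.prems(1) by blast
  moreover have "g differentiable (at x)" if "x \<in> U" for x
    using differentiable_cong_open[OF assms(1) that Suc.prems(1)] Suc.prems(2) that by auto
  ultimately show ?case
    using Suc.prems(2) Suc.IH[of "\<lambda>x. D f x v" "\<lambda>x. D g x v" for v] by auto
qed

lemma Ck_on_subset: "Ck_on k f U \<Longrightarrow> V \<subseteq> U \<Longrightarrow> Ck_on k f V"
  by (induction k arbitrary: f) (auto intro: continuous_on_subset)

lemma Ck_on_SucD: "Ck_on (Suc k) f U \<Longrightarrow> Ck_on k f U"
proof (induction k arbitrary: f)
  case 0
  then show ?case
    by (auto simp: differentiable_imp_continuous_within continuous_at_imp_continuous_on)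
next
  case (Suc k)
  show ?case
    unfolding Ck_on.simps(2)[of k]
    using Suc.prems Suc.IH[of "\<lambda>x. D f x v" for v] unfolding Ck_on.simps(2)[of "Suc k"] by blast
qed

text \<open>The recursion in \<open>Ck_on\<close> refers to the chosen derivative
  \<open>D f\<close>. Here any explicit derivative formula may take its place, which is the form the
  inductions below use.\<close>

lemma Ck_on_SucI:
  assumes "open U" "\<And>x. x \<in> U \<Longrightarrow> (f has_derivative f' x) (at x)" "\<And>v. Ck_on k (\<lambda>x. f' x v) U"
  shows "Ck_on (Suc k) f U"
proof -
  have "Ck_on k (\<lambda>x. D f x v) U" for v
    by (rule Ck_on_cong[OF assms(1) _ assms(3)]) (simp add: D_eqI[OF assms(2)])
  then show ?thesis
    using assms(2) unfolding Ck_on.simps differentiable_def by blast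
qed

lemma Ck_on_Suc_has_derivative: "Ck_on (Suc k) f U \<Longrightarrow> x \<in> U \<Longrightarrow> (f has_derivative D f x) (at x)"
  using frechet_derivative_works by auto

lemma Ck_on_const: "open U \<Longrightarrow> Ck_on k (\<lambda>x. c) U"
  by (induction k arbitrary: c) auto

lemma Ck_on_bounded_linear_comp:
  assumes "open U" "bounded_linear h" "Ck_on k f U"
  shows "Ck_on k (\<lambda>x. h (f x)) U"
  using assms(3)
proof (induction k arbitrary: f)
  case 0
  then show ?case using assms(2) by (simp add: bounded_linear.continuous_on)
next
  case (Suc k)
  show ?case
  proof (rule Ck_on_SucI[where f'="\<lambda>x v. h (D f x v)"])
    show "((\<lambda>x. h (f x)) has_derivative (\<lambda>v. h (D f x v))) (at x)" if "x \<in> U" for x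
      using bounded_linear.has_derivative[OF assms(2) Ck_on_Suc_has_derivative[OF Suc.prems that]] .
  qed (use Suc assms in auto)
qed

lemma Ck_on_add:
  assumes "open U" "Ck_on k f U" "Ck_on k g U"
  shows "Ck_on k (\<lambda>x. f x + g x) U"
  using assms(2,3)
proof (induction k arbitrary: f g)
  case 0
  then show ?case by (simp add: continuous_on_add)
next
  case (Suc k)
  show ?case
  proof (rule Ck_on_SucI[where f'="\<lambda>x v. D f x v + D g x v"])
    show "((\<lambda>x. f x + g x) has_derivative (\<lambda>v. D f x v + D g x v)) (at x)" if "x \<in> U" for x
      using has_derivative_add[OF Suc.prems[THEN Ck_on_Suc_has_derivative, OF that]] .
  qed (use Suc assms in auto)
qed

lemma Ck_on_bilinear:
  assumes "open U" "bounded_bilinear h" "Ck_on k f U" "Ck_on k g U"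
  shows "Ck_on k (\<lambda>x. h (f x) (g x)) U"
  using assms(3,4)
proof (induction k arbitrary: f g)
  case 0
  then show ?case using bounded_bilinear.continuous_on[OF assms(2)] by simp
next
  case (Suc k)
  show ?case
  proof (rule Ck_on_SucI[where f'="\<lambda>x v. h (f x) (D g x v) + h (D f x v) (g x)"])
    show "((\<lambda>x. h (f x) (g x)) has_derivative (\<lambda>v. h (f x) (D g x v) + h (D f x v) (g x))) (at x)"
      if "x \<in> U" for x
      using bounded_bilinear.FDERIV[OF assms(2) Suc.prems[THEN Ck_on_Suc_has_derivative, OF that]] .
    show "Ck_on k (\<lambda>x. h (f x) (D g x v) + h (D f x v) (g x)) U" for v
      using Suc.prems[THEN Ck_on_SucD] Suc.prems Suc.IH assms(1) by (intro Ck_on_add) auto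
  qed (use assms in auto)
qed

lemma Ck_on_mult:
  fixes f g :: "_ \<Rightarrow> real"
  assumes "open U" "Ck_on k f U" "Ck_on k g U"
  shows "Ck_on k (\<lambda>x. f x * g x) U"
  by (rule Ck_on_bilinear[where h="(*)", OF assms(1) bounded_bilinear_mult assms(2,3)])

lemma Ck_on_sum:
  assumes "open U" "\<And>i. i \<in> A \<Longrightarrow> Ck_on k (f i) U"
  shows "Ck_on k (\<lambda>x. \<Sum>i\<in>A. f i x) U"
  using assms(2)
proof (induction A rule: infinite_finite_induct)
  case (insert a F)
  then show ?case using Ck_on_add[OF assms(1), of k "f a" "\<lambda>x. \<Sum>i\<in>F. f i x"] by simp
qed (simp_all add: Ck_on_const assms(1))

lemma has_derivative_compose_at:
  assumes "(g has_derivative g') (at x)" "(f has_derivative f') (at (g x))"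
  shows "((\<lambda>x. f (g x)) has_derivative (\<lambda>v. f' (g' v))) (at x)"
  using has_derivative_compose[OF assms(1) has_derivative_at_withinI[OF assms(2)]] .

text \<open>The induction hypothesis controls \<open>D f\<close> only in constant directions,
  whereas the chain rule produces the moving direction \<open>D g x v\<close>. Expanding this vector
  in a basis of the finite-dimensional middle space separates the two dependences on
  \<open>x\<close>.\<close>

lemma Ck_on_compose:
  fixes g :: "'a::real_normed_vector \<Rightarrow> 'b::euclidean_space" and f :: "'b \<Rightarrow> 'c::real_normed_vector"
  assumes "open U" "open V" "g ` U \<subseteq> V" "Ck_on k g U" "Ck_on k f V"
  shows "Ck_on k (\<lambda>x. f (g x)) U"
  using assms(4,5)
proof (induction k arbitrary: f)
  case 0
  then show ?case
    using continuous_on_compose2[of V f U g] assms(3) by simp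
next
  case (Suc k)
  show ?case
  proof (rule Ck_on_SucI[where f'="\<lambda>x v. \<Sum>b\<in>Basis. (D g x v \<bullet> b) *\<^sub>R D f (g x) b"])
    show "((\<lambda>x. f (g x)) has_derivative (\<lambda>v. \<Sum>b\<in>Basis. (D g x v \<bullet> b) *\<^sub>R D f (g x) b)) (at x)"
      if "x \<in> U" for x
    proof -
      have f: "(f has_derivative D f (g x)) (at (g x))"
        using that assms(3) by (intro Ck_on_Suc_has_derivative[OF Suc.prems(2)]) auto
      have lin: "linear (D f (g x))"
        using has_derivative_linear[OF f] .
      have "D f (g x) w = (\<Sum>b\<in>Basis. (w \<bullet> b) *\<^sub>R D f (g x) b)" for w
      proof -
        have "D f (g x) w = D f (g x) (\<Sum>b\<in>Basis. (w \<bullet> b) *\<^sub>R b)"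
          by (simp add: euclidean_representation)
        also have "\<dots> = (\<Sum>b\<in>Basis. (w \<bullet> b) *\<^sub>R D f (g x) b)"
          by (simp only: linear_sum[OF lin] linear_scale[OF lin])
        finally show ?thesis .
      qed
      then have "D f (g x) = (\<lambda>w. \<Sum>b\<in>Basis. (w \<bullet> b) *\<^sub>R D f (g x) b)"
        by (rule ext)
      from has_derivative_eq_rhs[OF f this] show ?thesis
        by (rule has_derivative_compose_at[OF Ck_on_Suc_has_derivative[OF Suc.prems(1) that]])
    qed
    show "Ck_on k (\<lambda>x. \<Sum>b\<in>Basis. (D g x v \<bullet> b) *\<^sub>R D f (g x) b) U" for v
    proof (intro Ck_on_sum assms)
      fix b :: 'b
      show "Ck_on k (\<lambda>x. (D g x v \<bullet> b) *\<^sub>R D f (g x) b) U"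
      proof (rule Ck_on_bilinear[OF assms(1) bounded_bilinear_scaleR])
        show "Ck_on k (\<lambda>x. D g x v \<bullet> b) U"
          using Suc.prems(1)
          by (intro Ck_on_bounded_linear_comp[OF assms(1) bounded_linear_inner_left]) simp
        show "Ck_on k (\<lambda>x. D f (g x) b) U"
          using Suc.prems(2) by (intro Suc.IH Ck_on_SucD[OF Suc.prems(1)]) simp
      qed
    qed
  qed (rule assms(1))
qed

text \<open>Differentiability and derivatives at a point depend on the germ only. This is what
  extracts smoothness from \<open>local_diffeo\<close>, which grants it on a neighbourhood of each
  point.\<close>

lemma Ck_on_local:
  assumes "\<And>x. x \<in> U \<Longrightarrow> \<exists>W. open W \<and> x \<in> W \<and> Ck_on k f W"
  shows "Ck_on k f U"
  using assms
proof (induction k arbitrary: f)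
  case 0
  show ?case
    unfolding Ck_on.simps
  proof (rule continuous_at_imp_continuous_on, rule ballI)
    fix x assume "x \<in> U"
    then obtain W where "open W" "x \<in> W" "continuous_on W f" using 0 by auto
    then show "isCont f x" by (simp add: continuous_on_eq_continuous_at)
  qed
next
  case (Suc k)
  have "f differentiable (at x)" if "x \<in> U" for x
    using Suc.prems[OF that] by auto
  moreover have "Ck_on k (\<lambda>x. D f x v) U" for v
    using Suc.prems unfolding Ck_on.simps(2) by (intro Suc.IH) blast
  ultimately show ?case by simp
qed

lemma Ck_on_open_ident: "open U \<Longrightarrow> Ck_on k (\<lambda>x. x) U"
  by (cases k) (simp_all add: Ck_on_const)

section \<open>Closure properties of smooth maps\<close>

lemma smooth_on_const: "open U \<Longrightarrow> smooth_on (\<lambda>x. c) U"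
  and smooth_on_ident: "open U \<Longrightarrow> smooth_on (\<lambda>x. x) U"
  by (auto simp: smooth_on_def Ck_on_const Ck_on_open_ident)

lemma smooth_on_add: "open U \<Longrightarrow> smooth_on f U \<Longrightarrow> smooth_on g U \<Longrightarrow> smooth_on (\<lambda>x. f x + g x) U"
  by (simp add: smooth_on_def Ck_on_add)

lemma smooth_on_bounded_linear:
  "open U \<Longrightarrow> smooth_on f U \<Longrightarrow> bounded_linear h \<Longrightarrow> smooth_on (\<lambda>x. h (f x)) U"
  by (simp add: smooth_on_def Ck_on_bounded_linear_comp)

lemma smooth_on_bilinear:
  "open U \<Longrightarrow> smooth_on f U \<Longrightarrow> smooth_on g U \<Longrightarrow> bounded_bilinear b \<Longrightarrow> smooth_on (\<lambda>x. b (f x) (g x)) U"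
  by (simp add: smooth_on_def Ck_on_bilinear)

lemma smooth_on_sum:
  "open U \<Longrightarrow> (\<And>i. i \<in> A \<Longrightarrow> smooth_on (f i) U) \<Longrightarrow> smooth_on (\<lambda>x. \<Sum>i\<in>A. f i x) U"
  by (simp add: smooth_on_def Ck_on_sum)

lemma smooth_on_cong: "open U \<Longrightarrow> smooth_on f U \<Longrightarrow> (\<And>x. x \<in> U \<Longrightarrow> f x = g x) \<Longrightarrow> smooth_on g U"
  unfolding smooth_on_def using Ck_on_cong by blast

lemma smooth_on_subset: "smooth_on f U \<Longrightarrow> V \<subseteq> U \<Longrightarrow> smooth_on f V"
  unfolding smooth_on_def using Ck_on_subset by blast

lemma smooth_on_local:
  assumes "\<And>x. x \<in> U \<Longrightarrow> \<exists>W. open W \<and> x \<in> W \<and> smooth_on f W"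
  shows "smooth_on f U"
  unfolding smooth_on_def
proof (intro allI Ck_on_local)
  show "\<exists>W. open W \<and> x \<in> W \<and> Ck_on k f W" if "x \<in> U" for k x
    using assms[OF that] unfolding smooth_on_def by auto
qed

lemma smooth_on_compose:
  fixes g :: "'a::real_normed_vector \<Rightarrow> 'b::euclidean_space"
  shows "open U \<Longrightarrow> open V \<Longrightarrow> g ` U \<subseteq> V \<Longrightarrow> smooth_on g U \<Longrightarrow> smooth_on f V \<Longrightarrow>
    smooth_on (\<lambda>x. f (g x)) U"
  unfolding smooth_on_def using Ck_on_compose by blast

lemma smooth_on_D: "smooth_on f U \<Longrightarrow> smooth_on (\<lambda>x. D f x v) U"
  unfolding smooth_on_def using Ck_on.simps(2) by blast

lemma smooth_on_has_derivative: "smooth_on f U \<Longrightarrow> x \<in> U \<Longrightarrow> (f has_derivative D f x) (at x)"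
  unfolding smooth_on_def using Ck_on_Suc_has_derivative by blast

lemma smooth_on_differentiable: "smooth_on f U \<Longrightarrow> x \<in> U \<Longrightarrow> f differentiable (at x)"
  using smooth_on_has_derivative differentiable_def by blast

lemma smooth_on_continuous_on: "smooth_on f U \<Longrightarrow> continuous_on U f"
  unfolding smooth_on_def by (metis Ck_on.simps(1))

lemma smooth_on_mult:
  fixes f g :: "_ \<Rightarrow> real"
  shows "open U \<Longrightarrow> smooth_on f U \<Longrightarrow> smooth_on g U \<Longrightarrow> smooth_on (\<lambda>x. f x * g x) U"
  using smooth_on_bilinear[OF _ _ _ bounded_bilinear_mult] .

lemma smooth_on_scaleR:
  fixes f :: "_ \<Rightarrow> real"
  shows "open U \<Longrightarrow> smooth_on f U \<Longrightarrow> smooth_on g U \<Longrightarrow> smooth_on (\<lambda>x. f x *\<^sub>R g x) U"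
  using smooth_on_bilinear[OF _ _ _ bounded_bilinear_scaleR] .

lemma smooth_on_minus: "open U \<Longrightarrow> smooth_on f U \<Longrightarrow> smooth_on (\<lambda>x. - f x) U"
  using smooth_on_bounded_linear[OF _ _ bounded_linear_minus[OF bounded_linear_ident]] .

lemma smooth_on_diff: "open U \<Longrightarrow> smooth_on f U \<Longrightarrow> smooth_on g U \<Longrightarrow> smooth_on (\<lambda>x. f x - g x) U"
  using smooth_on_add[of U f "\<lambda>x. - g x"] smooth_on_minus[of U g] by simp

lemma smooth_on_prod:
  fixes f :: "'i \<Rightarrow> 'a::real_normed_vector \<Rightarrow> real"
  assumes "open U" "\<And>i. i \<in> A \<Longrightarrow> smooth_on (f i) U"
  shows "smooth_on (\<lambda>x. \<Prod>i\<in>A. f i x) U"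
  using assms(2)
proof (induction A rule: infinite_finite_induct)
  case (insert a F)
  then show ?case using smooth_on_mult[OF assms(1), of "f a" "\<lambda>x. \<Prod>i\<in>F. f i x"] by simp
qed (simp_all add: smooth_on_const assms(1))

lemma smooth_on_power:
  fixes f :: "_ \<Rightarrow> real"
  assumes "open U" "smooth_on f U"
  shows "smooth_on (\<lambda>x. f x ^ n) U"
proof (induction n)
  case (Suc n)
  show ?case unfolding power_Suc by (rule smooth_on_mult[OF assms Suc])
qed (simp add: smooth_on_const assms)

text \<open>The derivative of the reciprocal is a polynomial in the reciprocal itself and
  \<open>D f\<close>, so class k of the reciprocal yields class k + 1.\<close>

lemma smooth_on_inverse:
  fixes f :: "'a::real_normed_vector \<Rightarrow> real"
  assumes "open U" "smooth_on f U" "\<And>x. x \<in> U \<Longrightarrow> f x \<noteq> 0"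
  shows "smooth_on (\<lambda>x. inverse (f x)) U"
proof -
  have "Ck_on k (\<lambda>x. inverse (f x)) U" for k
  proof (induction k)
    case 0
    then show ?case
      using smooth_on_continuous_on[OF assms(2)] assms(3) by (simp add: continuous_on_inverse)
  next
    case (Suc k)
    show ?case
    proof (rule Ck_on_SucI[where f'="\<lambda>x v. - (inverse (f x) * D f x v * inverse (f x))"])
      show "((\<lambda>x. inverse (f x)) has_derivative (\<lambda>v. - (inverse (f x) * D f x v * inverse (f x)))) (at x)"
        if "x \<in> U" for x
        using Deriv.has_derivative_inverse[OF assms(3) smooth_on_has_derivative[OF assms(2)], OF that that] .
      show "Ck_on k (\<lambda>x. - (inverse (f x) * D f x v * inverse (f x))) U" for v
      proof -
        have "Ck_on k (\<lambda>x. D f x v) U"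
          using smooth_on_D[OF assms(2)] by (simp add: smooth_on_def)
        from Ck_on_mult[OF assms(1) Ck_on_mult[OF assms(1) Suc this] Suc] show ?thesis
          by (rule Ck_on_bounded_linear_comp[OF assms(1) bounded_linear_minus[OF bounded_linear_ident]])
      qed
    qed (rule assms(1))
  qed
  then show ?thesis by (simp add: smooth_on_def)
qed

lemma smooth_on_divide:
  fixes f g :: "'a::real_normed_vector \<Rightarrow> real"
  shows "open U \<Longrightarrow> smooth_on f U \<Longrightarrow> smooth_on g U \<Longrightarrow> (\<And>x. x \<in> U \<Longrightarrow> g x \<noteq> 0) \<Longrightarrow>
    smooth_on (\<lambda>x. f x / g x) U"
  using smooth_on_mult[of U f "\<lambda>x. inverse (g x)"] smooth_on_inverse[of U g] by (simp add: divide_inverse)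

lemma smooth_on_blinfun_apply: "open U \<Longrightarrow> smooth_on \<alpha> U \<Longrightarrow> smooth_on V U \<Longrightarrow> smooth_on (\<lambda>x. blinfun_apply (\<alpha> x) (V x)) U"
  by (rule smooth_on_bilinear[OF _ _ _ bounded_bilinear_blinfun_apply])


lemma smooth_on_euclidean:
  fixes f :: "'a::real_normed_vector \<Rightarrow> 'b::euclidean_space"
  assumes "open U" "\<And>b. b \<in> Basis \<Longrightarrow> smooth_on (\<lambda>x. f x \<bullet> b) U"
  shows "smooth_on f U"
proof -
  have "smooth_on (\<lambda>x. \<Sum>b\<in>Basis. (f x \<bullet> b) *\<^sub>R b) U"
    by (intro smooth_on_sum smooth_on_scaleR smooth_on_const assms)
  then show ?thesis by (simp add: euclidean_representation)
qed

lemma smooth_on_inner: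
  fixes f :: "'a::real_normed_vector \<Rightarrow> 'b::real_inner"
  shows "open U \<Longrightarrow> smooth_on f U \<Longrightarrow> smooth_on (\<lambda>x. f x \<bullet> b) U"
  by (rule smooth_on_bounded_linear[OF _ _ bounded_linear_inner_left])

lemma covector_expand: "(\<alpha> :: 'a::euclidean_space covector) = (\<Sum>b\<in>Basis. \<alpha> b *\<^sub>R blinfun_inner_left b)"
proof (rule blinfun_euclidean_eqI)
  fix j :: 'a assume "j \<in> Basis"
  then show "\<alpha> j = (\<Sum>b\<in>Basis. \<alpha> b *\<^sub>R blinfun_inner_left b) j"
    by (simp add: blinfun.sum_left scaleR_blinfun.rep_eq inner_Basis if_distrib sum.delta cong: if_cong)
qed

text \<open>A covector is a finite combination of fixed coordinate functionals, so smoothness into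
  the operator space can be tested on basis vectors.\<close>

lemma smooth_on_covector:
  fixes \<alpha> :: "'a::real_normed_vector \<Rightarrow> 'b::euclidean_space covector"
  assumes "open U" "\<And>b. b \<in> Basis \<Longrightarrow> smooth_on (\<lambda>x. \<alpha> x b) U"
  shows "smooth_on \<alpha> U"
proof -
  have "smooth_on (\<lambda>x. \<Sum>b\<in>Basis. \<alpha> x b *\<^sub>R blinfun_inner_left b) U"
    by (intro smooth_on_sum smooth_on_scaleR smooth_on_const assms)
  then show ?thesis
    by (simp flip: covector_expand)
qed

lemma smooth_on_apply:
  "open U \<Longrightarrow> smooth_on \<alpha> U \<Longrightarrow> smooth_on (\<lambda>x. blinfun_apply (\<alpha> x) v) U"
  by (rule smooth_on_blinfun_apply[OF _ _ smooth_on_const])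

section \<open>Calculation rules for directional derivatives\<close>

lemma D_blinfun_apply:
  assumes "\<alpha> differentiable (at x)"
  shows "D (\<lambda>y. blinfun_apply (\<alpha> y) v) x u = blinfun_apply (D \<alpha> x u) v"
proof -
  have "(\<alpha> has_derivative D \<alpha> x) (at x)"
    using assms frechet_derivative_works by auto
  from bounded_linear.has_derivative[OF bounded_linear_apply_blinfun this, of v]
  show ?thesis by (simp add: D_eqI)
qed

lemma D_mult:
  fixes f g :: "_ \<Rightarrow> real"
  assumes "f differentiable (at x)" "g differentiable (at x)"
  shows "D (\<lambda>y. f y * g y) x u = f x * D g x u + D f x u * g x"
  using fun_cong[OF D_eqI[OF has_derivative_mult[OF assms[unfolded frechet_derivative_works]]]] .

lemma D_add:
  assumes "f differentiable (at x)" "g differentiable (at x)"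
  shows "D (\<lambda>y. f y + g y) x u = D f x u + D g x u"
  using fun_cong[OF D_eqI[OF has_derivative_add[OF assms[unfolded frechet_derivative_works]]]] .

lemma D_diff:
  assumes "f differentiable (at x)" "g differentiable (at x)"
  shows "D (\<lambda>y. f y - g y) x u = D f x u - D g x u"
  using fun_cong[OF D_eqI[OF has_derivative_diff[OF assms[unfolded frechet_derivative_works]]]] .

lemma D_compose:
  assumes "g differentiable (at x)" "f differentiable (at (g x))"
  shows "D (\<lambda>y. f (g y)) x u = D f (g x) (D g x u)"
  using frechet_derivative_compose[OF assms] by (simp add: o_def)

lemma D_bounded_linear: "bounded_linear h \<Longrightarrow> D h x = h"
  by (rule D_eqI) (rule bounded_linear_imp_has_derivative)

lemma D_bounded_linear_comp:
  assumes "bounded_linear h" "f differentiable (at x)"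
  shows "D (\<lambda>y. h (f y)) x u = h (D f x u)"
  using D_compose[OF assms(2), of h u] bounded_linear_imp_differentiable[OF assms(1)]
  by (simp add: D_bounded_linear assms(1))

lemma bounded_linear_D: "f differentiable (at x) \<Longrightarrow> bounded_linear (D f x)"
  by (rule has_derivative_bounded_linear[of f _ "at x"]) (simp flip: frechet_derivative_works)

lemma differentiable_blinfun_apply:
  "\<alpha> differentiable (at x) \<Longrightarrow> (\<lambda>y. blinfun_apply (\<alpha> y) v) differentiable (at x)"
  by (rule differentiableI[OF bounded_linear.has_derivative[OF bounded_linear_apply_blinfun]])
    (simp only: frechet_derivative_works)


subsection \<open>Symmetry of second derivatives\<close>

lemma mvt_along:
  fixes f :: "'a::real_normed_vector \<Rightarrow> real"
  assumes "0 < h" "\<And>s. 0 \<le> s \<Longrightarrow> s \<le> h \<Longrightarrow> f differentiable (at (x + s *\<^sub>R u))"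
  shows "\<exists>s>0. s < h \<and> f (x + h *\<^sub>R u) - f x = h * D f (x + s *\<^sub>R u) u"
proof -
  have "((\<lambda>s. f (x + s *\<^sub>R u)) has_real_derivative D f (x + s *\<^sub>R u) u) (at s)" if "0 \<le> s" "s \<le> h" for s
  proof -
    have f: "(f has_derivative D f (x + s *\<^sub>R u)) (at (x + s *\<^sub>R u))"
      using assms(2)[OF that] frechet_derivative_works by auto
    have "((\<lambda>s. x + s *\<^sub>R u) has_derivative (\<lambda>t. t *\<^sub>R u)) (at s)"
      by (auto intro!: derivative_eq_intros)
    from has_derivative_compose_at[OF this f]
    have "((\<lambda>s. f (x + s *\<^sub>R u)) has_derivative (\<lambda>t. D f (x + s *\<^sub>R u) (t *\<^sub>R u))) (at s)" .
    moreover have "D f (x + s *\<^sub>R u) (t *\<^sub>R u) = D f (x + s *\<^sub>R u) u * t" for t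
      using linear_scale[OF has_derivative_linear[OF f], of t u] by simp
    ultimately show ?thesis
      by (simp add: has_field_derivative_def mult_commute_abs)
  qed
  from MVT2[OF assms(1) this] show ?thesis by auto
qed

text \<open>Two uses of the mean value theorem: along \<open>u\<close> for the increment of
  \<open>f\<close> in direction \<open>v\<close>, then along \<open>v\<close> for the
  \<open>u\<close>-derivative. The second difference on the left is symmetric in \<open>u\<close>
  and \<open>v\<close>, which is the point of the lemma.\<close>

lemma second_difference:
  fixes f :: "'a::real_normed_vector \<Rightarrow> real"
  assumes f: "smooth_on f (ball x e)" and h: "0 < h" "h * (norm u + norm v) < e"
  shows "\<exists>s t. 0 < s \<and> s < h \<and> 0 < t \<and> t < h \<and>
    f (x + h *\<^sub>R u + h *\<^sub>R v) - f (x + h *\<^sub>R u) - (f (x + h *\<^sub>R v) - f x) =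
    h * (h * D (\<lambda>y. D f y u) (x + s *\<^sub>R u + t *\<^sub>R v) v)"
proof -
  have in_ball: "x + s *\<^sub>R u + t *\<^sub>R v \<in> ball x e" if "0 \<le> s" "s \<le> h" "0 \<le> t" "t \<le> h" for s t
  proof -
    have "norm (s *\<^sub>R u + t *\<^sub>R v) \<le> s * norm u + t * norm v"
      using norm_triangle_ineq[of "s *\<^sub>R u" "t *\<^sub>R v"] that by simp
    also have "\<dots> \<le> h * norm u + h * norm v"
      using that by (intro add_mono mult_right_mono) auto
    finally have "norm (s *\<^sub>R u + t *\<^sub>R v) < e"
      using h by (simp add: algebra_simps)
    moreover have "dist x (x + s *\<^sub>R u + t *\<^sub>R v) = norm (s *\<^sub>R u + t *\<^sub>R v)"
      by (metis add.assoc dist_add_cancel dist_0_norm add.right_neutral)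
    ultimately show ?thesis by simp
  qed
  have shift: "((\<lambda>y. y + h *\<^sub>R v) has_derivative (\<lambda>w. w)) (at y)" for y
    by (auto intro!: derivative_eq_intros)
  let ?F = "\<lambda>y. f (y + h *\<^sub>R v) - f y"
  have dF: "(?F has_derivative (\<lambda>w. D f (x + s *\<^sub>R u + h *\<^sub>R v) w - D f (x + s *\<^sub>R u) w)) (at (x + s *\<^sub>R u))"
    if "0 \<le> s" "s \<le> h" for s
    using in_ball[OF that, of 0] in_ball[OF that, of h] h
    by (intro has_derivative_diff has_derivative_compose_at[OF shift] smooth_on_has_derivative[OF f]) auto
  obtain s where s: "0 < s" "s < h" "?F (x + h *\<^sub>R u) - ?F x = h * D ?F (x + s *\<^sub>R u) u"
    using mvt_along[OF h(1), of ?F x u] dF unfolding differentiable_def by auto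
  have "(\<lambda>y. D f y u) differentiable (at (x + s *\<^sub>R u + t *\<^sub>R v))" if "0 \<le> t" "t \<le> h" for t
    using smooth_on_differentiable[OF smooth_on_D[OF f] in_ball] s that by auto
  from mvt_along[OF h(1) this] obtain t where "0 < t" "t < h"
    "D f (x + s *\<^sub>R u + h *\<^sub>R v) u - D f (x + s *\<^sub>R u) u = h * D (\<lambda>y. D f y u) (x + s *\<^sub>R u + t *\<^sub>R v) v"
    by auto
  moreover have "D ?F (x + s *\<^sub>R u) u = D f (x + s *\<^sub>R u + h *\<^sub>R v) u - D f (x + s *\<^sub>R u) u"
    using D_eqI[OF dF] s by simp
  ultimately show ?thesis using s by (intro exI[of _ s] exI[of _ t]) simp
qed

text \<open>The symmetric second difference equals \<open>h * h\<close> times either mixed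
  derivative at some point near \<open>x\<close>; continuity of both mixed derivatives then forces
  their values at \<open>x\<close> to coincide.\<close>

lemma D_D_commute_real:
  fixes f :: "'a::real_normed_vector \<Rightarrow> real"
  assumes "open U" "smooth_on f U" "x \<in> U"
  shows "D (\<lambda>y. D f y u) x v = D (\<lambda>y. D f y v) x u"
proof (rule ccontr)
  let ?G = "\<lambda>u v y. D (\<lambda>y. D f y u) y v"
  assume neq: "?G u v x \<noteq> ?G v u x"
  \<comment> \<open>Half the supposed gap: values within \<open>r\<close> of the two mixed
    derivatives at \<open>x\<close> can never be equal.\<close>
  define r where "r = \<bar>?G u v x - ?G v u x\<bar> / 2"
  have "r > 0" using neq by (simp add: r_def)
  have cont: "isCont (?G u v) x" for u v
    using smooth_on_continuous_on[OF smooth_on_D[OF smooth_on_D[OF assms(2)]]] assms(1,3)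
    by (simp add: continuous_on_eq_continuous_at)
  obtain d1 where d1: "d1 > 0" "\<And>y. dist y x < d1 \<Longrightarrow> dist (?G u v y) (?G u v x) < r"
    using cont[of u v] \<open>r > 0\<close> unfolding continuous_at_eps_delta by metis
  obtain d2 where d2: "d2 > 0" "\<And>y. dist y x < d2 \<Longrightarrow> dist (?G v u y) (?G v u x) < r"
    using cont[of v u] \<open>r > 0\<close> unfolding continuous_at_eps_delta by metis
  obtain d3 where d3: "d3 > 0" "ball x d3 \<subseteq> U"
    using assms(1,3) by (meson open_contains_ball)
  define e where "e = min d1 (min d2 d3)"
  have e: "e > 0" "e \<le> d1" "e \<le> d2" "e \<le> d3" using d1 d2 d3 by (auto simp: e_def)
  \<comment> \<open>The summand 1 keeps the denominator positive when \<open>u\<close> and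
    \<open>v\<close> both vanish.\<close>
  define h where "h = e / (2 * (norm u + norm v + 1))"
  have "0 < h" using e by (simp add: h_def add_nonneg_pos)
  have "h * (norm u + norm v) < e"
  proof -
    have "h * (norm u + norm v) \<le> h * (norm u + norm v + 1)" using \<open>0 < h\<close> by simp
    also have "\<dots> = e / 2"
      using add_nonneg_pos[of "norm u + norm v" 1] by (simp add: h_def field_simps)
    finally show ?thesis using e by simp
  qed
  have f: "smooth_on f (ball x e)"
    using smooth_on_subset[OF assms(2)] d3 e by (meson order_trans subset_ball)
  \<comment> \<open>Stated for a pair \<open>a\<close>, \<open>b\<close> with the same sum of norms
    so that it serves both orders of \<open>u\<close> and \<open>v\<close>.\<close>
  have near: "dist (x + s *\<^sub>R a + t *\<^sub>R b) x < e"
    if "0 < s" "s < h" "0 < t" "t < h" "norm a + norm b = norm u + norm v" for s t a b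
  proof -
    have "dist (x + s *\<^sub>R a + t *\<^sub>R b) x = norm (s *\<^sub>R a + t *\<^sub>R b)"
      by (simp add: dist_norm algebra_simps)
    also have "\<dots> \<le> s * norm a + t * norm b"
      using norm_triangle_ineq[of "s *\<^sub>R a" "t *\<^sub>R b"] that by simp
    also have "\<dots> \<le> h * norm a + h * norm b"
      using that by (intro add_mono mult_right_mono) auto
    also have "\<dots> = h * (norm u + norm v)" using that by (metis distrib_left)
    finally show ?thesis using \<open>h * (norm u + norm v) < e\<close> by simp
  qed
  obtain s t where st: "0 < s" "s < h" "0 < t" "t < h"
    "f (x + h *\<^sub>R u + h *\<^sub>R v) - f (x + h *\<^sub>R u) - (f (x + h *\<^sub>R v) - f x) =
       h * (h * ?G u v (x + s *\<^sub>R u + t *\<^sub>R v))"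
    using second_difference[OF f \<open>0 < h\<close> \<open>h * (norm u + norm v) < e\<close>] by auto
  obtain s' t' where st': "0 < s'" "s' < h" "0 < t'" "t' < h"
    "f (x + h *\<^sub>R v + h *\<^sub>R u) - f (x + h *\<^sub>R v) - (f (x + h *\<^sub>R u) - f x) =
       h * (h * ?G v u (x + s' *\<^sub>R v + t' *\<^sub>R u))"
    using second_difference[OF f \<open>0 < h\<close>, of v u] \<open>h * (norm u + norm v) < e\<close>
    by (auto simp: add.commute)
  have "f (x + h *\<^sub>R v + h *\<^sub>R u) = f (x + h *\<^sub>R u + h *\<^sub>R v)"
    by (simp add: ac_simps)
  then have "h * (h * ?G u v (x + s *\<^sub>R u + t *\<^sub>R v)) = h * (h * ?G v u (x + s' *\<^sub>R v + t' *\<^sub>R u))"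
    using st(5) st'(5) by linarith
  with \<open>0 < h\<close> have "?G u v (x + s *\<^sub>R u + t *\<^sub>R v) = ?G v u (x + s' *\<^sub>R v + t' *\<^sub>R u)" by simp
  moreover have "dist (?G u v (x + s *\<^sub>R u + t *\<^sub>R v)) (?G u v x) < r"
    using d1(2) near[OF st(1-4)] e by force
  moreover have "dist (?G v u (x + s' *\<^sub>R v + t' *\<^sub>R u)) (?G v u x) < r"
    using d2(2) near[OF st'(1-4), of v u] e by force
  ultimately show False
    by (simp add: r_def dist_real_def abs_if split: if_splits)
qed

lemma D_D_commute:
  fixes f :: "'a::real_normed_vector \<Rightarrow> 'b::euclidean_space"
  assumes "open U" "smooth_on f U" "x \<in> U"
  shows "D (\<lambda>y. D f y u) x v = D (\<lambda>y. D f y v) x u"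
proof (rule euclidean_eqI)
  fix b :: 'b assume "b \<in> Basis"
  have 1: "D (\<lambda>y. f y \<bullet> b) y w = D f y w \<bullet> b" if "y \<in> U" for y w
    by (rule D_bounded_linear_comp[OF bounded_linear_inner_left smooth_on_differentiable[OF assms(2) that]])
  have 2: "D (\<lambda>y. D f y w) x z \<bullet> b = D (\<lambda>y. D (\<lambda>y. f y \<bullet> b) y w) x z" for w z
  proof -
    have "D (\<lambda>y. D f y w) x z \<bullet> b = D (\<lambda>y. D f y w \<bullet> b) x z"
      by (rule D_bounded_linear_comp[OF bounded_linear_inner_left
            smooth_on_differentiable[OF smooth_on_D[OF assms(2)] assms(3)], symmetric])
    then show ?thesis
      using D_cong[OF assms(1,3), of "\<lambda>y. D (\<lambda>y. f y \<bullet> b) y w" "\<lambda>y. D f y w \<bullet> b"] 1 by simp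
  qed
  show "D (\<lambda>y. D f y u) x v \<bullet> b = D (\<lambda>y. D f y v) x u \<bullet> b"
    unfolding 2 by (rule D_D_commute_real[OF assms(1) smooth_on_inner[OF assms(1,2)] assms(3)])
qed


section \<open>Exterior derivative\<close>

definition dd :: "('a::real_normed_vector \<Rightarrow> real) \<Rightarrow> 'a one_form" where
  "dd f x = Blinfun (D f x)"

lemma dd_apply: "f differentiable (at x) \<Longrightarrow> dd f x v = D f x v"
  by (simp add: dd_def bounded_linear_Blinfun_apply bounded_linear_D)

lemma dd_const: "dd (\<lambda>_. c) x = 0"
  by (rule blinfun_eqI) (simp add: dd_apply)

lemma smooth_on_dd:
  fixes f :: "'a::euclidean_space \<Rightarrow> real"
  assumes "open U" "smooth_on f U"
  shows "smooth_on (dd f) U"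
proof (rule smooth_on_covector[OF assms(1)])
  show "smooth_on (\<lambda>x. dd f x b) U" for b
    by (rule smooth_on_cong[OF assms(1) smooth_on_D[OF assms(2)]])
      (simp add: dd_apply smooth_on_differentiable[OF assms(2)])
qed

lemma ext_d_cong:
  assumes "open U" "x \<in> U" "\<And>y. y \<in> U \<Longrightarrow> \<alpha> y = \<beta> y"
  shows "ext_d \<alpha> x = ext_d \<beta> x"
  using D_cong[OF assms] by (simp add: ext_d_def fun_eq_iff)

lemma ext_d_add:
  assumes "\<alpha> differentiable (at x)" "\<beta> differentiable (at x)"
  shows "ext_d (\<lambda>y. \<alpha> y + \<beta> y) x u v = ext_d \<alpha> x u v + ext_d \<beta> x u v"
  by (simp add: ext_d_def D_add assms blinfun.add_left)

lemma ext_d_diff: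
  assumes "\<alpha> differentiable (at x)" "\<beta> differentiable (at x)"
  shows "ext_d (\<lambda>y. \<alpha> y - \<beta> y) x u v = ext_d \<alpha> x u v - ext_d \<beta> x u v"
  by (simp add: ext_d_def D_diff assms blinfun.diff_left)

lemma ext_d_scaleR:
  assumes "f differentiable (at x)" "\<alpha> differentiable (at x)"
  shows "ext_d (\<lambda>y. f y *\<^sub>R \<alpha> y) x u v = (dd f x \<curlywedge> \<alpha> x) u v + f x * ext_d \<alpha> x u v"
proof -
  have "D (\<lambda>y. f y *\<^sub>R \<alpha> y) x = (\<lambda>w. f x *\<^sub>R D \<alpha> x w + D f x w *\<^sub>R \<alpha> x)"
    using assms by (intro D_eqI has_derivative_scaleR) (simp_all add: frechet_derivative_works)
  then show ?thesis
    by (simp add: ext_d_def wedge_def dd_apply[OF assms(1)] blinfun.add_left blinfun.scaleR_left algebra_simps)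
qed

lemma ext_d_dd:
  fixes f :: "'a::euclidean_space \<Rightarrow> real"
  assumes "open U" "smooth_on f U" "x \<in> U"
  shows "ext_d (dd f) x u v = 0"
proof -
  have "D (dd f) x u v = D (\<lambda>y. D f y v) x u" for u v
  proof -
    have "D (dd f) x u v = D (\<lambda>y. dd f y v) x u"
      by (rule D_blinfun_apply[symmetric]) (rule smooth_on_differentiable[OF smooth_on_dd[OF assms(1,2)] assms(3)])
    then show ?thesis
      using D_cong[OF assms(1,3), of "\<lambda>y. dd f y v" "\<lambda>y. D f y v"]
      by (simp add: dd_apply smooth_on_differentiable[OF assms(2)])
  qed
  then show ?thesis
    using D_D_commute[OF assms, of u v] by (simp add: ext_d_def)
qed

lemma pullback_apply:
  "f differentiable (at x) \<Longrightarrow> pullback f \<alpha> x v = \<alpha> (f x) (D f x v)"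
  by (simp add: pullback_def bounded_linear_Blinfun_apply bounded_linear_D)

lemma smooth_on_pullback:
  fixes f :: "'a::euclidean_space \<Rightarrow> 'b::euclidean_space"
  assumes "open U" "open V" "f ` U \<subseteq> V" "smooth_on f U" "smooth_on \<alpha> V"
  shows "smooth_on (pullback f \<alpha>) U"
proof (rule smooth_on_covector[OF assms(1)])
  fix b :: 'a
  have "smooth_on (\<lambda>x. \<alpha> (f x) (D f x b)) U"
    by (rule smooth_on_blinfun_apply[OF assms(1) smooth_on_compose[OF assms] smooth_on_D[OF assms(4)]])
  then show "smooth_on (\<lambda>x. pullback f \<alpha> x b) U"
    by (rule smooth_on_cong[OF assms(1)]) (simp add: pullback_apply smooth_on_differentiable[OF assms(4)])
qed

text \<open>Differentiating the pullback leaves, besides the expected term, \<open>\<alpha>\<close>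
  applied to the second derivative of \<open>f\<close>. That term is symmetric in \<open>u\<close>
  and \<open>v\<close> and cancels in the antisymmetrization.\<close>

lemma ext_d_pullback:
  fixes f :: "'a::euclidean_space \<Rightarrow> 'b::euclidean_space"
  assumes "open U" "open V" "f ` U \<subseteq> V" "smooth_on f U" "smooth_on \<alpha> V" "x \<in> U"
  shows "ext_d (pullback f \<alpha>) x u v = ext_d \<alpha> (f x) (D f x u) (D f x v)"
proof -
  note df = smooth_on_differentiable[OF assms(4)]
  have d: "D (pullback f \<alpha>) x u v = D \<alpha> (f x) (D f x u) (D f x v) + \<alpha> (f x) (D (\<lambda>y. D f y v) x u)" for u v
  proof -
    have "f x \<in> V" using assms(3,6) by auto
    have a: "(\<lambda>y. \<alpha> (f y)) differentiable (at x)"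
      by (rule smooth_on_differentiable[OF smooth_on_compose[OF assms(1-5)] assms(6)])
    have "D (pullback f \<alpha>) x u v = D (\<lambda>y. pullback f \<alpha> y v) x u"
      by (rule D_blinfun_apply[symmetric]) (rule smooth_on_differentiable[OF smooth_on_pullback[OF assms(1-5)] assms(6)])
    also have "\<dots> = D (\<lambda>y. \<alpha> (f y) (D f y v)) x u"
      using D_cong[OF assms(1,6), of "\<lambda>y. pullback f \<alpha> y v" "\<lambda>y. \<alpha> (f y) (D f y v)"]
      by (simp add: pullback_apply df)
    also have "\<dots> = \<alpha> (f x) (D (\<lambda>y. D f y v) x u) + D (\<lambda>y. \<alpha> (f y)) x u (D f x v)"
      using fun_cong[OF D_eqI[OF bounded_bilinear.FDERIV[OF bounded_bilinear_blinfun_apply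
            a[unfolded frechet_derivative_works]
            smooth_on_has_derivative[OF smooth_on_D[OF assms(4)] assms(6)]]]] .
    also have "D (\<lambda>y. \<alpha> (f y)) x u = D \<alpha> (f x) (D f x u)"
      by (rule D_compose[OF df[OF assms(6)] smooth_on_differentiable[OF assms(5) \<open>f x \<in> V\<close>]])
    finally show ?thesis by simp
  qed
  show ?thesis
    unfolding ext_d_def d using D_D_commute[OF assms(1,4,6), of u v] by simp
qed

lemma ext_d_add_left: "\<alpha> differentiable (at x) \<Longrightarrow> ext_d \<alpha> x (u + u') v = ext_d \<alpha> x u v + ext_d \<alpha> x u' v"
  and ext_d_scale_left: "\<alpha> differentiable (at x) \<Longrightarrow> ext_d \<alpha> x (c *\<^sub>R u) v = c * ext_d \<alpha> x u v"
  and ext_d_commute: "ext_d \<alpha> x u v = - ext_d \<alpha> x v u"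
  unfolding ext_d_def using bounded_linear_D[of \<alpha> x]
  by (simp_all add: linear_add linear_scale bounded_linear.linear blinfun.add_left blinfun.add_right
      blinfun.scaleR_left blinfun.scaleR_right algebra_simps)

text \<open>The arguments are vector fields, not constant vectors, so the derivative of
  \<open>\<alpha>\<close> is again expanded in a basis before smoothness in constant directions
  applies.\<close>

lemma smooth_on_ext_d:
  fixes \<alpha> :: "('a::euclidean_space) one_form"
  assumes "open U" "smooth_on \<alpha> U" "smooth_on X U" "smooth_on Y U"
  shows "smooth_on (\<lambda>x. ext_d \<alpha> x (X x) (Y x)) U"
proof -
  have "smooth_on (\<lambda>x. \<Sum>b\<in>Basis. (X x \<bullet> b) *\<^sub>R D \<alpha> x b) U" if X: "smooth_on X U" for X :: "'a \<Rightarrow> 'a"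
    by (intro smooth_on_sum smooth_on_scaleR smooth_on_inner[OF assms(1) X] smooth_on_D[OF assms(2)] assms(1))
  moreover have "(\<Sum>b\<in>Basis. (w \<bullet> b) *\<^sub>R D \<alpha> x b) = D \<alpha> x w" if "x \<in> U" for x w
  proof -
    have lin: "linear (D \<alpha> x)"
      by (rule has_derivative_linear[OF smooth_on_has_derivative[OF assms(2) that]])
    have "D \<alpha> x w = D \<alpha> x (\<Sum>b\<in>Basis. (w \<bullet> b) *\<^sub>R b)"
      by (simp add: euclidean_representation)
    then show ?thesis
      by (simp only: linear_sum[OF lin] linear_scale[OF lin])
  qed
  ultimately have "smooth_on (\<lambda>x. D \<alpha> x (X x)) U" if "smooth_on X U" for X :: "'a \<Rightarrow> 'a"
    by (rule smooth_on_cong[OF assms(1)]) (use that in auto)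
  from smooth_on_blinfun_apply[OF assms(1) this[OF assms(3)] assms(4)]
    smooth_on_blinfun_apply[OF assms(1) this[OF assms(4)] assms(3)]
  show ?thesis
    unfolding ext_d_def by (rule smooth_on_diff[OF assms(1)])
qed

text \<open>Exterior derivative of a 2-form, evaluated on constant vector fields. These commute, so
  no bracket terms occur, and the cyclic sum matches the convention without factorials.\<close>

definition ext_d2 :: "('a::real_normed_vector \<Rightarrow> 'a \<Rightarrow> 'a \<Rightarrow> real) \<Rightarrow> 'a \<Rightarrow> 'a \<Rightarrow> 'a \<Rightarrow> 'a \<Rightarrow> real" where
  "ext_d2 \<omega> x u v w = D (\<lambda>y. \<omega> y v w) x u + D (\<lambda>y. \<omega> y w u) x v + D (\<lambda>y. \<omega> y u v) x w"

text \<open>The six second derivatives in the cyclic sum cancel in pairs by symmetry. All identities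
  of Bianchi type below start from this.\<close>

lemma ext_d2_ext_d:
  fixes \<alpha> :: "('a::euclidean_space) one_form"
  assumes "open U" "smooth_on \<alpha> U" "x \<in> U"
  shows "ext_d2 (ext_d \<alpha>) x u v w = 0"
proof -
  have d: "D (\<lambda>y. ext_d \<alpha> y v w) x u = D (\<lambda>y. D (\<lambda>y. \<alpha> y w) y v) x u - D (\<lambda>y. D (\<lambda>y. \<alpha> y v) y w) x u" for u v w
  proof -
    have "ext_d \<alpha> y v w = D (\<lambda>y. \<alpha> y w) y v - D (\<lambda>y. \<alpha> y v) y w" if "y \<in> U" for y
      by (simp add: ext_d_def D_blinfun_apply smooth_on_differentiable[OF assms(2) that])
    then have "D (\<lambda>y. ext_d \<alpha> y v w) x u = D (\<lambda>y. D (\<lambda>y. \<alpha> y w) y v - D (\<lambda>y. \<alpha> y v) y w) x u"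
      using D_cong[OF assms(1,3), of "\<lambda>y. ext_d \<alpha> y v w" "\<lambda>y. D (\<lambda>y. \<alpha> y w) y v - D (\<lambda>y. \<alpha> y v) y w"] by simp
    also have "\<dots> = D (\<lambda>y. D (\<lambda>y. \<alpha> y w) y v) x u - D (\<lambda>y. D (\<lambda>y. \<alpha> y v) y w) x u"
      by (intro D_diff smooth_on_differentiable[OF smooth_on_D[OF smooth_on_apply[OF assms(1,2)]] assms(3)])
    finally show ?thesis .
  qed
  note c = D_D_commute[OF assms(1) smooth_on_apply[OF assms(1,2)] assms(3)]
  show ?thesis
    unfolding ext_d2_def d using c[of w v u] c[of u w v] c[of v u w] by simp
qed

lemma ext_d2_cong:
  assumes "open U" "x \<in> U" "\<And>y u v. y \<in> U \<Longrightarrow> \<omega> y u v = \<omega>' y u v"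
  shows "ext_d2 \<omega> x u v w = ext_d2 \<omega>' x u v w"
  unfolding ext_d2_def
  using D_cong[OF assms(1,2), of "\<lambda>y. \<omega> y v w" "\<lambda>y. \<omega>' y v w"] D_cong[OF assms(1,2), of "\<lambda>y. \<omega> y w u" "\<lambda>y. \<omega>' y w u"]
    D_cong[OF assms(1,2), of "\<lambda>y. \<omega> y u v" "\<lambda>y. \<omega>' y u v"] assms(3) by simp

lemma ext_d2_add:
  assumes "\<And>u v. (\<lambda>y. \<omega> y u v) differentiable (at x)" "\<And>u v. (\<lambda>y. \<omega>' y u v) differentiable (at x)"
  shows "ext_d2 (\<lambda>y u v. \<omega> y u v + \<omega>' y u v) x u v w = ext_d2 \<omega> x u v w + ext_d2 \<omega>' x u v w"
  unfolding ext_d2_def by (simp add: D_add assms)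

lemma wedge_differentiable:
  assumes "\<alpha> differentiable (at x)" "\<beta> differentiable (at x)"
  shows "(\<lambda>y. (\<alpha> y \<curlywedge> \<beta> y) u v) differentiable (at x)"
proof -
  show ?thesis
    unfolding wedge_def
    by (intro differentiable_diff differentiable_mult differentiable_blinfun_apply assms)
qed

text \<open>The graded Leibniz rule d(\<open>\<alpha>\<close> wedge \<open>\<beta>\<close>) =
  d\<open>\<alpha>\<close> wedge \<open>\<beta>\<close> - \<open>\<alpha>\<close> wedge
  d\<open>\<beta>\<close>. The last product is written with the 2-form first, which costs no
  sign.\<close>

lemma ext_d2_wedge:
  assumes "\<alpha> differentiable (at x)" "\<beta> differentiable (at x)"
  shows "ext_d2 (\<lambda>y u v. (\<alpha> y \<curlywedge> \<beta> y) u v) x u v w =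
    wedge21 (ext_d \<alpha> x) (\<beta> x) u v w - wedge21 (ext_d \<beta> x) (\<alpha> x) u v w"
proof -
  note diff = assms[THEN differentiable_blinfun_apply]
  have d: "D (\<lambda>y. (\<alpha> y \<curlywedge> \<beta> y) v w) x u =
    \<alpha> x v * D \<beta> x u w + D \<alpha> x u v * \<beta> x w - (\<alpha> x w * D \<beta> x u v + D \<alpha> x u w * \<beta> x v)" for u v w
    unfolding wedge_def
    by (simp add: D_diff D_mult diff differentiable_mult D_blinfun_apply assms)
  show ?thesis
    unfolding ext_d2_def d by (simp add: wedge21_def ext_d_def algebra_simps)
qed

lemma ext_d2_scale_wedge:
  assumes "f differentiable (at x)" "\<alpha> differentiable (at x)" "\<beta> differentiable (at x)"
  shows "ext_d2 (\<lambda>y u v. f y * (\<alpha> y \<curlywedge> \<beta> y) u v) x u v w =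
    wedge21 (\<alpha> x \<curlywedge> \<beta> x) (dd f x) u v w +
    f x * (wedge21 (ext_d \<alpha> x) (\<beta> x) u v w - wedge21 (ext_d \<beta> x) (\<alpha> x) u v w)"
proof -
  have "ext_d2 (\<lambda>y u v. f y * (\<alpha> y \<curlywedge> \<beta> y) u v) x u v w =
    f x * ext_d2 (\<lambda>y u v. (\<alpha> y \<curlywedge> \<beta> y) u v) x u v w + wedge21 (\<alpha> x \<curlywedge> \<beta> x) (dd f x) u v w"
    by (simp add: ext_d2_def D_mult assms wedge_differentiable wedge21_def dd_apply algebra_simps)
  then show ?thesis
    using ext_d2_wedge[OF assms(2,3)] by simp
qed


section \<open>Coframes\<close>

text \<open>\<open>idx\<close> is an arbitrary enumeration of a finite index type; it mediates between lists of forms and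
  determinants of matrices.\<close>

definition idx :: "nat \<Rightarrow> 'n::finite" where
  "idx = (SOME h. bij_betw h {..<CARD('n)} UNIV)"

definition nidx :: "'n::finite \<Rightarrow> nat" where
  "nidx = inv_into {..<CARD('n)} idx"

lemma bij_idx: "bij_betw (idx :: nat \<Rightarrow> 'n::finite) {..<CARD('n)} UNIV"
proof -
  obtain h :: "nat \<Rightarrow> 'n" where "bij_betw h {..<CARD('n)} UNIV"
    using ex_bij_betw_nat_finite[of "UNIV :: 'n set"] unfolding atLeast0LessThan by auto
  then show ?thesis
    unfolding idx_def by (rule someI[of "\<lambda>h. bij_betw h {..<CARD('n)} UNIV"])
qed

lemma nidx_idx: "j < CARD('n) \<Longrightarrow> nidx (idx j :: 'n::finite) = j"
  unfolding nidx_def using bij_betw_inv_into_left[OF bij_idx] by auto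

lemma idx_nidx: "idx (nidx a) = (a :: 'n::finite)"
  unfolding nidx_def using bij_betw_inv_into_right[OF bij_idx] by auto

lemma nidx_less: "nidx (a :: 'n::finite) < CARD('n)"
  unfolding nidx_def using bij_betw_inv_into[OF bij_idx[where 'n='n]] unfolding bij_betw_def by blast

lemma bij_nidx: "bij_betw (nidx :: 'n::finite \<Rightarrow> nat) UNIV {..<CARD('n)}"
  unfolding nidx_def by (rule bij_betw_inv_into[OF bij_idx])

definition crd :: "nat \<Rightarrow> real ^ 'n::finite \<Rightarrow> real" where
  "crd j x = x $ idx j"

definition mkvec :: "(nat \<Rightarrow> real) \<Rightarrow> real ^ 'n::finite" where
  "mkvec f = (\<chi> a. f (nidx a))"

lemma crd_mkvec: "j < CARD('n) \<Longrightarrow> crd j (mkvec f :: real ^ 'n::finite) = f j"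
  by (simp add: crd_def mkvec_def nidx_idx)

lemma crd_eqI: "(\<And>j. j < CARD('n) \<Longrightarrow> crd j x = crd j y) \<Longrightarrow> x = (y :: real ^ 'n::finite)"
  unfolding crd_def vec_eq_iff by (metis idx_nidx nidx_less)

lemma bounded_linear_crd: "bounded_linear (crd j)"
  unfolding crd_def by (rule bounded_linear_vec_nth)

lemma smooth_on_crd: "open U \<Longrightarrow> smooth_on f U \<Longrightarrow> smooth_on (\<lambda>x. crd j (f x)) U"
  by (rule smooth_on_bounded_linear[OF _ _ bounded_linear_crd])

lemma smooth_on_vec:
  fixes f :: "'a::real_normed_vector \<Rightarrow> real ^ 'n::finite"
  assumes "open U" "\<And>a. smooth_on (\<lambda>x. f x $ a) U"
  shows "smooth_on f U"
proof (rule smooth_on_euclidean[OF assms(1)])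
  fix b :: "real ^ 'n" assume "b \<in> Basis"
  then obtain a where "b = axis a 1" by (auto simp: Basis_vec_def)
  then show "smooth_on (\<lambda>x. f x \<bullet> b) U"
    using assms(2)[of a] by (simp add: inner_axis)
qed

lemma smooth_on_mkvec:
  fixes f :: "nat \<Rightarrow> 'a::real_normed_vector \<Rightarrow> real"
  assumes "open U" "\<And>j. j < CARD('n) \<Longrightarrow> smooth_on (f j) U"
  shows "smooth_on (\<lambda>x. mkvec (\<lambda>j. f j x) :: real ^ 'n::finite) U"
  by (rule smooth_on_vec[OF assms(1)]) (simp add: mkvec_def assms(2) nidx_less)

section \<open>Wedge products of covectors as determinants\<close>

definition cmat :: "(real ^ 'n::finite) covector list \<Rightarrow> real ^ 'n ^ 'n" where
  "cmat \<alpha>s = (\<chi> a c. (\<alpha>s ! nidx a) (axis c 1))"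

lemma cmat_mult: "(cmat \<alpha>s *v x) $ a = (\<alpha>s ! nidx a) x"
proof -
  have "(\<alpha>s ! nidx a) x = (\<alpha>s ! nidx a) (\<Sum>c\<in>UNIV. x $ c *\<^sub>R axis c 1)"
    using basis_expansion[of x] by (simp add: scalar_mult_eq_scaleR)
  then show ?thesis
    by (simp add: cmat_def matrix_vector_mult_def blinfun.sum_right blinfun.scaleR_right mult.commute)
qed

text \<open>Both sides are Leibniz sums, one over permutations of an initial segment of the
  naturals, the other over permutations of the index type. Conjugation by \<open>idx\<close> matches
  them and preserves signs.\<close>

lemma wedge_list_det:
  fixes \<alpha>s :: "(real ^ 'n::finite) covector list"
  assumes "length \<alpha>s = CARD('n)"
  shows "wedge_list \<alpha>s v = det (\<chi> a b. (\<alpha>s ! nidx a) (v (nidx b)) :: real ^ 'n ^ 'n)"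
proof -
  let ?n = "CARD('n)"
  let ?I = "{..<?n}"
  let ?h = "idx :: nat \<Rightarrow> 'n"
  have inj: "inj_on ?h ?I" using bij_idx bij_betw_def by blast
  show ?thesis
    unfolding wedge_list_def det_def assms
  proof (rule sum.reindex_bij_witness[of _ "map_permutation UNIV nidx" "map_permutation ?I ?h"])
    fix p assume "p \<in> {p. p permutes ?I}"
    then have p: "p permutes ?I" by simp
    show "map_permutation UNIV nidx (map_permutation ?I ?h p) = p"
      by (rule map_permutation_compose_inv[OF bij_idx p]) (simp add: nidx_idx)
    show "map_permutation ?I ?h p \<in> {p. p permutes UNIV}"
      using map_permutation_permutes[OF bij_idx p] by simp
    have "(\<Prod>a\<in>UNIV. (\<chi> a b. (\<alpha>s ! nidx a) (v (nidx b)) :: real ^ 'n ^ 'n) $ a $ map_permutation ?I ?h p a) =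
      (\<Prod>j<?n. (\<alpha>s ! nidx (?h j)) (v (nidx (map_permutation ?I ?h p (?h j)))))"
      by (simp add: prod.reindex_bij_betw[OF bij_idx, of "\<lambda>a. (\<alpha>s ! nidx a) (v (nidx (map_permutation ?I ?h p a)))"])
    also have "\<dots> = (\<Prod>j<?n. (\<alpha>s ! j) (v (p j)))"
    proof (rule prod.cong[OF refl])
      fix j assume j: "j \<in> ?I"
      then have "p j < ?n" using permutes_in_image[OF p] by auto
      then show "(\<alpha>s ! nidx (?h j)) (v (nidx (map_permutation ?I ?h p (?h j)))) = (\<alpha>s ! j) (v (p j))"
        using j by (simp add: map_permutation_apply[OF inj j] nidx_idx)
    qed
    finally show "of_int (sign (map_permutation ?I ?h p)) *
        (\<Prod>a\<in>UNIV. (\<chi> a b. (\<alpha>s ! nidx a) (v (nidx b)) :: real ^ 'n ^ 'n) $ a $ map_permutation ?I ?h p a) =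
        of_int (sign p) * (\<Prod>j<?n. (\<alpha>s ! j) (v (p j)))"
      by (simp add: sign_map_permutation[OF inj p])
  next
    fix q assume "q \<in> {q. q permutes (UNIV :: 'n set)}"
    then have q: "q permutes (UNIV :: 'n set)" by simp
    show "map_permutation ?I ?h (map_permutation UNIV nidx q) = q"
      by (rule map_permutation_compose_inv[OF bij_nidx q]) (simp add: idx_nidx)
    show "map_permutation UNIV nidx q \<in> {p. p permutes ?I}"
      using map_permutation_permutes[OF bij_nidx q] by simp
  qed
qed

text \<open>The matrix of values of the covectors on the vectors factors as \<open>cmat\<close>
  times the matrix with these vectors as columns, so its determinant is a multiple of the
  determinant of \<open>cmat\<close>.\<close>

lemma wedge_list_nonzero_det:
  fixes \<alpha>s :: "(real ^ 'n::finite) covector list"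
  assumes "length \<alpha>s = CARD('n)" "wedge_list \<alpha>s v \<noteq> 0"
  shows "det (cmat \<alpha>s) \<noteq> 0"
proof -
  have "(\<chi> a b. (\<alpha>s ! nidx a) (v (nidx b)) :: real ^ 'n ^ 'n) = cmat \<alpha>s ** (\<chi> c b. v (nidx b) $ c)"
    by (vector matrix_matrix_mult_def)
      (simp add: cmat_mult[symmetric] matrix_vector_mult_def)
  then have "wedge_list \<alpha>s v = det (cmat \<alpha>s) * det (\<chi> c b. v (nidx b) $ c)"
    by (simp add: wedge_list_det[OF assms(1)] det_mul)
  with assms(2) show ?thesis by auto
qed

text \<open>Covectors with no common nonzero kernel vector form an injective square matrix, hence an
  invertible one; the standard basis vectors then witness a nonzero wedge product.\<close>

lemma separating_wedge_list:
  fixes \<alpha>s :: "(real ^ 'n::finite) covector list"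
  assumes "length \<alpha>s = CARD('n)" "\<And>x. (\<And>\<alpha>. \<alpha> \<in> set \<alpha>s \<Longrightarrow> \<alpha> x = 0) \<Longrightarrow> x = 0"
  shows "\<exists>v. wedge_list \<alpha>s v \<noteq> 0"
proof -
  have "x = 0" if "cmat \<alpha>s *v x = 0" for x
  proof (rule assms(2))
    fix \<alpha> assume "\<alpha> \<in> set \<alpha>s"
    then obtain j where j: "j < CARD('n)" "\<alpha> = \<alpha>s ! j"
      using assms(1) by (metis in_set_conv_nth)
    show "\<alpha> x = 0"
      using cmat_mult[of \<alpha>s x "idx j"] that j by (simp add: nidx_idx)
  qed
  then have "\<exists>B. B ** cmat \<alpha>s = mat 1"
    unfolding matrix_left_invertible_ker by blast
  then have "det (cmat \<alpha>s) \<noteq> 0"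
    using invertible_det_nz invertible_left_inverse by blast
  moreover have "wedge_list \<alpha>s (\<lambda>j. axis (idx j) 1) = det (cmat \<alpha>s)"
    by (simp add: wedge_list_det[OF assms(1)] cmat_def idx_nidx)
  ultimately show ?thesis by metis
qed

lemma smooth_on_det:
  fixes M :: "'a::real_normed_vector \<Rightarrow> real ^ 'n::finite ^ 'n"
  assumes "open U" "\<And>a b. smooth_on (\<lambda>x. M x $ a $ b) U"
  shows "smooth_on (\<lambda>x. det (M x)) U"
  unfolding det_def by (intro smooth_on_sum smooth_on_mult smooth_on_const smooth_on_prod assms)

section \<open>Smooth coframes and their dual frames\<close>

definition coframe_on :: "(real ^ 'n::finite) one_form list \<Rightarrow> (real ^ 'n) set \<Rightarrow> bool" where
  "coframe_on \<alpha>s U \<longleftrightarrow> length \<alpha>s = CARD('n) \<and> (\<forall>\<alpha>\<in>set \<alpha>s. smooth_on \<alpha> U) \<and>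
     (\<forall>x\<in>U. \<exists>v. wedge_list (map (\<lambda>\<alpha>. \<alpha> x) \<alpha>s) v \<noteq> 0)"

text \<open>Cramer's rule writes the dual vectors as quotients of determinants in the coefficients
  of the forms, so the dual frame inherits smoothness.\<close>

lemma coframe_on_dual:
  fixes \<alpha>s :: "(real ^ 'n::finite) one_form list"
  assumes "open U" "coframe_on \<alpha>s U"
  obtains X where "\<And>k. k < CARD('n) \<Longrightarrow> smooth_on (X k) U"
    "\<And>x j k. x \<in> U \<Longrightarrow> j < CARD('n) \<Longrightarrow> k < CARD('n) \<Longrightarrow> (\<alpha>s ! j) x (X k x) = (if j = k then 1 else 0)"
    "\<And>x v. x \<in> U \<Longrightarrow> v = (\<Sum>k<CARD('n). (\<alpha>s ! k) x v *\<^sub>R X k x)"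
proof -
  have len: "length \<alpha>s = CARD('n)" and sm: "\<And>j. j < CARD('n) \<Longrightarrow> smooth_on (\<alpha>s ! j) U"
    using assms(2) by (auto simp: coframe_on_def)
  define M where "M x = cmat (map (\<lambda>\<alpha>. \<alpha> x) \<alpha>s)" for x
  have M_nth: "M x $ a $ c = (\<alpha>s ! nidx a) x (axis c 1)" for x a c
    by (simp add: M_def cmat_def len nidx_less)
  have M_mult: "(M x *v w) $ a = (\<alpha>s ! nidx a) x w" for x w a
    by (simp add: M_def cmat_mult len nidx_less)
  have det: "det (M x) \<noteq> 0" if "x \<in> U" for x
    using that assms(2) wedge_list_nonzero_det[of "map (\<lambda>\<alpha>. \<alpha> x) \<alpha>s"]
    unfolding coframe_on_def M_def by fastforce
  define X where "X k x = (\<chi> c. det (\<chi> i j. if j = c then (axis (idx k) 1 :: real^'n) $ i else M x $ i $ j) / det (M x))"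
    for k x
  have X: "M x *v X k x = axis (idx k) 1" if "x \<in> U" for x k
    using cramer[OF det[OF that], of "X k x" "axis (idx k) 1"] unfolding X_def by simp
  have sM: "smooth_on (\<lambda>x. M x $ a $ c) U" for a c
    unfolding M_nth by (rule smooth_on_apply[OF assms(1) sm[OF nidx_less]])
  have 1: "smooth_on (X k) U" for k
  proof (rule smooth_on_vec[OF assms(1)])
    fix c
    have "smooth_on (\<lambda>x. (\<chi> i j. if j = c then (axis (idx k) 1 :: real^'n) $ i else M x $ i $ j) $ a $ b) U" for a b
      by (cases "b = c") (simp_all add: smooth_on_const[OF assms(1)] sM)
    note smooth_on_det[OF assms(1) this]
    from smooth_on_divide[OF assms(1) this smooth_on_det[OF assms(1) sM] det]
    show "smooth_on (\<lambda>x. X k x $ c) U"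
      unfolding X_def vec_lambda_beta .
  qed
  have 2: "(\<alpha>s ! j) x (X k x) = (if j = k then 1 else 0)"
    if "x \<in> U" "j < CARD('n)" "k < CARD('n)" for x j k
  proof -
    have "(\<alpha>s ! j) x (X k x) = (M x *v X k x) $ idx j"
      using that by (simp add: M_mult nidx_idx)
    also have "\<dots> = (axis (idx k) 1 :: real ^ 'n) $ idx j"
      by (simp only: X[OF that(1)])
    also have "\<dots> = (if j = k then 1 else 0)"
      using that(2,3) by (simp add: axis_def) (metis nidx_idx)
    finally show ?thesis .
  qed
  have 3: "v = (\<Sum>k<CARD('n). (\<alpha>s ! k) x v *\<^sub>R X k x)" if x: "x \<in> U" for x v
  proof -
    have "M x *v v = M x *v (\<Sum>k<CARD('n). (\<alpha>s ! k) x v *\<^sub>R X k x)"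
    proof (rule vec_eq_iff[THEN iffD2], rule allI)
      fix a
      have "(M x *v (\<Sum>k<CARD('n). (\<alpha>s ! k) x v *\<^sub>R X k x)) $ a =
        (\<Sum>k<CARD('n). (\<alpha>s ! k) x v * (\<alpha>s ! nidx a) x (X k x))"
        by (simp add: M_mult blinfun.sum_right blinfun.scaleR_right)
      also have "\<dots> = (\<Sum>k<CARD('n). if nidx a = k then (\<alpha>s ! k) x v else 0)"
        by (rule sum.cong) (auto simp: 2[OF x nidx_less])
      also have "\<dots> = (\<alpha>s ! nidx a) x v"
        using nidx_less[of a] by simp
      finally show "(M x *v v) $ a = (M x *v (\<Sum>k<CARD('n). (\<alpha>s ! k) x v *\<^sub>R X k x)) $ a"
        by (simp add: M_mult)
    qed
    then show ?thesis
      using cramer[OF det[OF x], of v "M x *v v"] cramer[OF det[OF x], of "\<Sum>k<CARD('n). (\<alpha>s ! k) x v *\<^sub>R X k x" "M x *v v"]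
      by metis
  qed
  show thesis using that[of X] 1 2 3 by blast
qed

text \<open>A map pulling one family of forms back to a coframe has an injective differential
  between spaces of equal dimension. The inverse function theorem supplies a continuous local
  inverse; its smoothness has to be bootstrapped.\<close>

lemma coframe_local_diffeo:
  fixes \<alpha>s \<beta>s :: "(real ^ 'n::finite) one_form list"
  assumes U: "open U" "coframe_on \<alpha>s U" and V: "open V" "\<And>\<beta>. \<beta> \<in> set \<beta>s \<Longrightarrow> smooth_on \<beta> V" "length \<beta>s = CARD('n)"
    and f: "smooth_on f U" "f ` U \<subseteq> V"
    and pb: "\<And>j x. j < CARD('n) \<Longrightarrow> x \<in> U \<Longrightarrow> pullback f (\<beta>s ! j) x = (\<alpha>s ! j) x"
  shows "local_diffeo f U V"
  unfolding local_diffeo_def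
proof (intro conjI ballI f(2))
  fix x0 assume x0: "x0 \<in> U"
  obtain X where X: "\<And>k. k < CARD('n) \<Longrightarrow> smooth_on (X k) U"
    "\<And>x j k. x \<in> U \<Longrightarrow> j < CARD('n) \<Longrightarrow> k < CARD('n) \<Longrightarrow> (\<alpha>s ! j) x (X k x) = (if j = k then 1 else 0)"
    "\<And>x v. x \<in> U \<Longrightarrow> v = (\<Sum>k<CARD('n). (\<alpha>s ! k) x v *\<^sub>R X k x)"
    using coframe_on_dual[OF U] by blast
  \<comment> \<open>The candidate inverse of \<open>D f x\<close>: read off components with the
    target forms at \<open>f x\<close>, then reassemble them with the dual frame at
    \<open>x\<close>.\<close>
  define G where "G x w = (\<Sum>k<CARD('n). (\<beta>s ! k) (f x) w *\<^sub>R X k x)" for x w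
  have linG: "linear (G x)" for x
    unfolding G_def
    by (rule linearI) (simp_all add: blinfun.add_right blinfun.scaleR_right scaleR_add_left sum.distrib scaleR_sum_right)
  have GD: "G x (D f x w) = w" if "x \<in> U" for x w
  proof -
    have "(\<beta>s ! k) (f x) (D f x w) = (\<alpha>s ! k) x w" if k: "k < CARD('n)" for k
      using pullback_apply[OF smooth_on_differentiable[OF f(1) \<open>x \<in> U\<close>]] pb[OF k \<open>x \<in> U\<close>] by metis
    then have "G x (D f x w) = (\<Sum>k<CARD('n). (\<alpha>s ! k) x w *\<^sub>R X k x)"
      unfolding G_def by simp
    then show ?thesis using X(3)[OF that, of w] by simp
  qed
  have linD: "linear (D f x)" if "x \<in> U" for x
    by (rule has_derivative_linear[OF smooth_on_has_derivative[OF f(1) that]])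
  \<comment> \<open>In finite dimension a left inverse between spaces of equal dimension is also a
    right inverse.\<close>
  have DG: "D f x (G x w) = w" if "x \<in> U" for x w
    using linear_inverse_left[OF linD[OF that] linG, of x] GD[OF that] by (simp add: fun_eq_iff)
  define f' where "f' x = Blinfun (D f x)" for x
  have f'_apply: "blinfun_apply (f' x) = D f x" if "x \<in> U" for x
    unfolding f'_def by (simp add: bounded_linear_Blinfun_apply linD[OF that] linear_conv_bounded_linear[symmetric])
  have 1: "(f has_derivative blinfun_apply (f' x)) (at x)" if "x \<in> U" for x
    using smooth_on_has_derivative[OF f(1) that] by (simp add: f'_apply[OF that])
  have 2: "continuous_on U f'"
  proof (rule continuous_on_blinfun_componentwise)
    show "continuous_on U (\<lambda>x. blinfun_apply (f' x) b)" for b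
      using smooth_on_continuous_on[OF smooth_on_D[OF f(1), of b]]
      by (rule continuous_on_eq) (simp add: f'_apply)
  qed
  have 3: "Blinfun (G x0) o\<^sub>L f' x0 = id_blinfun"
    by (rule blinfun_eqI)
      (simp add: bounded_linear_Blinfun_apply[OF linear_conv_bounded_linear[THEN iffD1, OF linG]]
        f'_apply[OF x0] GD[OF x0])
  obtain U' V' g where W: "open U'" "U' \<subseteq> U" "x0 \<in> U'" "open V'" "homeomorphism U' V' f g"
  proof (rule inverse_function_theorem[OF U(1) _ 2 x0 3])
    show "(f has_derivative blinfun_apply (f' x)) (at x)" if "x \<in> U" for x
      by (rule 1[OF that])
  qed (rule that, assumption+)
  have gf: "\<And>x. x \<in> U' \<Longrightarrow> g (f x) = x" and fg: "\<And>y. y \<in> V' \<Longrightarrow> f (g y) = y"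
    and img: "f ` U' = V'" "g ` V' = U'" and contg: "continuous_on V' g" and contf: "continuous_on U' f"
    using W(5) unfolding homeomorphism_def by auto
  have gU: "g y \<in> U'" if "y \<in> V'" for y using img(2) that by auto
  have dg: "(g has_derivative (\<lambda>w. G (g y) w)) (at y)" if y: "y \<in> V'" for y
  proof (rule has_derivative_inverse_strong_x[OF W(1) gU[OF y] contf gf _ _ fg[OF y]])
    show "(f has_derivative D f (g y)) (at (g y))"
      using smooth_on_has_derivative[OF f(1)] gU[OF y] W(2) by blast
    show "D f (g y) \<circ> (\<lambda>w. G (g y) w) = id"
      using DG gU[OF y] W(2) by (auto simp: fun_eq_iff)
  qed
  \<comment> \<open>Since \<open>f (g y) = y\<close>, the derivative of \<open>g\<close> at
    \<open>y\<close> combines target forms evaluated at \<open>y\<close> with dual vectors at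
    \<open>g y\<close>. Smoothness of both families and class k of \<open>g\<close> give class k of
    this derivative, hence class k + 1 of \<open>g\<close>.\<close>
  have "Ck_on k g V'" for k
  proof (induction k)
    case 0
    then show ?case using contg by simp
  next
    case (Suc k)
    show ?case
    proof (rule Ck_on_SucI[OF W(4) dg])
      fix v
      have "Ck_on k (\<lambda>y. (\<beta>s ! m) y v *\<^sub>R X m (g y)) V'" if m: "m < CARD('n)" for m
      proof (rule Ck_on_bilinear[OF W(4) bounded_bilinear_scaleR])
        have sub: "V' \<subseteq> V" using img(1) W(2) f(2) by auto
        have len: "m < length \<beta>s" using V(3) m by simp
        have "smooth_on (\<lambda>y. (\<beta>s ! m) y v) V'"
          by (rule smooth_on_apply[OF W(4) smooth_on_subset[OF V(2)[OF nth_mem[OF len]] sub]])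
        then show "Ck_on k (\<lambda>y. (\<beta>s ! m) y v) V'" by (simp add: smooth_on_def)
        have "Ck_on k (X m) U'"
          using smooth_on_subset[OF X(1)[OF m] W(2)] by (simp add: smooth_on_def)
        then show "Ck_on k (\<lambda>y. X m (g y)) V'"
          by (intro Ck_on_compose[OF W(4) W(1) _ Suc]) (auto simp: img)
      qed
      then have "Ck_on k (\<lambda>y. \<Sum>m<CARD('n). (\<beta>s ! m) y v *\<^sub>R X m (g y)) V'"
        by (intro Ck_on_sum[OF W(4)]) simp
      then show "Ck_on k (\<lambda>y. G (g y) v) V'"
        by (rule Ck_on_cong[OF W(4), rotated]) (simp add: G_def fg)
    qed
  qed
  then have sg: "smooth_on g V'" by (simp add: smooth_on_def)
  have inj: "inj_on f U'" by (rule inj_on_inverseI[of _ g]) (rule gf)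
  have "inv_into U' f y = g y" if "y \<in> V'" for y
    using inv_into_f_f[OF inj gU[OF that]] unfolding fg[OF that] .
  then have "smooth_on (inv_into U' f) (f ` U')"
    unfolding img(1) by (intro smooth_on_cong[OF W(4) sg]) (rule sym)
  then show "\<exists>W. open W \<and> x0 \<in> W \<and> W \<subseteq> U \<and> open (f ` W) \<and> inj_on f W \<and>
      smooth_on f W \<and> smooth_on (inv_into W f) (f ` W)"
    using W(1-4) inj img(1) smooth_on_subset[OF f(1) W(2)] by (intro exI[of _ U'] conjI) simp_all
qed


section \<open>Cartan data and gauge transformations\<close>

record (overloaded) ('a::real_normed_vector) cartan =
  t1 :: "'a one_form"
  t2 :: "'a one_form"
  t3 :: "'a one_form"
  w2 :: "'a one_form"
  w2b :: "'a one_form"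
  w3 :: "'a one_form"
  w3b :: "'a one_form"
  w4 :: "'a one_form"
  cR :: "'a \<Rightarrow> real"
  cRb :: "'a \<Rightarrow> real"
  cS :: "'a \<Rightarrow> real"
  cSb :: "'a \<Rightarrow> real"

definition smooth_cartan :: "'a::real_normed_vector set \<Rightarrow> 'a cartan \<Rightarrow> bool" where
  "smooth_cartan X C \<longleftrightarrow> open X \<and>
     smooth_on (t1 C) X \<and> smooth_on (t2 C) X \<and> smooth_on (t3 C) X \<and> smooth_on (w2 C) X \<and>
     smooth_on (w2b C) X \<and> smooth_on (w3 C) X \<and> smooth_on (w3b C) X \<and> smooth_on (w4 C) X \<and>
     smooth_on (cR C) X \<and> smooth_on (cRb C) X \<and> smooth_on (cS C) X \<and> smooth_on (cSb C) X"

definition eqs_at :: "real \<Rightarrow> 'a::real_normed_vector cartan \<Rightarrow> 'a \<Rightarrow> 'a \<Rightarrow> 'a \<Rightarrow> bool" where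
  "eqs_at i C p u v \<longleftrightarrow>
     ext_d (t1 C) p u v = (w2 C p \<curlywedge> t1 C p) u v + (w3 C p \<curlywedge> t3 C p) u v \<and>
     ext_d (t2 C) p u v = (w2b C p \<curlywedge> t2 C p) u v + (w3b C p \<curlywedge> t3 C p) u v \<and>
     ext_d (t3 C) p u v = i * (t1 C p \<curlywedge> t2 C p) u v + ((w2 C p + w2b C p) \<curlywedge> t3 C p) u v \<and>
     ext_d (w2 C) p u v =
       2 * i * (t1 C p \<curlywedge> w3b C p) u v + i * (t2 C p \<curlywedge> w3 C p) u v + (w4 C p \<curlywedge> t3 C p) u v \<and>
     ext_d (w2b C) p u v =
       - 2 * i * (t2 C p \<curlywedge> w3 C p) u v - i * (t1 C p \<curlywedge> w3b C p) u v + (w4 C p \<curlywedge> t3 C p) u v \<and>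
     ext_d (w3 C) p u v =
       (w4 C p \<curlywedge> t1 C p) u v + (w3 C p \<curlywedge> w2b C p) u v + cR C p * (t2 C p \<curlywedge> t3 C p) u v \<and>
     ext_d (w3b C) p u v =
       (w4 C p \<curlywedge> t2 C p) u v + (w3b C p \<curlywedge> w2 C p) u v + cRb C p * (t1 C p \<curlywedge> t3 C p) u v \<and>
     ext_d (w4 C) p u v =
       i * (w3 C p \<curlywedge> w3b C p) u v + (w4 C p \<curlywedge> (w2 C p + w2b C p)) u v
       + cSb C p * (t1 C p \<curlywedge> t3 C p) u v + cS C p * (t2 C p \<curlywedge> t3 C p) u v"

definition cartan_on :: "real \<Rightarrow> 'a::real_normed_vector set \<Rightarrow> 'a cartan \<Rightarrow> bool" where
  "cartan_on i X C \<longleftrightarrow> smooth_cartan X C \<and> (\<forall>p\<in>X. \<forall>u v. eqs_at i C p u v)"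

text \<open>The structure equations are symmetric under exchanging barred and unbarred objects together
  with \<open>i \<mapsto> -i\<close>.\<close>

definition bar :: "'a::real_normed_vector cartan \<Rightarrow> 'a cartan" where
  "bar C = \<lparr>t1 = t2 C, t2 = t1 C, t3 = t3 C, w2 = w2b C, w2b = w2 C, w3 = w3b C, w3b = w3 C, w4 = w4 C,
     cR = cRb C, cRb = cR C, cS = cSb C, cSb = cS C\<rparr>"

lemma bar_simps [simp]:
  "t1 (bar C) = t2 C" "t2 (bar C) = t1 C" "t3 (bar C) = t3 C" "w2 (bar C) = w2b C" "w2b (bar C) = w2 C"
  "w3 (bar C) = w3b C" "w3b (bar C) = w3 C" "w4 (bar C) = w4 C" "cR (bar C) = cRb C" "cRb (bar C) = cR C"
  "cS (bar C) = cSb C" "cSb (bar C) = cS C"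
  by (simp_all add: bar_def)

lemma eqs_at_bar: "eqs_at (- i) (bar C) p u v \<longleftrightarrow> eqs_at i C p u v"
  unfolding eqs_at_def bar_simps
  by (auto simp: wedge_def blinfun.add_left algebra_simps)

lemma cartan_on_bar: "cartan_on i X C \<Longrightarrow> cartan_on (- i) X (bar C)"
  by (auto simp: cartan_on_def eqs_at_bar smooth_cartan_def)

lemma smooth_cartanD:
  assumes "smooth_cartan X C"
  shows "open X" "smooth_on (t1 C) X" "smooth_on (t2 C) X" "smooth_on (t3 C) X" "smooth_on (w2 C) X"
     "smooth_on (w2b C) X" "smooth_on (w3 C) X" "smooth_on (w3b C) X" "smooth_on (w4 C) X"
     "smooth_on (cR C) X" "smooth_on (cRb C) X" "smooth_on (cS C) X" "smooth_on (cSb C) X"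
  using assms unfolding smooth_cartan_def by simp_all

lemma ext_d_const_scaleR:
  assumes "\<alpha> differentiable (at x)"
  shows "ext_d (\<lambda>y. k *\<^sub>R \<alpha> y) x u v = k * ext_d \<alpha> x u v"
  using ext_d_scaleR[of "\<lambda>_. k" x \<alpha> u v] assms
  by (simp add: wedge_def dd_apply)

text \<open>\<open>scale\<close>, \<open>shear\<close>, \<open>shearb\<close> and \<open>twist\<close> are \<open>\<omega> \<mapsto> h\<^sup>-\<^sup>1 \<omega> h + h\<^sup>-\<^sup>1 dh\<close> for \<open>h\<close> in the diagonal subgroup and in
  three one-parameter subgroups of the Borel group.\<close>

definition scale :: "('a::real_normed_vector \<Rightarrow> real) \<Rightarrow> ('a \<Rightarrow> real) \<Rightarrow> 'a cartan \<Rightarrow> 'a cartan" where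
  "scale b b' C = \<lparr>t1 = \<lambda>x. b x *\<^sub>R t1 C x, t2 = \<lambda>x. b' x *\<^sub>R t2 C x, t3 = \<lambda>x. b x *\<^sub>R b' x *\<^sub>R t3 C x,
     w2 = \<lambda>x. w2 C x + inverse (b x) *\<^sub>R dd b x, w2b = \<lambda>x. w2b C x + inverse (b' x) *\<^sub>R dd b' x,
     w3 = \<lambda>x. inverse (b' x) *\<^sub>R w3 C x, w3b = \<lambda>x. inverse (b x) *\<^sub>R w3b C x,
     w4 = \<lambda>x. inverse (b x) *\<^sub>R inverse (b' x) *\<^sub>R w4 C x,
     cR = \<lambda>x. cR C x * inverse (b x) * inverse (b' x) ^ 3, cRb = \<lambda>x. cRb C x * inverse (b x) ^ 3 * inverse (b' x),
     cS = \<lambda>x. cS C x * inverse (b x) ^ 2 * inverse (b' x) ^ 3,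
     cSb = \<lambda>x. cSb C x * inverse (b x) ^ 3 * inverse (b' x) ^ 2\<rparr>"

definition shear :: "real \<Rightarrow> ('a::real_normed_vector \<Rightarrow> real) \<Rightarrow> 'a cartan \<Rightarrow> 'a cartan" where
  "shear i c C = \<lparr>t1 = \<lambda>x. t1 C x + c x *\<^sub>R t3 C x, t2 = t2 C, t3 = t3 C,
     w2 = \<lambda>x. w2 C x - i *\<^sub>R c x *\<^sub>R t2 C x, w2b = \<lambda>x. w2b C x + (2 * i) *\<^sub>R c x *\<^sub>R t2 C x,
     w3 = \<lambda>x. w3 C x + dd c x + c x *\<^sub>R w2b C x + i *\<^sub>R c x *\<^sub>R c x *\<^sub>R t2 C x, w3b = w3b C,
     w4 = \<lambda>x. w4 C x + i *\<^sub>R c x *\<^sub>R w3b C x,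
     cR = cR C, cRb = cRb C, cS = cS C, cSb = \<lambda>x. cSb C x + i * c x * cRb C x\<rparr>"

definition shearb :: "real \<Rightarrow> ('a::real_normed_vector \<Rightarrow> real) \<Rightarrow> 'a cartan \<Rightarrow> 'a cartan" where
  "shearb i c C = bar (shear (- i) c (bar C))"

definition twist :: "('a::real_normed_vector \<Rightarrow> real) \<Rightarrow> 'a cartan \<Rightarrow> 'a cartan" where
  "twist r C = \<lparr>t1 = t1 C, t2 = t2 C, t3 = t3 C,
     w2 = \<lambda>x. w2 C x + r x *\<^sub>R t3 C x, w2b = \<lambda>x. w2b C x + r x *\<^sub>R t3 C x,
     w3 = \<lambda>x. w3 C x + r x *\<^sub>R t1 C x, w3b = \<lambda>x. w3b C x + r x *\<^sub>R t2 C x,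
     w4 = \<lambda>x. w4 C x + dd r x + r x *\<^sub>R (w2 C x + w2b C x) + r x *\<^sub>R r x *\<^sub>R t3 C x,
     cR = cR C, cRb = cRb C, cS = cS C, cSb = cSb C\<rparr>"

lemma D_inverse:
  fixes f :: "_ \<Rightarrow> real"
  assumes "f differentiable (at x)" "f x \<noteq> 0"
  shows "D (\<lambda>y. inverse (f y)) x u = - (inverse (f x) * D f x u * inverse (f x))"
  using fun_cong[OF D_eqI[OF Deriv.has_derivative_inverse[OF assms(2) assms(1)[unfolded frechet_derivative_works]]]] .

lemma smooth_cartan_scale:
  fixes C :: "('a::euclidean_space) cartan"
  assumes C: "smooth_cartan X C" and b: "smooth_on b X" "smooth_on b' X" "\<And>x. x \<in> X \<Longrightarrow> b x \<noteq> 0" "\<And>x. x \<in> X \<Longrightarrow> b' x \<noteq> 0"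
  shows "smooth_cartan X (scale b b' C)"
  unfolding smooth_cartan_def scale_def cartan.simps
  by (intro conjI smooth_on_add smooth_on_mult smooth_on_scaleR smooth_on_inverse smooth_on_power
      smooth_on_dd smooth_cartanD[OF C] b) 

lemma smooth_cartan_shear:
  fixes C :: "('a::euclidean_space) cartan"
  assumes C: "smooth_cartan X C" and c: "smooth_on c X"
  shows "smooth_cartan X (shear i c C)"
  unfolding smooth_cartan_def shear_def cartan.simps
  by (intro conjI smooth_on_add smooth_on_diff smooth_on_mult smooth_on_scaleR smooth_on_const
      smooth_on_dd smooth_cartanD[OF C] c)

lemma smooth_cartan_twist:
  fixes C :: "('a::euclidean_space) cartan"
  assumes C: "smooth_cartan X C" and r: "smooth_on r X"
  shows "smooth_cartan X (twist r C)"
  unfolding smooth_cartan_def twist_def cartan.simps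
  by (intro conjI smooth_on_add smooth_on_mult smooth_on_scaleR
      smooth_on_dd smooth_cartanD[OF C] r)

text \<open>The exponents in the curvatures are forced by weights: \<open>w3\<close> scales by the
  inverse of \<open>b'\<close> and the product of \<open>t2\<close> and \<open>t3\<close> by
  \<open>b * b' ^ 2\<close>, so \<open>cR\<close> takes the inverse of \<open>b * b' ^ 3\<close>.
  The same weights appear as the coefficients of \<open>w2\<close> and \<open>w2b\<close> in the
  differentials of the curvatures.\<close>

lemma cartan_on_scale:
  fixes C :: "('a::euclidean_space) cartan"
  assumes C: "cartan_on i X C" and b: "smooth_on b X" "smooth_on b' X" "\<And>x. x \<in> X \<Longrightarrow> b x \<noteq> 0" "\<And>x. x \<in> X \<Longrightarrow> b' x \<noteq> 0"
  shows "cartan_on i X (scale b b' C)"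
  unfolding cartan_on_def
proof (intro conjI ballI allI)
  have sC: "smooth_cartan X C" using C cartan_on_def by blast
  then show "smooth_cartan X (scale b b' C)" by (rule smooth_cartan_scale[OF _ b])
  fix p u v assume p: "p \<in> X"
  have e: "eqs_at i C p u v" using C p unfolding cartan_on_def by blast
  note E = e[unfolded eqs_at_def wedge_def blinfun.add_left]
  note d = smooth_cartanD(2-)[OF sC, THEN smooth_on_differentiable, OF p]
  note db = smooth_on_differentiable[OF b(1) p] smooth_on_differentiable[OF b(2) p]
  note ddb = smooth_on_differentiable[OF smooth_on_dd[OF smooth_cartanD(1)[OF sC] b(1)] p]
    smooth_on_differentiable[OF smooth_on_dd[OF smooth_cartanD(1)[OF sC] b(2)] p]
  note nz = b(3)[OF p] b(4)[OF p]
  \<comment> \<open>Scalings are kept nested by deleting \<open>scaleR_scaleR\<close> below, so that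
    the product rule \<open>ext_d_scaleR\<close> peels off one scalar function at a time.\<close>
  note rules = ext_d_add ext_d_scaleR ext_d_dd[OF smooth_cartanD(1)[OF sC] b(1) p] ext_d_dd[OF smooth_cartanD(1)[OF sC] b(2) p]
    dd_apply D_inverse differentiable_inverse differentiable_scaleR d db ddb nz
  show "eqs_at i (scale b b' C) p u v"
    unfolding eqs_at_def scale_def cartan.simps
    by (simp add: E rules wedge_def blinfun.add_left blinfun.scaleR_left del: scaleR_scaleR; simp add: nz field_simps power2_eq_square power3_eq_cube)
qed

text \<open>Of the curvatures only \<open>cSb\<close> changes: \<open>w4\<close> acquires a multiple
  \<open>i * c\<close> of \<open>w3b\<close>, whose differential contains \<open>cRb\<close> times
  the product of \<open>t1\<close> and \<open>t3\<close>.\<close>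

lemma cartan_on_shear:
  fixes C :: "('a::euclidean_space) cartan"
  assumes C: "cartan_on i X C" and c: "smooth_on c X"
  shows "cartan_on i X (shear i c C)"
  unfolding cartan_on_def
proof (intro conjI ballI allI)
  have sC: "smooth_cartan X C" using C cartan_on_def by blast
  then show "smooth_cartan X (shear i c C)" by (rule smooth_cartan_shear[OF _ c])
  fix p u v assume p: "p \<in> X"
  have e: "eqs_at i C p u v" using C p unfolding cartan_on_def by blast
  note E = e[unfolded eqs_at_def wedge_def blinfun.add_left]
  note d = smooth_cartanD(2-)[OF sC, THEN smooth_on_differentiable, OF p]
  note dc = smooth_on_differentiable[OF c p]
  note ddc = smooth_on_differentiable[OF smooth_on_dd[OF smooth_cartanD(1)[OF sC] c] p]
  note rules = ext_d_add ext_d_diff ext_d_const_scaleR ext_d_scaleR ext_d_dd[OF smooth_cartanD(1)[OF sC] c p]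
    differentiable_scaleR differentiable_add differentiable_diff d dc ddc
  show "eqs_at i (shear i c C) p u v"
    unfolding eqs_at_def shear_def cartan.simps
    by (simp add: E rules wedge_def blinfun.add_left blinfun.diff_left blinfun.scaleR_left del: scaleR_scaleR; simp add: algebra_simps)
qed

text \<open>Conjugation by \<open>bar\<close> sends \<open>i\<close> to \<open>- i\<close> and back,
  so the barred shear needs no computation of its own.\<close>

lemma cartan_on_shearb:
  fixes C :: "('a::euclidean_space) cartan"
  assumes "cartan_on i X C" "smooth_on c X"
  shows "cartan_on i X (shearb i c C)"
  unfolding shearb_def
  using cartan_on_bar[OF cartan_on_shear[OF cartan_on_bar[OF assms(1)] assms(2)]] by simp

text \<open>This is the freedom left once \<open>t1\<close>, \<open>t2\<close> and \<open>t3\<close>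
  are fixed. The term quadratic in \<open>r\<close> in the new \<open>w4\<close> compensates the
  change of \<open>w2\<close> and \<open>w2b\<close> in the linear one.\<close>

lemma cartan_on_twist:
  fixes C :: "('a::euclidean_space) cartan"
  assumes C: "cartan_on i X C" and r: "smooth_on r X"
  shows "cartan_on i X (twist r C)"
  unfolding cartan_on_def
proof (intro conjI ballI allI)
  have sC: "smooth_cartan X C" using C cartan_on_def by blast
  then show "smooth_cartan X (twist r C)" by (rule smooth_cartan_twist[OF _ r])
  fix p u v assume p: "p \<in> X"
  have e: "eqs_at i C p u v" using C p unfolding cartan_on_def by blast
  note E = e[unfolded eqs_at_def wedge_def blinfun.add_left]
  note d = smooth_cartanD(2-)[OF sC, THEN smooth_on_differentiable, OF p]
  note dr = smooth_on_differentiable[OF r p]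
  note ddr = smooth_on_differentiable[OF smooth_on_dd[OF smooth_cartanD(1)[OF sC] r] p]
  note rules = ext_d_add ext_d_scaleR ext_d_dd[OF smooth_cartanD(1)[OF sC] r p]
    differentiable_scaleR differentiable_add d dr ddr
  show "eqs_at i (twist r C) p u v"
    unfolding eqs_at_def twist_def cartan.simps
    by (simp add: E rules wedge_def blinfun.add_left blinfun.scaleR_left del: scaleR_scaleR; simp add: algebra_simps)
qed


section \<open>Pullback and composite gauge transformations\<close>

definition pull :: "('a::real_normed_vector \<Rightarrow> 'b::real_normed_vector) \<Rightarrow> 'b cartan \<Rightarrow> 'a cartan" where
  "pull f C = \<lparr>t1 = pullback f (t1 C), t2 = pullback f (t2 C), t3 = pullback f (t3 C),
     w2 = pullback f (w2 C), w2b = pullback f (w2b C), w3 = pullback f (w3 C), w3b = pullback f (w3b C),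
     w4 = pullback f (w4 C), cR = \<lambda>x. cR C (f x), cRb = \<lambda>x. cRb C (f x), cS = \<lambda>x. cS C (f x), cSb = \<lambda>x. cSb C (f x)\<rparr>"

lemma smooth_cartan_pull:
  fixes f :: "'a::euclidean_space \<Rightarrow> 'b::euclidean_space"
  assumes U: "open U" "smooth_on f U" "f ` U \<subseteq> V" and C: "smooth_cartan V C"
  shows "smooth_cartan U (pull f C)"
  unfolding smooth_cartan_def pull_def cartan.simps
  by (intro conjI smooth_on_pullback[OF U(1) smooth_cartanD(1)[OF C] U(3,2)]
      smooth_on_compose[OF U(1) smooth_cartanD(1)[OF C] U(3,2)] smooth_cartanD(2-)[OF C] U(1))

lemma cartan_on_pull:
  fixes f :: "'a::euclidean_space \<Rightarrow> 'b::euclidean_space"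
  assumes U: "open U" "smooth_on f U" "f ` U \<subseteq> V" and C: "cartan_on i V C"
  shows "cartan_on i U (pull f C)"
  unfolding cartan_on_def
proof (intro conjI ballI allI)
  have sC: "smooth_cartan V C" using C cartan_on_def by blast
  then show "smooth_cartan U (pull f C)" by (rule smooth_cartan_pull[OF U])
  fix p u v assume p: "p \<in> U"
  then have "f p \<in> V" using U(3) by blast
  then have e: "eqs_at i C (f p) (D f p u) (D f p v)"
    using C unfolding cartan_on_def by blast
  note E = e[unfolded eqs_at_def wedge_def blinfun.add_left]
  note d = smooth_cartanD(2-9)[OF sC, THEN ext_d_pullback[OF U(1) smooth_cartanD(1)[OF sC] U(3,2) _ p]]
  show "eqs_at i (pull f C) p u v"
    unfolding eqs_at_def pull_def cartan.simps
    by (simp add: d E wedge_def blinfun.add_left pullback_apply smooth_on_differentiable[OF U(2) p])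
qed

text \<open>Outside the set considered the fields are arbitrary total functions, so equality of
  Cartan data can only be asked for point by point.\<close>

definition agree_at :: "'a::real_normed_vector cartan \<Rightarrow> 'a cartan \<Rightarrow> 'a \<Rightarrow> bool" where
  "agree_at C C' x \<longleftrightarrow> t1 C x = t1 C' x \<and> t2 C x = t2 C' x \<and> t3 C x = t3 C' x \<and> w2 C x = w2 C' x \<and>
     w2b C x = w2b C' x \<and> w3 C x = w3 C' x \<and> w3b C x = w3b C' x \<and> w4 C x = w4 C' x \<and>
     cR C x = cR C' x \<and> cRb C x = cRb C' x \<and> cS C x = cS C' x \<and> cSb C x = cSb C' x"

lemma agree_at_trans: "agree_at C C' x \<Longrightarrow> agree_at C' C'' x \<Longrightarrow> agree_at C C'' x"
  and agree_at_sym: "agree_at C C' x \<Longrightarrow> agree_at C' C x"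
  and agree_at_refl: "agree_at C C x"
  by (simp_all add: agree_at_def)

lemma pullback_dd:
  assumes "f differentiable (at x)" "b differentiable (at (f x))"
  shows "dd b (f x) o\<^sub>L Blinfun (D f x) = dd (\<lambda>y. b (f y)) x"
proof (rule blinfun_eqI)
  fix v
  have "(\<lambda>y. b (f y)) differentiable (at x)"
    using differentiable_chain_at[OF assms] by (simp add: o_def)
  then show "(dd b (f x) o\<^sub>L Blinfun (D f x)) v = dd (\<lambda>y. b (f y)) x v"
    by (simp add: dd_apply assms D_compose bounded_linear_Blinfun_apply bounded_linear_D)
qed

lemma pullback_pullback:
  assumes "f differentiable (at x)" "g differentiable (at (f x))"
  shows "pullback f (pullback g \<alpha>) x = pullback (\<lambda>y. g (f y)) \<alpha> x"
proof (rule blinfun_eqI)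
  fix v
  have "(\<lambda>y. g (f y)) differentiable (at x)"
    using differentiable_chain_at[OF assms] by (simp add: o_def)
  then show "pullback f (pullback g \<alpha>) x v = pullback (\<lambda>y. g (f y)) \<alpha> x v"
    by (simp add: pullback_apply assms D_compose)
qed

lemma pull_pull:
  assumes "f differentiable (at x)" "g differentiable (at (f x))"
  shows "agree_at (pull f (pull g C)) (pull (\<lambda>y. g (f y)) C) x"
  unfolding agree_at_def pull_def cartan.simps by (simp add: pullback_pullback[OF assms])

lemma pull_cong:
  assumes "open U" "x \<in> U" "\<And>y. y \<in> U \<Longrightarrow> f y = g y"
  shows "agree_at (pull f C) (pull g C) x"
  unfolding agree_at_def pull_def cartan.simps pullback_def
  using D_cong[OF assms] assms(3)[OF assms(2)] by simp

text \<open>Parameters 0 and 1 are the diagonal entries, 2 and 3 the two shears, 4 the twist. With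
  the twist outermost, a further twist of data with vanishing parameter 4 is absorbed by changing
  this parameter alone.\<close>

definition regauge :: "real \<Rightarrow> (nat \<Rightarrow> 'a::real_normed_vector \<Rightarrow> real) \<Rightarrow> 'a cartan \<Rightarrow> 'a cartan" where
  "regauge i g C = twist (g 4) (shearb i (g 3) (shear i (g 2) (scale (g 0) (g 1) C)))"

lemmas gauge_unfold = regauge_def twist_def shearb_def shear_def scale_def

definition gauge_fun :: "(nat \<Rightarrow> 'a::real_normed_vector \<Rightarrow> real) \<Rightarrow> 'a set \<Rightarrow> bool" where
  "gauge_fun g X \<longleftrightarrow> open X \<and> (\<forall>j<5. smooth_on (g j) X) \<and> (\<forall>x\<in>X. g 0 x \<noteq> 0 \<and> g 1 x \<noteq> 0)"

lemma cartan_on_gauge: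
  fixes C :: "('a::euclidean_space) cartan"
  assumes "cartan_on i X C" "gauge_fun g X"
  shows "cartan_on i X (regauge i g C)"
  unfolding regauge_def
  by (intro cartan_on_twist cartan_on_shearb cartan_on_shear cartan_on_scale assms)
    (use assms(2) in \<open>simp_all add: gauge_fun_def\<close>)

text \<open>Differentials of the parameters enter the connection forms, hence the parameters must
  agree on a whole neighbourhood, while the data being transformed are compared at \<open>x\<close>
  only.\<close>

lemma gauge_cong:
  assumes "open X" "x \<in> X" "agree_at C C' x" "\<And>j y. j < 5 \<Longrightarrow> y \<in> X \<Longrightarrow> g j y = h j y"
  shows "agree_at (regauge i g C) (regauge i h C') x"
proof -
  have d: "dd (g j) x = dd (h j) x" and e: "g j x = h j x" if "j < 5" for j
    using D_cong[OF assms(1,2) assms(4)[OF that]] assms(4)[OF that assms(2)] by (simp_all add: dd_def)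
  show ?thesis
    using assms(3) unfolding agree_at_def gauge_unfold bar_def cartan.simps
    by (simp add: d e)
qed

text \<open>Pullback at a point is linear in the forms and commutes with the differentials of the
  parameters, and \<open>regauge\<close> is built from nothing else.\<close>

lemma pull_gauge:
  assumes "f differentiable (at x)" "\<And>j. j < 5 \<Longrightarrow> g j differentiable (at (f x))"
  shows "agree_at (pull f (regauge i g C)) (regauge i (\<lambda>j y. g j (f y)) (pull f C)) x"
  unfolding agree_at_def gauge_unfold bar_def pull_def cartan.simps pullback_def
  by (simp add: bounded_bilinear.add_left[OF bounded_bilinear_blinfun_compose] bounded_bilinear.diff_left[OF bounded_bilinear_blinfun_compose] bounded_bilinear.scaleR_left[OF bounded_bilinear_blinfun_compose]
      bounded_bilinear.minus_left[OF bounded_bilinear_blinfun_compose] pullback_dd[OF assms(1,2)])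

text \<open>The shears act after the scaling and therefore meet a \<open>t3\<close> already
  multiplied by \<open>g 0 x * g 1 x\<close>.\<close>

lemma gauge_theta:
  "t1 (regauge i g C) x = g 0 x *\<^sub>R t1 C x + (g 2 x * g 0 x * g 1 x) *\<^sub>R t3 C x"
  "t2 (regauge i g C) x = g 1 x *\<^sub>R t2 C x + (g 3 x * g 0 x * g 1 x) *\<^sub>R t3 C x"
  "t3 (regauge i g C) x = (g 0 x * g 1 x) *\<^sub>R t3 C x"
  by (simp_all add: gauge_unfold bar_def)

lemma gauge_twist:
  assumes "\<And>x. x \<in> X \<Longrightarrow> g 4 x = 0" "open X" "x \<in> X"
  shows "agree_at (twist r (regauge i g C)) (regauge i (g(4 := r)) C) x"
proof -
  have "dd (g 4) x = dd (\<lambda>_. 0) x"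
    using D_cong[OF assms(2,3), of "g 4" "\<lambda>_. 0"] assms(1) by (simp add: dd_def)
  moreover have "dd (\<lambda>_::'a. 0::real) x = 0"
    by (rule dd_const)
  ultimately show ?thesis
    using assms(1)[OF assms(3)] unfolding agree_at_def gauge_unfold bar_def cartan.simps
    by simp
qed


section \<open>Uniqueness of the connection forms\<close>

text \<open>Nothing is required of the connection forms on the three vectors, so the notion makes
  sense on the 3-dimensional base as well as on the 8-dimensional bundle.\<close>

definition dual_at :: "'a::real_normed_vector cartan \<Rightarrow> 'a \<Rightarrow> 'a \<Rightarrow> 'a \<Rightarrow> 'a \<Rightarrow> bool" where
  "dual_at C x a b c \<longleftrightarrow>
     t1 C x a = 1 \<and> t1 C x b = 0 \<and> t1 C x c = 0 \<and> t2 C x a = 0 \<and> t2 C x b = 1 \<and> t2 C x c = 0 \<and>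
     t3 C x a = 0 \<and> t3 C x b = 0 \<and> t3 C x c = 1"

text \<open>Here \<open>d2\<close>, \<open>d2b\<close>, \<open>d3\<close>, \<open>d3b\<close> stand
  for differences of connection forms with the same \<open>t1\<close>, \<open>t2\<close>,
  \<open>t3\<close>. Inserting pairs of dual vectors kills nearly all components; only the values of
  \<open>d2b\<close>, \<open>d3\<close> and \<open>d3b\<close> on \<open>c\<close> survive, to be
  removed by the later structure equations.\<close>

lemma cartan_lemma:
  fixes T1 T2 T3 d2 d2b d3 d3b :: "'a::real_normed_vector covector"
  assumes dual: "T1 a = 1" "T1 b = 0" "T1 c = 0" "T2 a = 0" "T2 b = 1" "T2 c = 0" "T3 a = 0" "T3 b = 0" "T3 c = 1"
    and 1: "\<And>u v. (d2 \<curlywedge> T1) u v + (d3 \<curlywedge> T3) u v = 0"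
    and 2: "\<And>u v. (d2b \<curlywedge> T2) u v + (d3b \<curlywedge> T3) u v = 0"
    and 3: "\<And>u v. ((d2 + d2b) \<curlywedge> T3) u v = 0"
    and 4: "d2 c = 0"
  shows "d2 u = 0" "d2b u = d2b c * T3 u" "d3 u = d3 c * T3 u" "d3b u = d2b c * T2 u + d3b c * T3 u"
proof -
  note w = wedge_def blinfun.add_left
  have "d2b a = 0" using 2[of b a] by (simp add: w dual)
  moreover have "d2 a + d2b a = 0" using 3[of a c] by (simp add: w dual)
  moreover have "d3 a = 0" using 1[of a c] by (simp add: w dual 4)
  ultimately have "d2 a = 0" "d3 a = 0" by simp_all
  then show d2: "d2 u = 0" for u using 1[of u a] by (simp add: w dual)
  show "d2b u = d2b c * T3 u" using 3[of u c] by (simp add: w dual d2)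
  show "d3 u = d3 c * T3 u" using 1[of u c] by (simp add: w dual d2)
  show "d3b u = d2b c * T2 u + d3b c * T3 u" using 2[of u c] by (simp add: w dual)
qed

text \<open>After a twist matching one component of \<open>w2\<close>, agreement climbs through the
  structure equations: the equations of the thetas give \<open>w2\<close>, that of \<open>w2\<close>
  gives \<open>w2b\<close>, that of \<open>w2b\<close> gives \<open>w3\<close>, \<open>w3b\<close>
  and most of \<open>w4\<close>, those of \<open>w3\<close> and \<open>w3b\<close> give the rest of
  \<open>w4\<close> with \<open>cR\<close> and \<open>cRb\<close>, and that of \<open>w4\<close>
  gives \<open>cS\<close> and \<open>cSb\<close>.\<close>

lemma cartan_unique:
  fixes C C' :: "('a::euclidean_space) cartan"
  assumes "i \<noteq> 0" and C: "cartan_on i X C" and C': "cartan_on i X C'"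
    and th: "\<And>x. x \<in> X \<Longrightarrow> t1 C x = t1 C' x \<and> t2 C x = t2 C' x \<and> t3 C x = t3 C' x"
    and dual: "\<And>x. x \<in> X \<Longrightarrow> dual_at C x (A1 x) (A2 x) (A3 x)" and sm: "smooth_on A3 X"
  obtains r where "smooth_on r X" "\<And>x. x \<in> X \<Longrightarrow> agree_at (twist r C) C' x"
proof -
  have sC: "smooth_cartan X C" "smooth_cartan X C'" using C C' cartan_on_def by blast+
  have X: "open X" using smooth_cartanD(1)[OF sC(1)] .
  \<comment> \<open>The twist changes \<open>w2\<close> by \<open>r\<close> times \<open>t3\<close>,
    and \<open>t3\<close> is 1 on \<open>A3\<close>; this choice makes the two \<open>w2\<close>
    agree on \<open>A3\<close>, the normalization Cartan's lemma needs.\<close>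
  define r where "r x = (w2 C' x) (A3 x) - (w2 C x) (A3 x)" for x
  have r: "smooth_on r X"
    unfolding r_def
    by (intro smooth_on_diff smooth_on_blinfun_apply smooth_cartanD[OF sC(1)] smooth_cartanD[OF sC(2)] sm)
  define B where "B = twist r C"
  have B: "cartan_on i X B" unfolding B_def by (rule cartan_on_twist[OF C r])
  have tB: "t1 B = t1 C" "t2 B = t2 C" "t3 B = t3 C"
    by (simp_all add: B_def twist_def)
  have eB: "eqs_at i B p u v" and eC': "eqs_at i C' p u v" if "p \<in> X" for p u v
    using B C' that unfolding cartan_on_def by blast+
  note cong = ext_d_cong[OF X]
  have xt: "ext_d (t1 B) p = ext_d (t1 C') p" "ext_d (t2 B) p = ext_d (t2 C') p" "ext_d (t3 B) p = ext_d (t3 C') p"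
    if "p \<in> X" for p
    unfolding tB using th by (auto intro!: cong[OF that])
  have dB: "t1 B p (A1 p) = 1 \<and> t1 B p (A2 p) = 0 \<and> t1 B p (A3 p) = 0 \<and>
     t2 B p (A1 p) = 0 \<and> t2 B p (A2 p) = 1 \<and> t2 B p (A3 p) = 0 \<and>
     t3 B p (A1 p) = 0 \<and> t3 B p (A2 p) = 0 \<and> t3 B p (A3 p) = 1" if "p \<in> X" for p
    using dual[OF that] unfolding dual_at_def tB by blast
  have th': "t1 C' p = t1 B p" "t2 C' p = t2 B p" "t3 C' p = t3 B p" if "p \<in> X" for p
    using th[OF that] by (simp_all add: tB)
  have s1: "w2 B p = w2 C' p \<and> w2b C' p u - w2b B p u = (w2b C' p - w2b B p) (A3 p) * t3 B p u \<and>
     w3 C' p u - w3 B p u = (w3 C' p - w3 B p) (A3 p) * t3 B p u \<and>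
     w3b C' p u - w3b B p u = (w2b C' p - w2b B p) (A3 p) * t2 B p u + (w3b C' p - w3b B p) (A3 p) * t3 B p u"
    if p: "p \<in> X" for p u
  proof -
    have 1: "((w2 C' p - w2 B p) \<curlywedge> t1 B p) u v + ((w3 C' p - w3 B p) \<curlywedge> t3 B p) u v = 0" for u v
      using eB[OF p, of u v] eC'[OF p, of u v] unfolding eqs_at_def xt[OF p] th'[OF p]
      by (simp add: wedge_def blinfun.diff_left algebra_simps)
    have 2: "((w2b C' p - w2b B p) \<curlywedge> t2 B p) u v + ((w3b C' p - w3b B p) \<curlywedge> t3 B p) u v = 0" for u v
      using eB[OF p, of u v] eC'[OF p, of u v] unfolding eqs_at_def xt[OF p] th'[OF p]
      by (simp add: wedge_def blinfun.diff_left algebra_simps)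
    have 3: "((w2 C' p - w2 B p + (w2b C' p - w2b B p)) \<curlywedge> t3 B p) u v = 0" for u v
      using eB[OF p, of u v] eC'[OF p, of u v] unfolding eqs_at_def xt[OF p] th'[OF p]
      by (simp add: wedge_def blinfun.diff_left blinfun.add_left algebra_simps)
    have 4: "(w2 C' p - w2 B p) (A3 p) = 0"
      using dB[OF p] by (simp add: B_def twist_def r_def blinfun.diff_left blinfun.add_left blinfun.scaleR_left)
    from dB[OF p] have d: "t1 B p (A1 p) = 1" "t1 B p (A2 p) = 0" "t1 B p (A3 p) = 0"
     "t2 B p (A1 p) = 0" "t2 B p (A2 p) = 1" "t2 B p (A3 p) = 0"
     "t3 B p (A1 p) = 0" "t3 B p (A2 p) = 0" "t3 B p (A3 p) = 1" by blast+
    note L = cartan_lemma[OF d 1 2 3 4]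
    have "w2 B p = w2 C' p"
      using L(1) by (intro blinfun_eqI) (simp add: blinfun.diff_left)
    then show ?thesis using L(2-4)[of u] by (simp add: blinfun.diff_left)
  qed
  \<comment> \<open>\<open>w2\<close> now agrees throughout the open set, so its differential does
    too and the right-hand sides of its structure equation can be compared.\<close>
  have x2: "ext_d (w2 B) p = ext_d (w2 C') p" if "p \<in> X" for p
    using s1 by (auto intro!: cong[OF that])
  have y: "(w2b C' p - w2b B p) (A3 p) = 0"
      "2 * i * (w3b C' p - w3b B p) (A3 p) + (w4 C' p - w4 B p) (A1 p) = 0"
      "i * (w3 C' p - w3 B p) (A3 p) + (w4 C' p - w4 B p) (A2 p) = 0" if p: "p \<in> X" for p
  proof -
    have e: "2 * i * (t1 B p \<curlywedge> (w3b C' p - w3b B p)) u v + i * (t2 B p \<curlywedge> (w3 C' p - w3 B p)) u v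
       + ((w4 C' p - w4 B p) \<curlywedge> t3 B p) u v = 0" for u v
      using eB[OF p, of u v] eC'[OF p, of u v] unfolding eqs_at_def x2[OF p] th'[OF p]
      by (simp add: wedge_def blinfun.diff_left algebra_simps)
    note s = s1[OF p, folded blinfun.diff_left]
    have "(w3 C' p - w3 B p) (A1 p) = 0" "(w3b C' p - w3b B p) (A1 p) = 0"
      "(w3b C' p - w3b B p) (A2 p) = (w2b C' p - w2b B p) (A3 p)" "(w3 C' p - w3 B p) (A2 p) = 0"
      using s[of "A1 p"] s[of "A2 p"] dB[OF p] by simp_all
    then show "(w2b C' p - w2b B p) (A3 p) = 0"
      "2 * i * (w3b C' p - w3b B p) (A3 p) + (w4 C' p - w4 B p) (A1 p) = 0"
      "i * (w3 C' p - w3 B p) (A3 p) + (w4 C' p - w4 B p) (A2 p) = 0"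
      using e[of "A1 p" "A2 p"] e[of "A1 p" "A3 p"] e[of "A2 p" "A3 p"] dB[OF p] \<open>i \<noteq> 0\<close>
      by (simp_all add: wedge_def)
  qed
  have s2: "w2b B p = w2b C' p" if p: "p \<in> X" for p
    using s1[OF p] y(1)[OF p] by (intro blinfun_eqI) simp
  have x2b: "ext_d (w2b B) p = ext_d (w2b C') p" if "p \<in> X" for p
    using s2 by (auto intro!: cong[OF that])
  have z: "(w3b C' p - w3b B p) (A3 p) = 0" "(w3 C' p - w3 B p) (A3 p) = 0"
     "w4 C' p u - w4 B p u = (w4 C' p - w4 B p) (A3 p) * t3 B p u" if p: "p \<in> X" for p u
  proof -
    have e: "- 2 * i * (t2 B p \<curlywedge> (w3 C' p - w3 B p)) u v - i * (t1 B p \<curlywedge> (w3b C' p - w3b B p)) u v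
       + ((w4 C' p - w4 B p) \<curlywedge> t3 B p) u v = 0" for u v
      using eB[OF p, of u v] eC'[OF p, of u v] unfolding eqs_at_def x2b[OF p] th'[OF p]
      by (simp add: wedge_def blinfun.diff_left algebra_simps)
    have "- i * (w3b C' p - w3b B p) (A3 p) + (w4 C' p - w4 B p) (A1 p) = 0"
      "- 2 * i * (w3 C' p - w3 B p) (A3 p) + (w4 C' p - w4 B p) (A2 p) = 0"
      using e[of "A1 p" "A3 p"] e[of "A2 p" "A3 p"] dB[OF p] by (simp_all add: wedge_def)
    \<comment> \<open>The equations of \<open>w2\<close> and \<open>w2b\<close> share the
      \<open>w4\<close> term; subtracting eliminates it and leaves the factor
      \<open>3 * i\<close>.\<close>
    with y(2,3)[OF p] have "3 * i * (w3b C' p - w3b B p) (A3 p) = 0" "3 * i * (w3 C' p - w3 B p) (A3 p) = 0"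
      by simp_all
    then show z': "(w3b C' p - w3b B p) (A3 p) = 0" "(w3 C' p - w3 B p) (A3 p) = 0"
      using \<open>i \<noteq> 0\<close> by simp_all
    show "w4 C' p u - w4 B p u = (w4 C' p - w4 B p) (A3 p) * t3 B p u"
      using e[of u "A3 p"] dB[OF p] z' by (simp add: wedge_def blinfun.diff_left)
  qed
  have s3: "w3 B p = w3 C' p" "w3b B p = w3b C' p" if p: "p \<in> X" for p
    using s1[OF p] y(1)[OF p] z(1,2)[OF p] by (auto intro!: blinfun_eqI)
  have x3: "ext_d (w3 B) p = ext_d (w3 C') p" "ext_d (w3b B) p = ext_d (w3b C') p" if "p \<in> X" for p
    using s3 by (auto intro!: cong[OF that])
  have s4: "w4 B p = w4 C' p" "cR B p = cR C' p" "cRb B p = cRb C' p" if p: "p \<in> X" for p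
  proof -
    have e: "((w4 C' p - w4 B p) \<curlywedge> t1 B p) u v + (cR C' p - cR B p) * (t2 B p \<curlywedge> t3 B p) u v = 0"
      "((w4 C' p - w4 B p) \<curlywedge> t2 B p) u v + (cRb C' p - cRb B p) * (t1 B p \<curlywedge> t3 B p) u v = 0" for u v
      using eB[OF p, of u v] eC'[OF p, of u v] unfolding eqs_at_def x3[OF p] th'[OF p] s2[OF p] s3[OF p] s1[THEN conjunct1, OF p]
      by (simp_all add: wedge_def blinfun.diff_left algebra_simps)
    \<comment> \<open>The curvature term of the equation of \<open>w3\<close> vanishes on the pair
      \<open>A3\<close>, \<open>A1\<close>, which isolates the last component of
      \<open>w4\<close>.\<close>
    have "(w4 C' p - w4 B p) (A3 p) = 0"
      using e(1)[of "A3 p" "A1 p"] dB[OF p] by (simp add: wedge_def)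
    then show w4: "w4 B p = w4 C' p"
      using z(3)[OF p] by (intro blinfun_eqI) simp
    show "cR B p = cR C' p" "cRb B p = cRb C' p"
      using e(1)[of "A2 p" "A3 p"] e(2)[of "A1 p" "A3 p"] dB[OF p] by (simp_all add: wedge_def w4)
  qed
  have x4: "ext_d (w4 B) p = ext_d (w4 C') p" if "p \<in> X" for p
    using s4 by (auto intro!: cong[OF that])
  have s5: "cS B p = cS C' p" "cSb B p = cSb C' p" if p: "p \<in> X" for p
  proof -
    have e: "(cSb C' p - cSb B p) * (t1 B p \<curlywedge> t3 B p) u v + (cS C' p - cS B p) * (t2 B p \<curlywedge> t3 B p) u v = 0" for u v
      using eB[OF p, of u v] eC'[OF p, of u v] unfolding eqs_at_def x4[OF p] th'[OF p] s2[OF p] s3[OF p] s1[THEN conjunct1, OF p] s4[OF p]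
      by (simp add: algebra_simps)
    show "cS B p = cS C' p" "cSb B p = cSb C' p"
      using e[of "A2 p" "A3 p"] e[of "A1 p" "A3 p"] dB[OF p] by (simp_all add: wedge_def)
  qed
  show thesis
  proof (rule that[OF r])
    show "agree_at (twist r C) C' x" if "x \<in> X" for x
      unfolding B_def[symmetric] agree_at_def
      by (intro conjI th'[OF that, symmetric] s1[OF that, THEN conjunct1] s2[OF that] s3[OF that] s4[OF that] s5[OF that])
  qed
qed


section \<open>Bianchi identities\<close>

text \<open>This is d^2 = 0 for \<open>w3\<close>. After inserting the structure equations the terms
  without curvature cancel; the term in \<open>cS\<close> comes from the differential of
  \<open>w4\<close> multiplied by \<open>t1\<close>.\<close>

lemma bianchi_R:
  fixes C :: "('a::euclidean_space) cartan"
  assumes C: "cartan_on i X C" and p: "p \<in> X"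
  shows "wedge21 (t2 C p \<curlywedge> t3 C p)
    (dd (cR C) p + cR C p *\<^sub>R (w2 C p + 3 *\<^sub>R w2b C p) + cS C p *\<^sub>R t1 C p) u v w = 0"
proof -
  have sC: "smooth_cartan X C" using C cartan_on_def by blast
  note X = smooth_cartanD(1)[OF sC]
  note d = smooth_cartanD(2-)[OF sC, THEN smooth_on_differentiable, OF p]
  have e: "eqs_at i C y u v" if "y \<in> X" for y u v using C that unfolding cartan_on_def by blast
  note E = e[OF p, unfolded eqs_at_def wedge_def blinfun.add_left]
  have "0 = ext_d2 (ext_d (w3 C)) p u v w"
    by (rule ext_d2_ext_d[OF X smooth_cartanD(7)[OF sC] p, symmetric])
  also have "\<dots> = ext_d2 (\<lambda>y u v. (w4 C y \<curlywedge> t1 C y) u v + (w3 C y \<curlywedge> w2b C y) u v + cR C y * (t2 C y \<curlywedge> t3 C y) u v) p u v w"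
    by (rule ext_d2_cong[OF X p]) (use e in \<open>simp add: eqs_at_def\<close>)
  also have "\<dots> = wedge21 (t2 C p \<curlywedge> t3 C p)
    (dd (cR C) p + cR C p *\<^sub>R (w2 C p + 3 *\<^sub>R w2b C p) + cS C p *\<^sub>R t1 C p) u v w"
    by (simp add: ext_d2_add ext_d2_wedge ext_d2_scale_wedge d wedge_differentiable differentiable_add differentiable_mult;
        simp add: wedge21_def E wedge_def blinfun.add_left blinfun.scaleR_left; simp add: algebra_simps)
  finally show ?thesis by simp
qed

text \<open>This is d^2 = 0 for \<open>w4\<close>. Both curvatures \<open>cS\<close> and
  \<open>cSb\<close> occur in the one equation, and this coupling is the source of the common
  coefficient in their differentials.\<close>

lemma bianchi_S:
  fixes C :: "('a::euclidean_space) cartan"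
  assumes C: "cartan_on i X C" and p: "p \<in> X"
  shows "wedge21 (t1 C p \<curlywedge> t3 C p)
    (dd (cSb C) p + cSb C p *\<^sub>R (2 *\<^sub>R w2b C p + 3 *\<^sub>R w2 C p) - (i * cRb C p) *\<^sub>R w3 C p) u v w +
    wedge21 (t2 C p \<curlywedge> t3 C p)
    (dd (cS C) p + cS C p *\<^sub>R (2 *\<^sub>R w2 C p + 3 *\<^sub>R w2b C p) + (i * cR C p) *\<^sub>R w3b C p) u v w = 0"
proof -
  have sC: "smooth_cartan X C" using C cartan_on_def by blast
  note X = smooth_cartanD(1)[OF sC]
  note d = smooth_cartanD(2-)[OF sC, THEN smooth_on_differentiable, OF p]
  have e: "eqs_at i C y u v" if "y \<in> X" for y u v using C that unfolding cartan_on_def by blast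
  note E = e[OF p, unfolded eqs_at_def wedge_def blinfun.add_left]
  have "0 = ext_d2 (ext_d (w4 C)) p u v w"
    by (rule ext_d2_ext_d[OF X smooth_cartanD(9)[OF sC] p, symmetric])
  also have "\<dots> = ext_d2 (\<lambda>y u v. i * (w3 C y \<curlywedge> w3b C y) u v + (w4 C y \<curlywedge> w2 C y) u v + (w4 C y \<curlywedge> w2b C y) u v
       + cSb C y * (t1 C y \<curlywedge> t3 C y) u v + cS C y * (t2 C y \<curlywedge> t3 C y) u v) p u v w"
    by (rule ext_d2_cong[OF X p]) (use e in \<open>simp add: eqs_at_def wedge_def blinfun.add_left algebra_simps\<close>)
  also have "\<dots> = wedge21 (t1 C p \<curlywedge> t3 C p)
    (dd (cSb C) p + cSb C p *\<^sub>R (2 *\<^sub>R w2b C p + 3 *\<^sub>R w2 C p) - (i * cRb C p) *\<^sub>R w3 C p) u v w +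
    wedge21 (t2 C p \<curlywedge> t3 C p)
    (dd (cS C) p + cS C p *\<^sub>R (2 *\<^sub>R w2 C p + 3 *\<^sub>R w2b C p) + (i * cR C p) *\<^sub>R w3b C p) u v w"
    by (simp add: ext_d2_add ext_d2_wedge ext_d2_scale_wedge d wedge_differentiable differentiable_add differentiable_mult;
        simp add: wedge21_def E wedge_def blinfun.add_left blinfun.diff_left blinfun.scaleR_left dd_apply; simp add: algebra_simps)
  finally show ?thesis by simp
qed


section \<open>A distinguished gauge on the base\<close>

lemma wedge21_zero: "wedge21 \<omega> 0 u v w = 0"
  by (simp add: wedge21_def)

text \<open>A coframe with its dual frame. The assumption \<open>norm\<close> is the 12-component of
  the structure equation for the third form; it is the one component no connection form can
  adjust.\<close>

locale normalized_coframe =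
  fixes i :: real and N :: "'a::euclidean_space set" and e1 e2 e3 :: "'a one_form" and A1 A2 A3 :: "'a \<Rightarrow> 'a"
  assumes i: "i \<noteq> 0" and N: "open N"
    and e: "smooth_on e1 N" "smooth_on e2 N" "smooth_on e3 N"
    and A: "smooth_on A1 N" "smooth_on A2 N" "smooth_on A3 N"
    and dual: "\<And>x. x \<in> N \<Longrightarrow> e1 x (A1 x) = 1" "\<And>x. x \<in> N \<Longrightarrow> e1 x (A2 x) = 0" "\<And>x. x \<in> N \<Longrightarrow> e1 x (A3 x) = 0"
      "\<And>x. x \<in> N \<Longrightarrow> e2 x (A1 x) = 0" "\<And>x. x \<in> N \<Longrightarrow> e2 x (A2 x) = 1" "\<And>x. x \<in> N \<Longrightarrow> e2 x (A3 x) = 0"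
      "\<And>x. x \<in> N \<Longrightarrow> e3 x (A1 x) = 0" "\<And>x. x \<in> N \<Longrightarrow> e3 x (A2 x) = 0" "\<And>x. x \<in> N \<Longrightarrow> e3 x (A3 x) = 1"
    and expand: "\<And>x u. x \<in> N \<Longrightarrow> u = e1 x u *\<^sub>R A1 x + e2 x u *\<^sub>R A2 x + e3 x u *\<^sub>R A3 x"
    and norm: "\<And>x. x \<in> N \<Longrightarrow> ext_d e3 x (A1 x) (A2 x) = i"
begin

definition "c12 \<alpha> x = ext_d \<alpha> x (A1 x) (A2 x)"
definition "c13 \<alpha> x = ext_d \<alpha> x (A1 x) (A3 x)"
definition "c23 \<alpha> x = ext_d \<alpha> x (A2 x) (A3 x)"

lemma smooth_c: "smooth_on \<alpha> N \<Longrightarrow> smooth_on (c12 \<alpha>) N" "smooth_on \<alpha> N \<Longrightarrow> smooth_on (c13 \<alpha>) N"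
  "smooth_on \<alpha> N \<Longrightarrow> smooth_on (c23 \<alpha>) N"
  unfolding c12_def c13_def c23_def by (intro smooth_on_ext_d N A; assumption)+

lemma ext_d_expand:
  assumes "smooth_on \<alpha> N" "x \<in> N"
  shows "ext_d \<alpha> x u v = c12 \<alpha> x * (e1 x \<curlywedge> e2 x) u v + c13 \<alpha> x * (e1 x \<curlywedge> e3 x) u v + c23 \<alpha> x * (e2 x \<curlywedge> e3 x) u v"
proof -
  note d = smooth_on_differentiable[OF assms]
  note r = ext_d_commute[of \<alpha> x]
  have add_right: "ext_d \<alpha> x u (v + w) = ext_d \<alpha> x u v + ext_d \<alpha> x u w"
    and scale_right: "ext_d \<alpha> x u (c *\<^sub>R v) = c * ext_d \<alpha> x u v" for u v w c
    using r[of u "v + w"] r[of u v] r[of u w] r[of u "c *\<^sub>R v"]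
    by (simp_all add: ext_d_add_left[OF d] ext_d_scale_left[OF d])
  have self: "ext_d \<alpha> x u u = 0" for u using r[of u u] by simp
  have "ext_d \<alpha> x u v = ext_d \<alpha> x (e1 x u *\<^sub>R A1 x + e2 x u *\<^sub>R A2 x + e3 x u *\<^sub>R A3 x)
     (e1 x v *\<^sub>R A1 x + e2 x v *\<^sub>R A2 x + e3 x v *\<^sub>R A3 x)"
    using expand[OF assms(2), of u] expand[OF assms(2), of v] by simp
  also have "\<dots> = c12 \<alpha> x * (e1 x \<curlywedge> e2 x) u v + c13 \<alpha> x * (e1 x \<curlywedge> e3 x) u v + c23 \<alpha> x * (e2 x \<curlywedge> e3 x) u v"
    unfolding ext_d_add_left[OF d] ext_d_scale_left[OF d] add_right scale_right self
      r[of "A2 x" "A1 x"] r[of "A3 x" "A1 x"] r[of "A3 x" "A2 x"]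
    by (simp add: c12_def c13_def c23_def wedge_def algebra_simps)
  finally show ?thesis .
qed

text \<open>The coefficients below are read off from the structure equations. The one free coefficient is
  fixed by letting \<open>W2b\<close> have no \<open>e3\<close>-component.\<close>

definition "W2p x = (c13 e3 x - c12 e2 x) *\<^sub>R e1 x - c12 e1 x *\<^sub>R e2 x"
definition "W2b x = c12 e2 x *\<^sub>R e1 x + (c23 e3 x + c12 e1 x) *\<^sub>R e2 x"
text \<open>Solves the 12-component of the equation for \<open>W2\<close>. The unknown occurs twice,
  through the differential of \<open>e3\<close>, whose 12-component is \<open>i\<close>, and through
  the \<open>e1\<close>-component of \<open>W3\<close>; hence the divisor
  \<open>2 * i\<close>.\<close>

definition "p3 x = (2 * i * c23 e2 x - i * c13 e1 x - c12 W2p x) * inverse (2 * i)"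
definition "W2 x = W2p x + p3 x *\<^sub>R e3 x"
text \<open>Subtracting the equations for \<open>W2\<close> and \<open>W2b\<close> removes
  \<open>W4\<close>. In the 23-component \<open>W3\<close> enters with coefficients \<open>i\<close>
  and \<open>- 2 * i\<close>, whence the divisor \<open>3 * i\<close>; \<open>s3\<close> arises
  likewise from the 13-component.\<close>

definition "q3 x = (c23 W2 x - c23 W2b x) * inverse (3 * i)"
definition "s3 x = (c13 W2 x - c13 W2b x) * inverse (3 * i)"
definition "W3 x = (c13 e1 x + p3 x) *\<^sub>R e1 x + c23 e1 x *\<^sub>R e2 x + q3 x *\<^sub>R e3 x"
definition "W3b x = c13 e2 x *\<^sub>R e1 x + c23 e2 x *\<^sub>R e2 x + s3 x *\<^sub>R e3 x"
text \<open>The first two coefficients are the 13- and 23-components of the equation for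
  \<open>W2\<close>. The third is the 13-component of that for \<open>W3\<close>, where the
  curvature term has no share.\<close>

definition "W4 x = (c13 W2 x - 2 * i * s3 x) *\<^sub>R e1 x + (c23 W2 x - i * q3 x) *\<^sub>R e2 x
  + (- q3 x * c12 e2 x - c13 W3 x) *\<^sub>R e3 x"
text \<open>Each curvature is the defect of the one component of a structure equation in which it
  appears.\<close>

definition "RR x = c23 W3 x + q3 x * (c23 e3 x + c12 e1 x)"
definition "RRb x = c13 W3b x - (W3b x \<curlywedge> W2 x) (A1 x) (A3 x)"
definition "SS x = c23 W4 x - (i * (W3 x \<curlywedge> W3b x) (A2 x) (A3 x) + (W4 x \<curlywedge> (W2 x + W2b x)) (A2 x) (A3 x))"
definition "SSb x = c13 W4 x - (i * (W3 x \<curlywedge> W3b x) (A1 x) (A3 x) + (W4 x \<curlywedge> (W2 x + W2b x)) (A1 x) (A3 x))"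

definition base_cartan :: "'a cartan" where
  "base_cartan = \<lparr>t1 = e1, t2 = e2, t3 = e3, w2 = W2, w2b = W2b, w3 = W3, w3b = W3b, w4 = W4,
     cR = RR, cRb = RRb, cS = SS, cSb = SSb\<rparr>"

lemma smooth_W2p: "smooth_on W2p N" and smooth_W2b: "smooth_on W2b N"
  unfolding W2p_def W2b_def
  by (intro smooth_on_add smooth_on_diff smooth_on_scaleR smooth_c e N)+

lemma smooth_p3: "smooth_on p3 N"
  unfolding p3_def by (intro smooth_on_diff smooth_on_mult smooth_c e N smooth_on_const smooth_W2p)

lemma smooth_W2: "smooth_on W2 N"
  unfolding W2_def by (intro smooth_on_add smooth_on_scaleR e N smooth_p3 smooth_W2p)

lemma smooth_q3: "smooth_on q3 N" and smooth_s3: "smooth_on s3 N"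
  unfolding q3_def s3_def by (intro smooth_on_diff smooth_on_mult smooth_c N smooth_on_const smooth_W2 smooth_W2b)+

lemma smooth_W3: "smooth_on W3 N" and smooth_W3b: "smooth_on W3b N"
  unfolding W3_def W3b_def
  by (intro smooth_on_add smooth_on_scaleR smooth_c e N smooth_p3 smooth_q3 smooth_s3)+

lemma smooth_W4: "smooth_on W4 N"
  unfolding W4_def
  by (intro smooth_on_add smooth_on_diff smooth_on_minus smooth_on_mult smooth_on_scaleR smooth_c e N smooth_on_const smooth_q3 smooth_s3 smooth_W2 smooth_W3)

lemma smooth_base_cartan: "smooth_cartan N base_cartan"
  unfolding smooth_cartan_def base_cartan_def cartan.simps RR_def RRb_def SS_def SSb_def wedge_def blinfun.add_left
  by (intro conjI smooth_on_add smooth_on_diff smooth_on_minus smooth_on_mult smooth_on_const smooth_on_blinfun_apply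
      smooth_c e A N smooth_q3 smooth_s3 smooth_W2 smooth_W2b smooth_W3 smooth_W3b smooth_W4)

lemmas smooths = smooth_W2 smooth_W2b smooth_W3 smooth_W3b smooth_W4

lemma apply_A:
  assumes "x \<in> N"
  shows "W2 x (A1 x) = c13 e3 x - c12 e2 x" "W2 x (A2 x) = - c12 e1 x" "W2 x (A3 x) = p3 x"
    "W2b x (A1 x) = c12 e2 x" "W2b x (A2 x) = c23 e3 x + c12 e1 x" "W2b x (A3 x) = 0"
    "W3 x (A1 x) = c13 e1 x + p3 x" "W3 x (A2 x) = c23 e1 x" "W3 x (A3 x) = q3 x"
    "W3b x (A1 x) = c13 e2 x" "W3b x (A2 x) = c23 e2 x" "W3b x (A3 x) = s3 x"
    "W4 x (A1 x) = c13 W2 x - 2 * i * s3 x" "W4 x (A2 x) = c23 W2 x - i * q3 x"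
    "W4 x (A3 x) = - q3 x * c12 e2 x - c13 W3 x"
  by (simp_all add: W2_def W2p_def W2b_def W3_def W3b_def W4_def blinfun.add_left blinfun.diff_left
      blinfun.scaleR_left dual[OF assms])

lemma c12_e3: "x \<in> N \<Longrightarrow> c12 e3 x = i"
  unfolding c12_def by (rule norm)

lemma d_e:
  assumes "x \<in> N"
  shows "ext_d e1 x u v = (W2 x \<curlywedge> e1 x) u v + (W3 x \<curlywedge> e3 x) u v"
    "ext_d e2 x u v = (W2b x \<curlywedge> e2 x) u v + (W3b x \<curlywedge> e3 x) u v"
    "ext_d e3 x u v = i * (e1 x \<curlywedge> e2 x) u v + ((W2 x + W2b x) \<curlywedge> e3 x) u v"
  unfolding ext_d_expand[OF e(1) assms] ext_d_expand[OF e(2) assms] ext_d_expand[OF e(3) assms] c12_e3[OF assms]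
  by (simp_all add: wedge_def W2_def W2p_def W2b_def W3_def W3b_def blinfun.add_left blinfun.diff_left
      blinfun.scaleR_left algebra_simps)

lemma c12_W2: "x \<in> N \<Longrightarrow> c12 W2 x = 2 * i * c23 e2 x - i * (c13 e1 x + p3 x)"
proof -
  assume x: "x \<in> N"
  have "c12 W2 x = c12 W2p x + p3 x * i"
    unfolding c12_def W2_def
    by (subst ext_d_add)
      (simp_all add: ext_d_scaleR smooth_on_differentiable[OF _ x] smooth_W2p smooth_p3 e norm[OF x] wedge_def dual[OF x]
        differentiable_scaleR)
  moreover have "2 * i * p3 x = 2 * i * c23 e2 x - i * c13 e1 x - c12 W2p x"
    using i by (simp add: p3_def)
  ultimately show ?thesis by (simp add: algebra_simps)
qed

lemma ext_d_swap: "ext_d \<alpha> x (A3 x) (A1 x) = - c13 \<alpha> x"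
  unfolding c13_def by (rule ext_d_commute)

lemmas c_folds = c12_def[symmetric] c13_def[symmetric] c23_def[symmetric] ext_d_swap

lemma wedge21_A:
  "wedge21 (ext_d \<alpha> x) \<beta> (A1 x) (A2 x) (A3 x) = c12 \<alpha> x * \<beta> (A3 x) + c23 \<alpha> x * \<beta> (A1 x) - c13 \<alpha> x * \<beta> (A2 x)"
  unfolding wedge21_def c_folds by simp

text \<open>Not a matter of choice: d^2 = 0 for \<open>e3\<close> determines the sum of the
  12-components of \<open>W2\<close> and \<open>W2b\<close>, and the former is already
  known.\<close>

lemma c12_W2b:
  assumes x: "x \<in> N"
  shows "c12 W2b x = 2 * i * (c13 e1 x + p3 x) - i * c23 e2 x"
proof -
  note d = e[THEN smooth_on_differentiable, OF x] smooths[THEN smooth_on_differentiable, OF x]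
  have "0 = ext_d2 (ext_d e3) x (A1 x) (A2 x) (A3 x)"
    by (rule ext_d2_ext_d[OF N e(3) x, symmetric])
  also have "\<dots> = ext_d2 (\<lambda>y u v. i * (e1 y \<curlywedge> e2 y) u v + (W2 y \<curlywedge> e3 y) u v + (W2b y \<curlywedge> e3 y) u v) x (A1 x) (A2 x) (A3 x)"
    by (rule ext_d2_cong[OF N x]) (simp add: d_e wedge_def blinfun.add_left algebra_simps)
  also have "\<dots> = i * (- c13 e1 x - c23 e2 x) + c12 W2 x + c12 W2b x - i * p3 x"
    by (simp add: ext_d2_add ext_d2_wedge ext_d2_scale_wedge d wedge_differentiable differentiable_add differentiable_mult;
        simp add: wedge21_A dual[OF x] apply_A[OF x] c12_e3[OF x] dd_const wedge21_zero blinfun.add_left; simp add: algebra_simps)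
  finally show ?thesis using c12_W2[OF x] by (simp add: algebra_simps)
qed

lemma coefficient_eqs:
  "3 * i * q3 x = c23 W2 x - c23 W2b x" "3 * i * s3 x = c13 W2 x - c13 W2b x"
  using i by (simp_all add: q3_def s3_def)

lemma d_W2:
  assumes x: "x \<in> N"
  shows "ext_d W2 x u v = 2 * i * (e1 x \<curlywedge> W3b x) u v + i * (e2 x \<curlywedge> W3 x) u v + (W4 x \<curlywedge> e3 x) u v"
    "ext_d W2b x u v = - 2 * i * (e2 x \<curlywedge> W3 x) u v - i * (e1 x \<curlywedge> W3b x) u v + (W4 x \<curlywedge> e3 x) u v"
proof -
  have c: "c13 W2b x = c13 W2 x - 3 * i * s3 x" "c23 W2b x = c23 W2 x - 3 * i * q3 x"
    using coefficient_eqs[of x] by simp_all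
  show "ext_d W2 x u v = 2 * i * (e1 x \<curlywedge> W3b x) u v + i * (e2 x \<curlywedge> W3 x) u v + (W4 x \<curlywedge> e3 x) u v"
    "ext_d W2b x u v = - 2 * i * (e2 x \<curlywedge> W3 x) u v - i * (e1 x \<curlywedge> W3b x) u v + (W4 x \<curlywedge> e3 x) u v"
    unfolding ext_d_expand[OF smooth_W2 x] ext_d_expand[OF smooth_W2b x] c12_W2[OF x] c12_W2b[OF x] c
    by (simp_all add: wedge_def W3_def W3b_def W4_def blinfun.add_left blinfun.diff_left
        blinfun.scaleR_left algebra_simps)
qed

text \<open>The single component of d^2 = 0 for \<open>e1\<close>, evaluated on the dual frame, is
  the 12-component of the equation for \<open>W3\<close>.\<close>

lemma bianchi_e1:
  assumes x: "x \<in> N"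
  shows "c12 W3 x = (W4 x \<curlywedge> e1 x) (A1 x) (A2 x) + (W3 x \<curlywedge> W2b x) (A1 x) (A2 x)"
proof -
  note d = e[THEN smooth_on_differentiable, OF x] smooths[THEN smooth_on_differentiable, OF x]
  have "0 = ext_d2 (ext_d e1) x (A1 x) (A2 x) (A3 x)"
    by (rule ext_d2_ext_d[OF N e(1) x, symmetric])
  also have "\<dots> = ext_d2 (\<lambda>y u v. (W2 y \<curlywedge> e1 y) u v + (W3 y \<curlywedge> e3 y) u v) x (A1 x) (A2 x) (A3 x)"
    by (rule ext_d2_cong[OF N x]) (simp add: d_e)
  also have "\<dots> = c12 W3 x - ((W4 x \<curlywedge> e1 x) (A1 x) (A2 x) + (W3 x \<curlywedge> W2b x) (A1 x) (A2 x))"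
    by (simp add: ext_d2_add ext_d2_wedge d wedge_differentiable;
        simp add: wedge21_A dual[OF x] apply_A[OF x] c12_e3[OF x] c12_W2[OF x] wedge_def; simp add: algebra_simps)
  finally show ?thesis by simp
qed

text \<open>The counterpart for \<open>e2\<close>. Since \<open>W4\<close> was read off from the
  equation for \<open>W2\<close>, the components of the differential of \<open>W2b\<close> first
  have to be converted by \<open>coefficient_eqs\<close>.\<close>

lemma bianchi_e2:
  assumes x: "x \<in> N"
  shows "c12 W3b x = (W4 x \<curlywedge> e2 x) (A1 x) (A2 x) + (W3b x \<curlywedge> W2 x) (A1 x) (A2 x)"
proof -
  note d = e[THEN smooth_on_differentiable, OF x] smooths[THEN smooth_on_differentiable, OF x]
  have c: "c13 W2b x = c13 W2 x - 3 * i * s3 x" "c23 W2b x = c23 W2 x - 3 * i * q3 x"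
    using coefficient_eqs[of x] by simp_all
  have "0 = ext_d2 (ext_d e2) x (A1 x) (A2 x) (A3 x)"
    by (rule ext_d2_ext_d[OF N e(2) x, symmetric])
  also have "\<dots> = ext_d2 (\<lambda>y u v. (W2b y \<curlywedge> e2 y) u v + (W3b y \<curlywedge> e3 y) u v) x (A1 x) (A2 x) (A3 x)"
    by (rule ext_d2_cong[OF N x]) (simp add: d_e)
  also have "\<dots> = c12 W3b x - ((W4 x \<curlywedge> e2 x) (A1 x) (A2 x) + (W3b x \<curlywedge> W2 x) (A1 x) (A2 x))"
    by (simp add: ext_d2_add ext_d2_wedge d wedge_differentiable;
        simp add: wedge21_A dual[OF x] apply_A[OF x] c12_e3[OF x] c12_W2b[OF x] c wedge_def; simp add: algebra_simps)
  finally show ?thesis by simp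
qed

text \<open>Two defects are unknown. Closedness of the differentials of \<open>W2\<close> and
  \<open>W2b\<close> gives two linear relations between them, independent because \<open>i\<close>
  is nonzero.\<close>

lemma bianchi_W2:
  assumes x: "x \<in> N"
  shows "c23 W3b x = (W4 x \<curlywedge> e2 x) (A2 x) (A3 x) + (W3b x \<curlywedge> W2 x) (A2 x) (A3 x)"
    "c12 W4 x = i * (W3 x \<curlywedge> W3b x) (A1 x) (A2 x) + (W4 x \<curlywedge> (W2 x + W2b x)) (A1 x) (A2 x)"
proof -
  note d = e[THEN smooth_on_differentiable, OF x] smooths[THEN smooth_on_differentiable, OF x]
  let ?X = "c23 W3b x - ((W4 x \<curlywedge> e2 x) (A2 x) (A3 x) + (W3b x \<curlywedge> W2 x) (A2 x) (A3 x))"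
  let ?Z = "c12 W4 x - (i * (W3 x \<curlywedge> W3b x) (A1 x) (A2 x) + (W4 x \<curlywedge> (W2 x + W2b x)) (A1 x) (A2 x))"
  have "0 = ext_d2 (ext_d W2) x (A1 x) (A2 x) (A3 x)"
    by (rule ext_d2_ext_d[OF N smooth_W2 x, symmetric])
  also have "\<dots> = ext_d2 (\<lambda>y u v. (2 * i) * (e1 y \<curlywedge> W3b y) u v + i * (e2 y \<curlywedge> W3 y) u v + (W4 y \<curlywedge> e3 y) u v) x (A1 x) (A2 x) (A3 x)"
    by (rule ext_d2_cong[OF N x]) (simp add: d_W2)
  also have "\<dots> = ?Z - 2 * i * ?X"
    by (simp add: ext_d2_add ext_d2_wedge ext_d2_scale_wedge d wedge_differentiable differentiable_add differentiable_mult;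
        simp add: wedge21_A dual[OF x] apply_A[OF x] c12_e3[OF x] dd_const wedge21_zero wedge_def blinfun.add_left; simp add: algebra_simps)
  finally have 1: "?Z - 2 * i * ?X = 0" by simp
  \<comment> \<open>Naming the negative factors keeps the right-hand side a sum of scaled wedge
    products, the shape to which \<open>ext_d2_add\<close> and \<open>ext_d2_scale_wedge\<close>
    apply.\<close>
  define j k where "j = - 2 * i" and "k = - i"
  have "0 = ext_d2 (ext_d W2b) x (A1 x) (A2 x) (A3 x)"
    by (rule ext_d2_ext_d[OF N smooth_W2b x, symmetric])
  also have "\<dots> = ext_d2 (\<lambda>y u v. j * (e2 y \<curlywedge> W3 y) u v + k * (e1 y \<curlywedge> W3b y) u v + (W4 y \<curlywedge> e3 y) u v) x (A1 x) (A2 x) (A3 x)"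
    by (rule ext_d2_cong[OF N x]) (simp add: d_W2 j_def k_def)
  also have "\<dots> = ?Z + i * ?X"
    by (simp add: ext_d2_add ext_d2_wedge ext_d2_scale_wedge d wedge_differentiable differentiable_add differentiable_mult;
        simp add: wedge21_A dual[OF x] apply_A[OF x] c12_e3[OF x] dd_const wedge21_zero wedge_def blinfun.add_left; simp add: j_def k_def algebra_simps)
  finally have 2: "?Z + i * ?X = 0" by simp
  have "3 * i * ?X = 0" using 1 2 by algebra
  then have "?X = 0" using i by simp
  moreover have "?Z = 0" using 2 \<open>?X = 0\<close> by simp
  ultimately show "c23 W3b x = (W4 x \<curlywedge> e2 x) (A2 x) (A3 x) + (W3b x \<curlywedge> W2 x) (A2 x) (A3 x)"
    "c12 W4 x = i * (W3 x \<curlywedge> W3b x) (A1 x) (A2 x) + (W4 x \<curlywedge> (W2 x + W2b x)) (A1 x) (A2 x)"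
    by simp_all
qed

lemma wedge_expand:
  assumes x: "x \<in> N"
  shows "(\<alpha> \<curlywedge> \<beta>) u v = (\<alpha> \<curlywedge> \<beta>) (A1 x) (A2 x) * (e1 x \<curlywedge> e2 x) u v
    + (\<alpha> \<curlywedge> \<beta>) (A1 x) (A3 x) * (e1 x \<curlywedge> e3 x) u v + (\<alpha> \<curlywedge> \<beta>) (A2 x) (A3 x) * (e2 x \<curlywedge> e3 x) u v"
proof -
  have *: "\<gamma> w = e1 x w * \<gamma> (A1 x) + e2 x w * \<gamma> (A2 x) + e3 x w * \<gamma> (A3 x)" for \<gamma> :: "'a covector" and w
    using arg_cong[OF expand[OF x, of w], of "blinfun_apply \<gamma>"] by (simp add: blinfun.add_right blinfun.scaleR_right)
  show ?thesis
    unfolding wedge_def *[of \<alpha> u] *[of \<alpha> v] *[of \<beta> u] *[of \<beta> v] by (simp add: algebra_simps)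
qed

lemma cartan_on_base: "cartan_on i N base_cartan"
  unfolding cartan_on_def
proof (intro conjI ballI allI smooth_base_cartan)
  fix x u v assume x: "x \<in> N"
  \<comment> \<open>These five components hold by the choice of \<open>W4\<close> and of the
    curvatures; the remaining components of the last three equations are the identities proved from
    d^2 = 0.\<close>
  have 13: "c13 W3 x = (W4 x \<curlywedge> e1 x) (A1 x) (A3 x) + (W3 x \<curlywedge> W2b x) (A1 x) (A3 x)"
    and 23: "c23 W3 x = (W4 x \<curlywedge> e1 x) (A2 x) (A3 x) + (W3 x \<curlywedge> W2b x) (A2 x) (A3 x) + RR x"
    and b13: "c13 W3b x = (W4 x \<curlywedge> e2 x) (A1 x) (A3 x) + (W3b x \<curlywedge> W2 x) (A1 x) (A3 x) + RRb x"
    and s13: "c13 W4 x = i * (W3 x \<curlywedge> W3b x) (A1 x) (A3 x) + (W4 x \<curlywedge> (W2 x + W2b x)) (A1 x) (A3 x) + SSb x"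
    and s23: "c23 W4 x = i * (W3 x \<curlywedge> W3b x) (A2 x) (A3 x) + (W4 x \<curlywedge> (W2 x + W2b x)) (A2 x) (A3 x) + SS x"
    by (simp_all add: wedge_def apply_A[OF x] dual[OF x] RR_def RRb_def SS_def SSb_def)
  have W3: "ext_d W3 x u v = (W4 x \<curlywedge> e1 x) u v + (W3 x \<curlywedge> W2b x) u v + RR x * (e2 x \<curlywedge> e3 x) u v"
    unfolding ext_d_expand[OF smooth_W3 x] bianchi_e1[OF x] 13 23
      wedge_expand[OF x, of "W4 x" "e1 x" u v] wedge_expand[OF x, of "W3 x" "W2b x" u v]
    by (simp add: distrib_right)
  have W3b: "ext_d W3b x u v = (W4 x \<curlywedge> e2 x) u v + (W3b x \<curlywedge> W2 x) u v + RRb x * (e1 x \<curlywedge> e3 x) u v"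
    unfolding ext_d_expand[OF smooth_W3b x] bianchi_e2[OF x] bianchi_W2(1)[OF x] b13
      wedge_expand[OF x, of "W4 x" "e2 x" u v] wedge_expand[OF x, of "W3b x" "W2 x" u v]
    by (simp add: distrib_right)
  have W4: "ext_d W4 x u v = i * (W3 x \<curlywedge> W3b x) u v + (W4 x \<curlywedge> (W2 x + W2b x)) u v
       + SSb x * (e1 x \<curlywedge> e3 x) u v + SS x * (e2 x \<curlywedge> e3 x) u v"
    unfolding ext_d_expand[OF smooth_W4 x] bianchi_W2(2)[OF x] s13 s23
      wedge_expand[OF x, of "W3 x" "W3b x" u v] wedge_expand[OF x, of "W4 x" "W2 x + W2b x" u v]
    by (simp add: distrib_right distrib_left)
  show "eqs_at i base_cartan x u v"
    unfolding eqs_at_def base_cartan_def cartan.simps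
    using d_e[OF x, of u v] d_W2[OF x, of u v] W3 W3b W4 by simp
qed

end


section \<open>Curvature equations\<close>

lemma has_derivative_dd: "f differentiable (at x) \<Longrightarrow> (f has_derivative blinfun_apply (dd f x)) (at x)"
  by (simp add: dd_def bounded_linear_Blinfun_apply bounded_linear_D frechet_derivative_works[symmetric])

text \<open>Contraction with vectors dual to \<open>\<alpha>\<close> and \<open>\<beta>\<close>: if
  the triple product vanishes, \<open>\<xi>\<close> lies in their span with coefficients
  \<open>\<xi> b\<close> and \<open>\<xi> c\<close>.\<close>

lemma wedge21_pair:
  fixes \<alpha> \<beta> \<xi> :: "'a::real_normed_vector covector"
  assumes "\<alpha> b = 1" "\<alpha> c = 0" "\<beta> b = 0" "\<beta> c = 1"
  shows "wedge21 (\<alpha> \<curlywedge> \<beta>) \<xi> u b c = \<xi> u - \<alpha> u * \<xi> b - \<beta> u * \<xi> c"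
  unfolding wedge21_def wedge_def by (simp add: assms)

lemma cartan_R_derivative:
  fixes C :: "('a::euclidean_space) cartan"
  assumes C: "cartan_on i X C" and dual: "\<And>x. x \<in> X \<Longrightarrow> dual_at C x (A1 x) (A2 x) (A3 x)"
    and A: "smooth_on A2 X" "smooth_on A3 X"
  obtains R2 R3 where "smooth_on R2 X" "smooth_on R3 X"
    "\<And>p. p \<in> X \<Longrightarrow> (cR C has_derivative blinfun_apply (- cR C p *\<^sub>R (w2 C p + 3 *\<^sub>R w2b C p) - cS C p *\<^sub>R t1 C p
       + R2 p *\<^sub>R t2 C p + R3 p *\<^sub>R t3 C p)) (at p)"
proof -
  have sC: "smooth_cartan X C" using C cartan_on_def by blast
  note s = smooth_cartanD[OF sC]
  define \<xi> where "\<xi> p = dd (cR C) p + cR C p *\<^sub>R (w2 C p + 3 *\<^sub>R w2b C p) + cS C p *\<^sub>R t1 C p" for p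
  have s\<xi>: "smooth_on \<xi> X"
    unfolding \<xi>_def by (intro smooth_on_add smooth_on_scaleR smooth_on_const smooth_on_dd s)
  have \<xi>: "\<xi> p u = t2 C p u * \<xi> p (A2 p) + t3 C p u * \<xi> p (A3 p)" if p: "p \<in> X" for p u
  proof -
    have d: "t2 C p (A2 p) = 1" "t2 C p (A3 p) = 0" "t3 C p (A2 p) = 0" "t3 C p (A3 p) = 1"
      using dual[OF p] by (auto simp: dual_at_def)
    show ?thesis
      using bianchi_R[OF C p, of u "A2 p" "A3 p"] unfolding \<xi>_def[symmetric] wedge21_pair[OF d] by simp
  qed
  show thesis
  \<comment> \<open>The coefficient functions are the values of the corrected differential on the
    dual vectors, hence smooth.\<close>
  proof (rule that[of "\<lambda>p. \<xi> p (A2 p)" "\<lambda>p. \<xi> p (A3 p)"])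
    show "smooth_on (\<lambda>p. \<xi> p (A2 p)) X" "smooth_on (\<lambda>p. \<xi> p (A3 p)) X"
      by (rule smooth_on_blinfun_apply[OF s(1) s\<xi> A(1)], rule smooth_on_blinfun_apply[OF s(1) s\<xi> A(2)])
    fix p assume p: "p \<in> X"
    have "- cR C p *\<^sub>R (w2 C p + 3 *\<^sub>R w2b C p) - cS C p *\<^sub>R t1 C p
       + \<xi> p (A2 p) *\<^sub>R t2 C p + \<xi> p (A3 p) *\<^sub>R t3 C p = dd (cR C) p"
    proof (rule blinfun_eqI)
      fix u
      have "(- cR C p *\<^sub>R (w2 C p + 3 *\<^sub>R w2b C p) - cS C p *\<^sub>R t1 C p
          + \<xi> p (A2 p) *\<^sub>R t2 C p + \<xi> p (A3 p) *\<^sub>R t3 C p) u =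
        t2 C p u * \<xi> p (A2 p) + t3 C p u * \<xi> p (A3 p) - (cR C p * (w2 C p u + 3 * w2b C p u) + cS C p * t1 C p u)"
        by (simp add: blinfun.add_left blinfun.diff_left blinfun.minus_left blinfun.scaleR_left algebra_simps)
      also have "\<dots> = \<xi> p u - (cR C p * (w2 C p u + 3 * w2b C p u) + cS C p * t1 C p u)"
        using \<xi>[OF p, of u] by simp
      also have "\<dots> = dd (cR C) p u"
        by (simp add: \<xi>_def blinfun.add_left blinfun.scaleR_left)
      finally show "(- cR C p *\<^sub>R (w2 C p + 3 *\<^sub>R w2b C p) - cS C p *\<^sub>R t1 C p
          + \<xi> p (A2 p) *\<^sub>R t2 C p + \<xi> p (A3 p) *\<^sub>R t3 C p) u = dd (cR C) p u" .
    qed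
    then show "(cR C has_derivative blinfun_apply (- cR C p *\<^sub>R (w2 C p + 3 *\<^sub>R w2b C p) - cS C p *\<^sub>R t1 C p
       + \<xi> p (A2 p) *\<^sub>R t2 C p + \<xi> p (A3 p) *\<^sub>R t3 C p)) (at p)"
      using has_derivative_dd[OF smooth_on_differentiable[OF s(10) p]] by simp
  qed
qed

text \<open>One 3-form identity serves both differentials. The same function \<open>S1\<close>
  multiplies \<open>t1\<close> in one and \<open>t2\<close> in the other, which is the asserted
  equality of the two coefficients.\<close>

lemma cartan_S_derivative:
  fixes C :: "('a::euclidean_space) cartan"
  assumes C: "cartan_on i X C" and dual: "\<And>x. x \<in> X \<Longrightarrow> dual_at C x (A1 x) (A2 x) (A3 x)"
    and A: "smooth_on A1 X" "smooth_on A2 X" "smooth_on A3 X"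
  obtains S1 S2 S3 Sb2 Sb3 where "smooth_on S1 X" "smooth_on S2 X" "smooth_on S3 X" "smooth_on Sb2 X" "smooth_on Sb3 X"
    "\<And>p. p \<in> X \<Longrightarrow> (cS C has_derivative blinfun_apply (- cS C p *\<^sub>R (2 *\<^sub>R w2 C p + 3 *\<^sub>R w2b C p) - (i * cR C p) *\<^sub>R w3b C p
       + S1 p *\<^sub>R t1 C p + S2 p *\<^sub>R t2 C p + S3 p *\<^sub>R t3 C p)) (at p)"
    "\<And>p. p \<in> X \<Longrightarrow> (cSb C has_derivative blinfun_apply (- cSb C p *\<^sub>R (2 *\<^sub>R w2b C p + 3 *\<^sub>R w2 C p) + (i * cRb C p) *\<^sub>R w3 C p
       + Sb2 p *\<^sub>R t1 C p + S1 p *\<^sub>R t2 C p + Sb3 p *\<^sub>R t3 C p)) (at p)"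
proof -
  have sC: "smooth_cartan X C" using C cartan_on_def by blast
  note s = smooth_cartanD[OF sC]
  define \<eta> where "\<eta> p = dd (cS C) p + cS C p *\<^sub>R (2 *\<^sub>R w2 C p + 3 *\<^sub>R w2b C p) + (i * cR C p) *\<^sub>R w3b C p" for p
  define \<zeta> where "\<zeta> p = dd (cSb C) p + cSb C p *\<^sub>R (2 *\<^sub>R w2b C p + 3 *\<^sub>R w2 C p) - (i * cRb C p) *\<^sub>R w3 C p" for p
  have s\<eta>: "smooth_on \<eta> X" and s\<zeta>: "smooth_on \<zeta> X"
    unfolding \<eta>_def \<zeta>_def
    by (intro smooth_on_add smooth_on_diff smooth_on_mult smooth_on_scaleR smooth_on_const smooth_on_dd s)+
  have B: "wedge21 (t1 C p \<curlywedge> t3 C p) (\<zeta> p) u v w + wedge21 (t2 C p \<curlywedge> t3 C p) (\<eta> p) u v w = 0" if p: "p \<in> X" for p u v w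
    using bianchi_S[OF C p] unfolding \<eta>_def \<zeta>_def .
  have \<eta>: "\<eta> p u = \<zeta> p (A2 p) * t1 C p u + \<eta> p (A2 p) * t2 C p u + \<eta> p (A3 p) * t3 C p u"
    and \<zeta>: "\<zeta> p u = \<zeta> p (A1 p) * t1 C p u + \<zeta> p (A2 p) * t2 C p u + \<zeta> p (A3 p) * t3 C p u" if p: "p \<in> X" for p u
  proof -
    note d = dual[OF p, unfolded dual_at_def]
    have 1: "\<eta> p u = \<zeta> p (A2 p) * t1 C p u + \<eta> p (A2 p) * t2 C p u + \<eta> p (A3 p) * t3 C p u" for u
      using B[OF p, of u "A2 p" "A3 p"] d by (simp add: wedge21_def wedge_def algebra_simps)
    then show "\<eta> p u = \<zeta> p (A2 p) * t1 C p u + \<eta> p (A2 p) * t2 C p u + \<eta> p (A3 p) * t3 C p u" .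
    \<comment> \<open>The link between the two differentials: the \<open>t1\<close>-component of
      \<open>\<eta>\<close> is the \<open>t2\<close>-component of \<open>\<zeta>\<close>, and this
      value serves as \<open>S1\<close>.\<close>
    have "\<eta> p (A1 p) = \<zeta> p (A2 p)" using 1[of "A1 p"] d by simp
    then show "\<zeta> p u = \<zeta> p (A1 p) * t1 C p u + \<zeta> p (A2 p) * t2 C p u + \<zeta> p (A3 p) * t3 C p u"
      using B[OF p, of u "A1 p" "A3 p"] d by (simp add: wedge21_def wedge_def algebra_simps)
  qed
  show thesis
  proof (rule that[of "\<lambda>p. \<zeta> p (A2 p)" "\<lambda>p. \<eta> p (A2 p)" "\<lambda>p. \<eta> p (A3 p)" "\<lambda>p. \<zeta> p (A1 p)" "\<lambda>p. \<zeta> p (A3 p)"])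
    note ap = smooth_on_blinfun_apply[OF s(1)]
    show "smooth_on (\<lambda>p. \<zeta> p (A2 p)) X" by (rule ap[OF s\<zeta> A(2)])
    show "smooth_on (\<lambda>p. \<eta> p (A2 p)) X" by (rule ap[OF s\<eta> A(2)])
    show "smooth_on (\<lambda>p. \<eta> p (A3 p)) X" by (rule ap[OF s\<eta> A(3)])
    show "smooth_on (\<lambda>p. \<zeta> p (A1 p)) X" by (rule ap[OF s\<zeta> A(1)])
    show "smooth_on (\<lambda>p. \<zeta> p (A3 p)) X" by (rule ap[OF s\<zeta> A(3)])
    fix p assume p: "p \<in> X"
    have "- cS C p *\<^sub>R (2 *\<^sub>R w2 C p + 3 *\<^sub>R w2b C p) - (i * cR C p) *\<^sub>R w3b C p
       + \<zeta> p (A2 p) *\<^sub>R t1 C p + \<eta> p (A2 p) *\<^sub>R t2 C p + \<eta> p (A3 p) *\<^sub>R t3 C p =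
       \<eta> p - (cS C p *\<^sub>R (2 *\<^sub>R w2 C p + 3 *\<^sub>R w2b C p) + (i * cR C p) *\<^sub>R w3b C p)"
      (is "?l = ?r")
    proof (rule blinfun_eqI)
      show "?l u = ?r u" for u
        using \<eta>[OF p, of u]
        by (simp add: blinfun.add_left blinfun.diff_left blinfun.minus_left blinfun.scaleR_left)
    qed
    also have "\<dots> = dd (cS C) p" unfolding \<eta>_def by simp
    finally show "(cS C has_derivative blinfun_apply (- cS C p *\<^sub>R (2 *\<^sub>R w2 C p + 3 *\<^sub>R w2b C p) - (i * cR C p) *\<^sub>R w3b C p
       + \<zeta> p (A2 p) *\<^sub>R t1 C p + \<eta> p (A2 p) *\<^sub>R t2 C p + \<eta> p (A3 p) *\<^sub>R t3 C p)) (at p)"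
      using has_derivative_dd[OF smooth_on_differentiable[OF s(12) p]] by simp
    have "- cSb C p *\<^sub>R (2 *\<^sub>R w2b C p + 3 *\<^sub>R w2 C p) + (i * cRb C p) *\<^sub>R w3 C p
       + \<zeta> p (A1 p) *\<^sub>R t1 C p + \<zeta> p (A2 p) *\<^sub>R t2 C p + \<zeta> p (A3 p) *\<^sub>R t3 C p =
       \<zeta> p - (cSb C p *\<^sub>R (2 *\<^sub>R w2b C p + 3 *\<^sub>R w2 C p) - (i * cRb C p) *\<^sub>R w3 C p)"
      (is "?l = ?r")
    proof (rule blinfun_eqI)
      show "?l u = ?r u" for u
        using \<zeta>[OF p, of u]
        by (simp add: blinfun.add_left blinfun.diff_left blinfun.minus_left blinfun.scaleR_left)
    qed
    also have "\<dots> = dd (cSb C) p" unfolding \<zeta>_def by simp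
    finally show "(cSb C has_derivative blinfun_apply (- cSb C p *\<^sub>R (2 *\<^sub>R w2b C p + 3 *\<^sub>R w2 C p) + (i * cRb C p) *\<^sub>R w3 C p
       + \<zeta> p (A1 p) *\<^sub>R t1 C p + \<zeta> p (A2 p) *\<^sub>R t2 C p + \<zeta> p (A3 p) *\<^sub>R t3 C p)) (at p)"
      using has_derivative_dd[OF smooth_on_differentiable[OF s(13) p]] by simp
  qed
qed

lemma dual_at_bar: "dual_at C x a b c \<Longrightarrow> dual_at (bar C) x b a c"
  by (auto simp: dual_at_def)

lemma cartan_curvature:
  assumes C: "cartan_on i X C" and dual: "\<And>x. x \<in> X \<Longrightarrow> dual_at C x (A1 x) (A2 x) (A3 x)"
    and A: "smooth_on A1 X" "smooth_on A2 X" "smooth_on A3 X"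
  shows "curvature_equations i X (t1 C) (t2 C) (t3 C) (w2 C) (w2b C) (w3 C) (w3b C) (cR C) (cRb C) (cS C) (cSb C)"
proof -
  have sC: "smooth_cartan X C" using C cartan_on_def by blast
  obtain R2 R3 where R: "smooth_on R2 X" "smooth_on R3 X"
    "\<And>p. p \<in> X \<Longrightarrow> (cR C has_derivative blinfun_apply (- cR C p *\<^sub>R (w2 C p + 3 *\<^sub>R w2b C p) - cS C p *\<^sub>R t1 C p
       + R2 p *\<^sub>R t2 C p + R3 p *\<^sub>R t3 C p)) (at p)"
    using cartan_R_derivative[OF C dual A(2,3)] by blast
  obtain Rb2 Rb3 where Rb: "smooth_on Rb2 X" "smooth_on Rb3 X"
    "\<And>p. p \<in> X \<Longrightarrow> (cRb C has_derivative blinfun_apply (- cRb C p *\<^sub>R (w2b C p + 3 *\<^sub>R w2 C p) - cSb C p *\<^sub>R t2 C p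
       + Rb2 p *\<^sub>R t1 C p + Rb3 p *\<^sub>R t3 C p)) (at p)"
    using cartan_R_derivative[OF cartan_on_bar[OF C] dual_at_bar[OF dual] A(1,3), unfolded bar_simps] by blast
  obtain S1 S2 S3 Sb2 Sb3 where S: "smooth_on S1 X" "smooth_on S2 X" "smooth_on S3 X" "smooth_on Sb2 X" "smooth_on Sb3 X"
    "\<And>p. p \<in> X \<Longrightarrow> (cS C has_derivative blinfun_apply (- cS C p *\<^sub>R (2 *\<^sub>R w2 C p + 3 *\<^sub>R w2b C p) - (i * cR C p) *\<^sub>R w3b C p
       + S1 p *\<^sub>R t1 C p + S2 p *\<^sub>R t2 C p + S3 p *\<^sub>R t3 C p)) (at p)"
    "\<And>p. p \<in> X \<Longrightarrow> (cSb C has_derivative blinfun_apply (- cSb C p *\<^sub>R (2 *\<^sub>R w2b C p + 3 *\<^sub>R w2 C p) + (i * cRb C p) *\<^sub>R w3 C p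
       + Sb2 p *\<^sub>R t1 C p + S1 p *\<^sub>R t2 C p + Sb3 p *\<^sub>R t3 C p)) (at p)"
    using cartan_S_derivative[OF C dual A] by blast
  \<comment> \<open>\<open>S1\<close> stands twice in the list because it is also the witness for
    \<open>Sb1\<close>.\<close>
  have sm: "\<forall>f\<in>{R2, Rb2, R3, Rb3, S1, S1, S2, Sb2, S3, Sb3}. smooth_on f X"
    by (simp add: R(1,2) Rb(1,2) S(1-5))
  show ?thesis
    unfolding curvature_equations_def
  proof (intro conjI)
    show "\<forall>f\<in>{cR C, cRb C, cS C, cSb C}. smooth_on f X"
      using smooth_cartanD[OF sC] by simp
    show "\<exists>R2 Rb2 R3 Rb3 S1 Sb1 S2 Sb2 S3 Sb3. (\<forall>f\<in>{R2, Rb2, R3, Rb3, S1, Sb1, S2, Sb2, S3, Sb3}. smooth_on f X) \<and>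
      (\<forall>p\<in>X.
           (cR C has_derivative
              blinfun_apply (- cR C p *\<^sub>R (w2 C p + 3 *\<^sub>R w2b C p) - cS C p *\<^sub>R t1 C p
                + R2 p *\<^sub>R t2 C p + R3 p *\<^sub>R t3 C p)) (at p) \<and>
           (cRb C has_derivative
              blinfun_apply (- cRb C p *\<^sub>R (w2b C p + 3 *\<^sub>R w2 C p) - cSb C p *\<^sub>R t2 C p
                + Rb2 p *\<^sub>R t1 C p + Rb3 p *\<^sub>R t3 C p)) (at p) \<and>
           (cS C has_derivative
              blinfun_apply (- cS C p *\<^sub>R (2 *\<^sub>R w2 C p + 3 *\<^sub>R w2b C p) - (i * cR C p) *\<^sub>R w3b C p
                + S1 p *\<^sub>R t1 C p + S2 p *\<^sub>R t2 C p + S3 p *\<^sub>R t3 C p)) (at p) \<and>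
           (cSb C has_derivative
              blinfun_apply (- cSb C p *\<^sub>R (2 *\<^sub>R w2b C p + 3 *\<^sub>R w2 C p) + (i * cRb C p) *\<^sub>R w3 C p
                + Sb2 p *\<^sub>R t1 C p + Sb1 p *\<^sub>R t2 C p + Sb3 p *\<^sub>R t3 C p)) (at p) \<and>
           S1 p = Sb1 p)"
      by (rule exI[of _ R2], rule exI[of _ Rb2], rule exI[of _ R3], rule exI[of _ Rb3], rule exI[of _ S1], rule exI[of _ S1],
          rule exI[of _ S2], rule exI[of _ Sb2], rule exI[of _ S3], rule exI[of _ Sb3])
        (rule conjI[OF sm], intro ballI conjI R(3) Rb(3) S(6,7) refl)
  qed
qed


section \<open>The gauge of an ODE structure\<close>

text \<open>The contact condition is what permits the normalization of \<open>lam\<close>: it makes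
  its differential nonzero on the two frame vectors that \<open>lam\<close> annihilates.\<close>

lemma ode_base_cartan:
  assumes i: "i \<noteq> 0" and ode: "ode_structure N lam \<mu> \<mu>b"
  obtains E k where "cartan_on i N E" "smooth_on k N"
    "\<And>x. x \<in> N \<Longrightarrow> k x \<noteq> 0 \<and> t1 E x = \<mu> x \<and> t2 E x = \<mu>b x \<and> t3 E x = k x *\<^sub>R lam x"
    "\<And>x w. x \<in> N \<Longrightarrow> t1 E x w = 0 \<Longrightarrow> t2 E x w = 0 \<Longrightarrow> t3 E x w = 0 \<Longrightarrow> w = 0"
proof -
  have N: "open N" and sm: "smooth_on lam N" "smooth_on \<mu> N" "smooth_on \<mu>b N"
    and contact: "\<And>x. x \<in> N \<Longrightarrow> \<exists>u v w. wedge21 (ext_d lam x) (lam x) u v w \<noteq> 0"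
    using ode by (auto simp: ode_structure_def)
  have "coframe_on [lam, \<mu>, \<mu>b] N"
    using ode by (auto simp: ode_structure_def coframe_on_def)
  then obtain X where X: "\<And>k. k < CARD(3) \<Longrightarrow> smooth_on (X k) N"
    "\<And>x j k. x \<in> N \<Longrightarrow> j < CARD(3) \<Longrightarrow> k < CARD(3) \<Longrightarrow> ([lam, \<mu>, \<mu>b] ! j) x (X k x) = (if j = k then 1 else 0)"
    "\<And>x v. x \<in> N \<Longrightarrow> v = (\<Sum>k<CARD(3). ([lam, \<mu>, \<mu>b] ! k) x v *\<^sub>R X k x)"
    using coframe_on_dual[OF N] by blast
  have sX: "smooth_on (X 0) N" "smooth_on (X 1) N" "smooth_on (X 2) N"
    by (rule X(1); simp)+
  have d: "lam x (X 0 x) = 1" "lam x (X 1 x) = 0" "lam x (X 2 x) = 0" "\<mu> x (X 0 x) = 0" "\<mu> x (X 1 x) = 1" "\<mu> x (X 2 x) = 0"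
    "\<mu>b x (X 0 x) = 0" "\<mu>b x (X 1 x) = 0" "\<mu>b x (X 2 x) = 1" if "x \<in> N" for x
    using X(2)[OF that, of 0 0] X(2)[OF that, of 0 1] X(2)[OF that, of 0 2] X(2)[OF that, of 1 0] X(2)[OF that, of 1 1]
      X(2)[OF that, of 1 2] X(2)[OF that, of 2 0] X(2)[OF that, of 2 1] X(2)[OF that, of 2 2] by simp_all
  have ex: "v = lam x v *\<^sub>R X 0 x + \<mu> x v *\<^sub>R X 1 x + \<mu>b x v *\<^sub>R X 2 x" if "x \<in> N" for x v
    using X(3)[OF that, of v] by (simp add: numeral_3_eq_3 numeral_2_eq_2)
  define m where "m x = ext_d lam x (X 1 x) (X 2 x)" for x
  \<comment> \<open>Otherwise every term in the expansion of the differential of \<open>lam\<close>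
    would contain \<open>lam\<close> as a factor, and its product with \<open>lam\<close> would
    vanish.\<close>
  have m0: "m x \<noteq> 0" if x: "x \<in> N" for x
  proof
    assume m: "m x = 0"
    note df = smooth_on_differentiable[OF sm(1) x]
    note r = ext_d_commute[of lam x]
    have add_right: "ext_d lam x u (v + w) = ext_d lam x u v + ext_d lam x u w"
      and scale_right: "ext_d lam x u (c *\<^sub>R v) = c * ext_d lam x u v" for u v w c
      using r[of u "v + w"] r[of u v] r[of u w] r[of u "c *\<^sub>R v"]
      by (simp_all add: ext_d_add_left[OF df] ext_d_scale_left[OF df])
    have self: "ext_d lam x u u = 0" for u using r[of u u] by simp
    have "ext_d lam x u v = ext_d lam x (lam x u *\<^sub>R X 0 x + \<mu> x u *\<^sub>R X 1 x + \<mu>b x u *\<^sub>R X 2 x)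
      (lam x v *\<^sub>R X 0 x + \<mu> x v *\<^sub>R X 1 x + \<mu>b x v *\<^sub>R X 2 x)" for u v
      using ex[OF x, of u] ex[OF x, of v] by simp
    then have e: "ext_d lam x u v = ext_d lam x (X 0 x) (X 1 x) * (lam x u * \<mu> x v - lam x v * \<mu> x u)
       + ext_d lam x (X 0 x) (X 2 x) * (lam x u * \<mu>b x v - lam x v * \<mu>b x u)" for u v
      unfolding ext_d_add_left[OF df] ext_d_scale_left[OF df] add_right scale_right self
        r[of "X 1 x" "X 0 x"] r[of "X 2 x" "X 0 x"] r[of "X 2 x" "X 1 x"] m[unfolded m_def]
      by (simp add: algebra_simps)
    have "wedge21 (ext_d lam x) (lam x) u v w = 0" for u v w
      unfolding wedge21_def e[of u v] e[of v w] e[of w u] by (simp add: algebra_simps)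
    with contact[OF x] show False by blast
  qed
  have sm_m: "smooth_on m N" unfolding m_def by (rule smooth_on_ext_d[OF N sm(1) sX(2,3)])
  \<comment> \<open>\<open>lam\<close> vanishes on \<open>X 1 x\<close> and \<open>X 2 x\<close>, so
    the derivative of the factor drops out and the differential of the rescaled form takes the value
    \<open>k x * m x\<close>, which is \<open>i\<close>.\<close>
  define k where "k x = i * inverse (m x)" for x
  have sk: "smooth_on k N"
    unfolding k_def by (intro smooth_on_mult smooth_on_const smooth_on_inverse N sm_m m0)
  have k0: "k x \<noteq> 0" if "x \<in> N" for x using m0[OF that] i by (simp add: k_def)
  interpret normalized_coframe i N \<mu> \<mu>b "\<lambda>x. k x *\<^sub>R lam x" "X 1" "X 2" "\<lambda>x. inverse (k x) *\<^sub>R X 0 x"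
  proof
    show "smooth_on (\<lambda>x. k x *\<^sub>R lam x) N" "smooth_on (\<lambda>x. inverse (k x) *\<^sub>R X 0 x) N"
      by (intro smooth_on_scaleR smooth_on_inverse N sk k0 sm sX; assumption)+
    show "ext_d (\<lambda>x. k x *\<^sub>R lam x) x (X 1 x) (X 2 x) = i" if x: "x \<in> N" for x
      using smooth_on_differentiable[OF sk x] smooth_on_differentiable[OF sm(1) x] m0[OF x]
      by (simp add: ext_d_scaleR wedge_def d[OF x] m_def[symmetric] k_def[of x] del: One_nat_def)
    show "u = \<mu> x u *\<^sub>R X 1 x + \<mu>b x u *\<^sub>R X 2 x + (k x *\<^sub>R lam x) u *\<^sub>R inverse (k x) *\<^sub>R X 0 x" if x: "x \<in> N" for x u
    proof -
      have eq: "(k x *\<^sub>R lam x) u *\<^sub>R inverse (k x) *\<^sub>R X 0 x = lam x u *\<^sub>R X 0 x"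
        using k0[OF x] by (simp add: blinfun.scaleR_left)
      show ?thesis using ex[OF x, of u] unfolding eq by (simp add: ac_simps)
    qed
  qed (simp_all add: i N sm sX d k0 blinfun.scaleR_left blinfun.scaleR_right del: One_nat_def)
  show thesis
  proof (rule that[OF cartan_on_base sk])
    show "k x \<noteq> 0 \<and> t1 base_cartan x = \<mu> x \<and> t2 base_cartan x = \<mu>b x \<and> t3 base_cartan x = k x *\<^sub>R lam x" if "x \<in> N" for x
      unfolding base_cartan_def cartan.simps using k0[OF that] by simp
    show "w = 0" if "x \<in> N" "t1 base_cartan x w = 0" "t2 base_cartan x w = 0" "t3 base_cartan x w = 0" for x w
      using expand[OF that(1), of w] that(2-4) unfolding base_cartan_def cartan.simps by simp
  qed
qed


section \<open>The bundle over an ODE structure\<close>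

definition cforms :: "'a::real_normed_vector cartan \<Rightarrow> 'a one_form list" where
  "cforms C = [t1 C, t2 C, t3 C, w2 C, w2b C, w3 C, w3b C, w4 C]"

definition cartan_of :: "bundle_data \<Rightarrow> (real^8) cartan" where
  "cartan_of B = \<lparr>t1 = theta1 B, t2 = theta2 B, t3 = theta3 B, w2 = Omega2 B, w2b = Omega2b B,
     w3 = Omega3 B, w3b = Omega3b B, w4 = Omega4 B, cR = curvR B, cRb = curvRb B, cS = curvS B, cSb = curvSb B\<rparr>"

lemma cforms_cartan_of: "cforms (cartan_of B) = forms_of B"
  by (simp add: cforms_def cartan_of_def forms_of_def)

lemma structure_equations_iff:
  "structure_equations i P (theta1 B) (theta2 B) (theta3 B) (Omega2 B) (Omega2b B) (Omega3 B) (Omega3b B) (Omega4 B)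
     (curvR B) (curvRb B) (curvS B) (curvSb B) \<longleftrightarrow> (\<forall>p\<in>P. \<forall>u v. eqs_at i (cartan_of B) p u v)"
  unfolding structure_equations_def eqs_at_def cartan_of_def cartan.simps by (rule refl)

lemma cartan_on_bundle:
  assumes "cartan_bundle i N lam \<mu> \<mu>b B"
  shows "cartan_on i (total_space B) (cartan_of B)"
  unfolding cartan_on_def
proof (intro conjI)
  have "\<forall>\<alpha>\<in>set (forms_of B). smooth_on \<alpha> (total_space B)" "open (total_space B)"
    using assms unfolding cartan_bundle_def adapted_coframe_def fibred_over_def by blast+
  moreover have "\<forall>f\<in>{curvR B, curvRb B, curvS B, curvSb B}. smooth_on f (total_space B)"
    using assms unfolding cartan_bundle_def curvature_equations_def by blast
  ultimately show "smooth_cartan (total_space B) (cartan_of B)"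
    by (simp add: smooth_cartan_def cartan_of_def forms_of_def)
  show "\<forall>p\<in>total_space B. \<forall>u v. eqs_at i (cartan_of B) p u v"
    using assms unfolding cartan_bundle_def structure_equations_iff by blast
qed

lemma coframe_on_bundle:
  assumes "cartan_bundle i N lam \<mu> \<mu>b B"
  shows "coframe_on (cforms (cartan_of B)) (total_space B)"
  unfolding cforms_cartan_of coframe_on_def
proof (intro conjI)
  show "length (forms_of B) = CARD(8)" by (simp add: forms_of_def)
qed (use assms in \<open>simp_all add: cartan_bundle_def adapted_coframe_def\<close>)

lemma coframe_dual_at:
  fixes C :: "(real^8) cartan"
  assumes "open X" "coframe_on (cforms C) X"
  obtains A1 A2 A3 where "smooth_on A1 X" "smooth_on A2 X" "smooth_on A3 X"
    "\<And>x. x \<in> X \<Longrightarrow> dual_at C x (A1 x) (A2 x) (A3 x)"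
proof -
  obtain Y where Y: "\<And>k. k < CARD(8) \<Longrightarrow> smooth_on (Y k) X"
    "\<And>x j k. x \<in> X \<Longrightarrow> j < CARD(8) \<Longrightarrow> k < CARD(8) \<Longrightarrow> (cforms C ! j) x (Y k x) = (if j = k then 1 else 0)"
    "\<And>x v. x \<in> X \<Longrightarrow> v = (\<Sum>k<CARD(8). (cforms C ! k) x v *\<^sub>R Y k x)"
    using coframe_on_dual[OF assms] by blast
  show thesis
  proof (rule that[of "Y 0" "Y 1" "Y 2"])
    show "smooth_on (Y 0) X" "smooth_on (Y 1) X" "smooth_on (Y 2) X" by (rule Y(1); simp)+
    show "dual_at C x (Y 0 x) (Y 1 x) (Y 2 x)" if "x \<in> X" for x
      using Y(2)[OF that, of 0 0] Y(2)[OF that, of 0 1] Y(2)[OF that, of 0 2] Y(2)[OF that, of 1 0] Y(2)[OF that, of 1 1]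
        Y(2)[OF that, of 1 2] Y(2)[OF that, of 2 0] Y(2)[OF that, of 2 1] Y(2)[OF that, of 2 2]
      by (simp add: dual_at_def cforms_def)
  qed
qed

section \<open>The product bundle in coordinates\<close>

definition proj :: "real^8 \<Rightarrow> real^3" where
  "proj x = mkvec (\<lambda>j. crd j x)"

definition fibre_crd :: "nat \<Rightarrow> real^8 \<Rightarrow> real" where
  "fibre_crd j = crd (j + 3)"

definition point :: "real^3 \<Rightarrow> (nat \<Rightarrow> real) \<Rightarrow> real^8" where
  "point y g = mkvec (\<lambda>j. if j < 3 then crd j y else g (j - 3))"

lemma proj_point: "proj (point y g) = y"
  by (rule crd_eqI) (simp add: proj_def point_def crd_mkvec)

lemma fibre_crd_point: "j < 5 \<Longrightarrow> fibre_crd j (point y g) = g j"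
  by (simp add: fibre_crd_def point_def crd_mkvec)

lemma point_eqI:
  assumes "proj x = proj y" "\<And>j. j < 5 \<Longrightarrow> fibre_crd j x = fibre_crd j y"
  shows "x = y"
proof (rule crd_eqI)
  fix j assume j: "j < CARD(8)"
  show "crd j x = crd j y"
  proof (cases "j < 3")
    case True
    then show ?thesis
      using arg_cong[OF assms(1), of "crd j"] by (simp add: proj_def crd_mkvec)
  next
    case False
    then show ?thesis using assms(2)[of "j - 3"] j by (simp add: fibre_crd_def)
  qed
qed

lemma smooth_on_point:
  assumes "open U" "smooth_on f U" "\<And>j. j < 5 \<Longrightarrow> smooth_on (g j) U"
  shows "smooth_on (\<lambda>x. point (f x) (\<lambda>j. g j x)) U"
  unfolding point_def
proof (rule smooth_on_mkvec[OF assms(1)])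
  fix j assume "j < CARD(8)"
  then show "smooth_on (\<lambda>x. if j < 3 then crd j (f x) else g (j - 3) x) U"
    by (cases "j < 3") (simp_all add: smooth_on_crd[OF assms(1,2)] assms(3))
qed

lemma smooth_on_fibre_crd: "open U \<Longrightarrow> smooth_on (fibre_crd j) U"
  unfolding fibre_crd_def using smooth_on_crd[OF _ smooth_on_ident] by blast

lemma smooth_on_proj: "open U \<Longrightarrow> smooth_on proj U"
  unfolding proj_def[abs_def] by (intro smooth_on_mkvec smooth_on_crd smooth_on_ident)

lemma bounded_linear_proj: "bounded_linear proj"
proof -
  have "linear proj"
    by (rule linearI) (simp_all add: proj_def mkvec_def crd_def vec_eq_iff)
  then show ?thesis by (simp add: linear_conv_bounded_linear)
qed

lemma D_proj: "D proj x = proj"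
  by (rule D_bounded_linear[OF bounded_linear_proj])

lemma dd_fibre_crd: "dd (fibre_crd j) x u = fibre_crd j u"
  unfolding fibre_crd_def
  by (simp add: dd_apply bounded_linear_imp_differentiable[OF bounded_linear_crd] D_bounded_linear[OF bounded_linear_crd])

text \<open>The five fibre coordinates are the parameters of \<open>regauge\<close>; the two
  diagonal ones must be nonzero, either sign being allowed.\<close>

definition bundle_over :: "(real^3) set \<Rightarrow> (real^8) set" where
  "bundle_over N = {x. proj x \<in> N \<and> fibre_crd 0 x \<noteq> 0 \<and> fibre_crd 1 x \<noteq> 0}"

definition bundle_cartan :: "real \<Rightarrow> (real^3) cartan \<Rightarrow> (real^8) cartan" where
  "bundle_cartan i E = regauge i fibre_crd (pull proj E)"

definition bundle_of :: "real \<Rightarrow> (real^3) set \<Rightarrow> (real^3) cartan \<Rightarrow> bundle_data" where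
  "bundle_of i N E = (let C = bundle_cartan i E in
    \<lparr>total_space = bundle_over N, base_proj = proj, theta1 = t1 C, theta2 = t2 C, theta3 = t3 C,
     Omega2 = w2 C, Omega2b = w2b C, Omega3 = w3 C, Omega3b = w3b C, Omega4 = w4 C,
     curvR = cR C, curvRb = cRb C, curvS = cS C, curvSb = cSb C\<rparr>)"

lemma bundle_of_simps [simp]:
  "cartan_of (bundle_of i N E) = bundle_cartan i E" "total_space (bundle_of i N E) = bundle_over N"
  "base_proj (bundle_of i N E) = proj"
  by (simp_all add: cartan_of_def bundle_of_def Let_def)

lemma open_bundle_over:
  assumes "open N"
  shows "open (bundle_over N)"
proof -
  have "continuous_on UNIV proj" "continuous_on UNIV (fibre_crd j)" for j
    by (rule smooth_on_continuous_on[OF smooth_on_proj], simp) (rule smooth_on_continuous_on[OF smooth_on_fibre_crd], simp)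
  then have "open (proj -` N)" "open (fibre_crd j -` (- {0}))" for j
    using assms by (auto intro!: open_vimage)
  moreover have "bundle_over N = proj -` N \<inter> fibre_crd 0 -` (- {0}) \<inter> fibre_crd 1 -` (- {0})"
    by (auto simp: bundle_over_def)
  ultimately show ?thesis by auto
qed

lemma gauge_fun_fibre_crd: "open N \<Longrightarrow> gauge_fun fibre_crd (bundle_over N)"
  unfolding gauge_fun_def by (auto simp: open_bundle_over smooth_on_fibre_crd) (auto simp: bundle_over_def)

lemma cartan_on_bundle_cartan:
  assumes "cartan_on i N E"
  shows "cartan_on i (bundle_over N) (bundle_cartan i E)"
proof -
  have N: "open N" using assms unfolding cartan_on_def smooth_cartan_def by blast
  show ?thesis
    unfolding bundle_cartan_def
  proof (rule cartan_on_gauge[OF cartan_on_pull[OF open_bundle_over[OF N] _ _ assms] gauge_fun_fibre_crd[OF N]])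
    show "smooth_on proj (bundle_over N)" by (rule smooth_on_proj[OF open_bundle_over[OF N]])
    show "proj ` bundle_over N \<subseteq> N" by (auto simp: bundle_over_def)
  qed
qed

lemma proj_differentiable: "proj differentiable (at x)"
  by (rule bounded_linear_imp_differentiable[OF bounded_linear_proj])

text \<open>A vector killed by the three thetas is vertical, so all pulled back forms vanish on it.
  On vertical vectors the connection forms are triangular in the differentials of the fibre
  coordinates, which therefore vanish in turn.\<close>

lemma coframe_on_bundle_cartan:
  assumes C: "cartan_on i N E"
    and sep: "\<And>x w. x \<in> N \<Longrightarrow> t1 E x w = 0 \<Longrightarrow> t2 E x w = 0 \<Longrightarrow> t3 E x w = 0 \<Longrightarrow> w = 0"
  shows "coframe_on (cforms (bundle_cartan i E)) (bundle_over N)"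
  unfolding coframe_on_def
proof (intro conjI ballI)
  let ?C = "bundle_cartan i E"
  show "length (cforms ?C) = CARD(8)" by (simp add: cforms_def)
  have "smooth_cartan (bundle_over N) ?C"
    using cartan_on_bundle_cartan[OF C] unfolding cartan_on_def by blast
  then show "smooth_on \<alpha> (bundle_over N)" if "\<alpha> \<in> set (cforms ?C)" for \<alpha>
    using that unfolding smooth_cartan_def cforms_def by auto
  fix p assume p: "p \<in> bundle_over N"
  then have pN: "proj p \<in> N" and nz: "fibre_crd 0 p \<noteq> 0" "fibre_crd 1 p \<noteq> 0" by (auto simp: bundle_over_def)
  show "\<exists>v. wedge_list (map (\<lambda>\<alpha>. \<alpha> p) (cforms ?C)) v \<noteq> 0"
  proof (rule separating_wedge_list)
    show "length (map (\<lambda>\<alpha>. \<alpha> p) (cforms ?C)) = CARD(8)" by (simp add: cforms_def)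
    fix u assume "\<And>\<alpha>. \<alpha> \<in> set (map (\<lambda>\<alpha>. \<alpha> p) (cforms ?C)) \<Longrightarrow> \<alpha> u = 0"
    then have z: "t1 ?C p u = 0" "t2 ?C p u = 0" "t3 ?C p u = 0" "w2 ?C p u = 0" "w2b ?C p u = 0" "w3 ?C p u = 0"
      "w3b ?C p u = 0" "w4 ?C p u = 0"
      by (simp_all add: cforms_def)
    let ?F = "pull proj E"
    have t3: "t3 ?F p u = 0"
      using z(3) nz by (simp add: bundle_cartan_def gauge_theta blinfun.scaleR_left)
    have t1: "t1 ?F p u = 0"
      using z(1) nz t3 by (simp add: bundle_cartan_def gauge_theta blinfun.add_left blinfun.scaleR_left)
    have t2: "t2 ?F p u = 0"
      using z(2) nz t3 by (simp add: bundle_cartan_def gauge_theta blinfun.add_left blinfun.scaleR_left)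
    have "proj u = 0"
      using sep[OF pN, of "proj u"] t1 t2 t3 by (simp add: pull_def pullback_apply[OF proj_differentiable] D_proj)
    then have F0: "w2 ?F p u = 0" "w2b ?F p u = 0" "w3 ?F p u = 0" "w3b ?F p u = 0" "w4 ?F p u = 0"
      by (simp_all add: pull_def pullback_apply[OF proj_differentiable] D_proj)
    note simps = bundle_cartan_def gauge_unfold bar_def blinfun.add_left blinfun.diff_left blinfun.minus_left blinfun.scaleR_left
      t1 t2 t3 F0 nz dd_fibre_crd
    have f0: "fibre_crd 0 u = 0" using z(4) by (simp add: simps)
    have f1: "fibre_crd 1 u = 0" using z(5) by (simp add: simps del: One_nat_def)
    have f2: "fibre_crd 2 u = 0" using z(6) f1 by (simp add: simps del: One_nat_def)
    have f3: "fibre_crd 3 u = 0" using z(7) f0 by (simp add: simps)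
    have f4: "fibre_crd 4 u = 0" using z(8) f0 f1 f2 f3 by (simp add: simps del: One_nat_def)
    have "fibre_crd j u = fibre_crd j 0" if "j < 5" for j
    proof -
      have "j = 0 \<or> j = 1 \<or> j = 2 \<or> j = 3 \<or> j = 4" using that by auto
      moreover have "fibre_crd j 0 = 0" by (simp add: fibre_crd_def crd_def)
      ultimately show ?thesis using f0 f1 f2 f3 f4 by auto
    qed
    moreover have "proj u = proj 0"
      using \<open>proj u = 0\<close> linear_0[OF bounded_linear.linear[OF bounded_linear_proj]] by simp
    ultimately show "u = 0" by (intro point_eqI)
  qed
qed

lemma pullback_scaleR: "pullback f (\<lambda>x. k x *\<^sub>R \<alpha> x) p = k (f p) *\<^sub>R pullback f \<alpha> p"
  by (simp add: pullback_def bounded_bilinear.scaleR_left[OF bounded_bilinear_blinfun_compose])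

lemma pullback_cong_at: "\<alpha> (f p) = \<beta> (f p) \<Longrightarrow> pullback f \<alpha> p = pullback f \<beta> p"
  by (simp add: pullback_def)

lemma cartan_bundle_bundle_of:
  assumes C: "cartan_on i N E" and k: "smooth_on k N"
    and E: "\<And>x. x \<in> N \<Longrightarrow> k x \<noteq> 0 \<and> t1 E x = \<mu> x \<and> t2 E x = \<mu>b x \<and> t3 E x = k x *\<^sub>R lam x"
    and sep: "\<And>x w. x \<in> N \<Longrightarrow> t1 E x w = 0 \<Longrightarrow> t2 E x w = 0 \<Longrightarrow> t3 E x w = 0 \<Longrightarrow> w = 0"
  shows "cartan_bundle i N lam \<mu> \<mu>b (bundle_of i N E)"
proof -
  let ?B = "bundle_of i N E" and ?C = "bundle_cartan i E" and ?P = "bundle_over N"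
  have N: "open N" using C unfolding cartan_on_def smooth_cartan_def by blast
  note P = open_bundle_over[OF N]
  have cf: "coframe_on (cforms ?C) ?P" by (rule coframe_on_bundle_cartan[OF C sep])
  have CC: "cartan_on i ?P ?C" by (rule cartan_on_bundle_cartan[OF C])
  have fields: "theta1 ?B = t1 ?C" "theta2 ?B = t2 ?C" "theta3 ?B = t3 ?C" "Omega2 ?B = w2 ?C" "Omega2b ?B = w2b ?C"
    "Omega3 ?B = w3 ?C" "Omega3b ?B = w3b ?C" "curvR ?B = cR ?C" "curvRb ?B = cRb ?C" "curvS ?B = cS ?C" "curvSb ?B = cSb ?C"
    by (simp_all add: bundle_of_def Let_def)
  have "fibred_over ?B N"
    unfolding fibred_over_def bundle_of_simps
  proof (intro conjI ballI P smooth_on_proj)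
    show "proj ` ?P = N"
    proof
      show "proj ` ?P \<subseteq> N" by (auto simp: bundle_over_def)
      show "N \<subseteq> proj ` ?P"
      proof
        fix y assume "y \<in> N"
        \<comment> \<open>Any values do for a preimage, provided the first two fibre coordinates are
          nonzero.\<close>
        then have "point y (\<lambda>_. 1) \<in> ?P" by (simp add: bundle_over_def proj_point fibre_crd_point)
        then show "y \<in> proj ` ?P"
          using image_eqI[of y proj "point y (\<lambda>_. 1)" ?P] by (simp add: proj_point)
      qed
    qed
    show "surj (D proj p)" for p
      unfolding D_proj by (rule surjI[of _ "\<lambda>y. point y (\<lambda>_. 0)"]) (rule proj_point)
  qed
  moreover have "adapted_coframe ?B lam \<mu> \<mu>b"
    unfolding adapted_coframe_def bundle_of_simps
  proof (intro conjI)
    have f: "forms_of ?B = cforms ?C" using cforms_cartan_of[of ?B] by simp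
    show "\<forall>\<alpha>\<in>set (forms_of ?B). smooth_on \<alpha> ?P" "\<forall>p\<in>?P. \<exists>v. wedge_list (map (\<lambda>\<alpha>. \<alpha> p) (forms_of ?B)) v \<noteq> 0"
      using cf unfolding f coframe_on_def by simp_all
    have sk: "smooth_on (\<lambda>p. k (proj p)) ?P"
      by (rule smooth_on_compose[OF P N _ smooth_on_proj[OF P] k]) (auto simp: bundle_over_def)
    note sf = smooth_on_fibre_crd[OF P]
    let ?a = "\<lambda>p. fibre_crd 0 p * fibre_crd 1 p * k (proj p)"
    show "\<exists>a b bb c cb. (\<forall>f\<in>{a, b, bb, c, cb}. smooth_on f ?P) \<and>
        (\<forall>p\<in>?P. a p * b p * bb p \<noteq> 0 \<and>
           theta1 ?B p = b p *\<^sub>R pullback proj \<mu> p + c p *\<^sub>R pullback proj lam p \<and>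
           theta2 ?B p = bb p *\<^sub>R pullback proj \<mu>b p + cb p *\<^sub>R pullback proj lam p \<and>
           theta3 ?B p = a p *\<^sub>R pullback proj lam p)"
    \<comment> \<open>Read off from \<open>gauge_theta\<close>, with the third base form replaced by
      \<open>k\<close> times \<open>lam\<close>.\<close>
    proof (rule exI[of _ ?a], rule exI[of _ "fibre_crd 0"], rule exI[of _ "fibre_crd 1"],
        rule exI[of _ "\<lambda>p. fibre_crd 2 p * ?a p"], rule exI[of _ "\<lambda>p. fibre_crd 3 p * ?a p"], rule conjI)
      have "smooth_on ?a ?P" "smooth_on (\<lambda>p. fibre_crd 2 p * ?a p) ?P" "smooth_on (\<lambda>p. fibre_crd 3 p * ?a p) ?P"
        by (intro smooth_on_mult P sf sk)+
      then show "\<forall>f\<in>{?a, fibre_crd 0, fibre_crd 1, \<lambda>p. fibre_crd 2 p * ?a p, \<lambda>p. fibre_crd 3 p * ?a p}. smooth_on f ?P"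
        using sf by simp
      show "\<forall>p\<in>?P. ?a p * fibre_crd 0 p * fibre_crd 1 p \<noteq> 0 \<and>
           theta1 ?B p = fibre_crd 0 p *\<^sub>R pullback proj \<mu> p + (fibre_crd 2 p * ?a p) *\<^sub>R pullback proj lam p \<and>
           theta2 ?B p = fibre_crd 1 p *\<^sub>R pullback proj \<mu>b p + (fibre_crd 3 p * ?a p) *\<^sub>R pullback proj lam p \<and>
           theta3 ?B p = ?a p *\<^sub>R pullback proj lam p"
      proof
        fix p assume p: "p \<in> ?P"
        then have pN: "proj p \<in> N" and nz: "fibre_crd 0 p \<noteq> 0" "fibre_crd 1 p \<noteq> 0" by (auto simp: bundle_over_def)
        have "t1 (pull proj E) p = pullback proj \<mu> p" "t2 (pull proj E) p = pullback proj \<mu>b p"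
          "t3 (pull proj E) p = k (proj p) *\<^sub>R pullback proj lam p"
          using E[OF pN] pullback_cong_at[of "t1 E" proj p \<mu>] pullback_cong_at[of "t2 E" proj p \<mu>b]
            pullback_cong_at[of "t3 E" proj p "\<lambda>x. k x *\<^sub>R lam x"]
          by (simp_all add: pull_def pullback_scaleR)
        then show "?a p * fibre_crd 0 p * fibre_crd 1 p \<noteq> 0 \<and>
           theta1 ?B p = fibre_crd 0 p *\<^sub>R pullback proj \<mu> p + (fibre_crd 2 p * ?a p) *\<^sub>R pullback proj lam p \<and>
           theta2 ?B p = fibre_crd 1 p *\<^sub>R pullback proj \<mu>b p + (fibre_crd 3 p * ?a p) *\<^sub>R pullback proj lam p \<and>
           theta3 ?B p = ?a p *\<^sub>R pullback proj lam p"
          using nz E[OF pN] by (simp add: fields bundle_cartan_def gauge_theta mult.assoc)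
      qed
    qed
  qed
  moreover have "structure_equations i ?P (theta1 ?B) (theta2 ?B) (theta3 ?B) (Omega2 ?B) (Omega2b ?B) (Omega3 ?B) (Omega3b ?B)
     (Omega4 ?B) (curvR ?B) (curvRb ?B) (curvS ?B) (curvSb ?B)"
    unfolding structure_equations_iff bundle_of_simps using CC unfolding cartan_on_def by blast
  moreover have "curvature_equations i ?P (theta1 ?B) (theta2 ?B) (theta3 ?B) (Omega2 ?B) (Omega2b ?B) (Omega3 ?B) (Omega3b ?B)
     (curvR ?B) (curvRb ?B) (curvS ?B) (curvSb ?B)"
    unfolding fields
  proof (rule coframe_dual_at[OF P cf])
    fix A1 A2 A3 assume A: "smooth_on A1 ?P" "smooth_on A2 ?P" "smooth_on A3 ?P"
      and dual: "\<And>x. x \<in> ?P \<Longrightarrow> dual_at ?C x (A1 x) (A2 x) (A3 x)"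
    show "curvature_equations i ?P (t1 ?C) (t2 ?C) (t3 ?C) (w2 ?C) (w2b ?C) (w3 ?C) (w3b ?C) (cR ?C) (cRb ?C) (cS ?C) (cSb ?C)"
      by (rule cartan_curvature[OF CC dual A])
  qed
  ultimately show ?thesis
    unfolding cartan_bundle_def bundle_of_simps by (intro conjI)
qed


section \<open>Universality\<close>

lemma bundle_lift_iff:
  "bundle_lift \<phi> B B' \<Phi> \<longleftrightarrow> local_diffeo \<Phi> (total_space B) (total_space B') \<and>
     (\<forall>p\<in>total_space B. base_proj B' (\<Phi> p) = \<phi> (base_proj B p) \<and>
        agree_at (pull \<Phi> (cartan_of B')) (cartan_of B) p)"
  unfolding bundle_lift_def agree_at_def pull_def cartan_of_def cartan.simps forms_of_def functions_of_def
  by (simp add: conj_ac)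

lemma gauge_w2:
  "w2 (regauge i g C) x = w2 (regauge i (g(4 := \<lambda>_. 0)) C) x + g 4 x *\<^sub>R t3 (regauge i g C) x"
  by (simp add: gauge_unfold bar_def)

text \<open>Evaluating the common thetas on the dual vectors determines the first four parameters.
  They agree on an open set, so their differentials do as well, and \<open>w2\<close> then differs
  only by the twist term, which yields parameter 4.\<close>

lemma gauge_inj:
  fixes F :: "('a::euclidean_space) cartan"
  assumes X: "open X" "x \<in> X" and j: "j < 5"
    and g: "\<And>x. x \<in> X \<Longrightarrow> g 0 x \<noteq> 0 \<and> g 1 x \<noteq> 0"
    and agree: "\<And>x. x \<in> X \<Longrightarrow> agree_at (regauge i h F) (regauge i g F) x"
    and dual: "\<And>x. x \<in> X \<Longrightarrow> dual_at (regauge i g F) x (A1 x) (A2 x) (A3 x)"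
  shows "h j x = g j x"
proof -
  have *: "h 0 y = g 0 y \<and> h 1 y = g 1 y \<and> h 2 y = g 2 y \<and> h 3 y = g 3 y" if y: "y \<in> X" for y
  proof -
    note d = dual[OF y, unfolded dual_at_def gauge_theta blinfun.add_left blinfun.scaleR_left real_scaleR_def]
    have "t1 (regauge i h F) y u = t1 (regauge i g F) y u" "t2 (regauge i h F) y u = t2 (regauge i g F) y u"
      "t3 (regauge i h F) y u = t3 (regauge i g F) y u" for u
      using agree[OF y] by (simp_all add: agree_at_def)
    note e = this[unfolded gauge_theta blinfun.add_left blinfun.scaleR_left real_scaleR_def, symmetric]
    have t3: "t3 F y (A1 y) = 0" "t3 F y (A2 y) = 0" using d g[OF y] by auto
    have c: "g 0 y * g 1 y * t3 F y (A3 y) = 1" "h 0 y * h 1 y * t3 F y (A3 y) = 1"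
      using d e(3)[of "A3 y"] by simp_all
    have a: "g 0 y * t1 F y (A1 y) = 1" "h 0 y * t1 F y (A1 y) = 1"
      using d e(1)[of "A1 y"] t3 by simp_all
    have b: "g 1 y * t2 F y (A2 y) = 1" "h 1 y * t2 F y (A2 y) = 1"
      using d e(2)[of "A2 y"] t3 by simp_all
    have 0: "h 0 y = g 0 y" using a by (metis mult_cancel_right mult_zero_right zero_neq_one)
    have 1: "h 1 y = g 1 y" using b by (metis mult_cancel_right mult_zero_right zero_neq_one)
    have d3: "g 0 y * t1 F y (A3 y) + g 2 y * g 0 y * g 1 y * t3 F y (A3 y) = 0"
      "g 1 y * t2 F y (A3 y) + g 3 y * g 0 y * g 1 y * t3 F y (A3 y) = 0"
      using d by blast+
    have "g 2 y * (g 0 y * g 1 y * t3 F y (A3 y)) = h 2 y * (g 0 y * g 1 y * t3 F y (A3 y))"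
      "g 3 y * (g 0 y * g 1 y * t3 F y (A3 y)) = h 3 y * (g 0 y * g 1 y * t3 F y (A3 y))"
      using e(1,2)[of "A3 y"] unfolding 0 1 by (simp_all add: mult.assoc del: One_nat_def)
    then have 2: "h 2 y = g 2 y" and 3: "h 3 y = g 3 y" unfolding c by simp_all
    show ?thesis using 0 1 2 3 by blast
  qed
  have lt5: "j = 0 \<or> j = 1 \<or> j = 2 \<or> j = 3 \<or> j = 4" if "j < 5" for j :: nat using that by auto
  have "agree_at (regauge i (h(4 := \<lambda>_. 0)) F) (regauge i (g(4 := \<lambda>_. 0)) F) x"
  proof (rule gauge_cong[OF X agree_at_refl])
    fix j y assume "j < (5::nat)" "y \<in> X"
    then show "(h(4 := \<lambda>_. 0)) j y = (g(4 := \<lambda>_. 0)) j y"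
      using *[of y] lt5[of j] by auto
  qed
  then have "w2 (regauge i (h(4 := \<lambda>_. 0)) F) x = w2 (regauge i (g(4 := \<lambda>_. 0)) F) x"
    by (simp add: agree_at_def)
  moreover have "w2 (regauge i h F) x = w2 (regauge i g F) x" "t3 (regauge i h F) x = t3 (regauge i g F) x"
    using agree[OF X(2)] by (simp_all add: agree_at_def)
  ultimately have "h 4 x *\<^sub>R t3 (regauge i g F) x = g 4 x *\<^sub>R t3 (regauge i g F) x"
    using gauge_w2[of i h F x] gauge_w2[of i g F x] by simp
  then have "(h 4 x *\<^sub>R t3 (regauge i g F) x) (A3 x) = (g 4 x *\<^sub>R t3 (regauge i g F) x) (A3 x)"
    by (rule arg_cong)
  then have "h 4 x = g 4 x"
    using dual[OF X(2)] by (simp add: dual_at_def blinfun.scaleR_left)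
  then show ?thesis using *[OF X(2)] lt5[OF j] by auto
qed

text \<open>A general change of the three forms has five coefficients, while a gauge transformation
  offers four at this level. The structure equations supply the missing relation; what remains after
  matching the thetas is a twist.\<close>

lemma gauge_exists:
  fixes F C :: "('a::euclidean_space) cartan"
  assumes i: "i \<noteq> 0" and F: "cartan_on i X F" and C: "cartan_on i X C"
    and sm: "smooth_on \<beta> X" "smooth_on \<beta>' X" "smooth_on \<gamma> X" "smooth_on \<gamma>' X" "smooth_on h X"
    and nz: "\<And>x. x \<in> X \<Longrightarrow> \<beta> x \<noteq> 0 \<and> \<beta>' x \<noteq> 0 \<and> h x \<noteq> 0"
    and th: "\<And>x. x \<in> X \<Longrightarrow> t1 C x = \<beta> x *\<^sub>R t1 F x + \<gamma> x *\<^sub>R t3 F x \<and>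
      t2 C x = \<beta>' x *\<^sub>R t2 F x + \<gamma>' x *\<^sub>R t3 F x \<and> t3 C x = h x *\<^sub>R t3 F x"
    and dual: "\<And>x. x \<in> X \<Longrightarrow> dual_at C x (A1 x) (A2 x) (A3 x)" and A3: "smooth_on A3 X"
  shows "\<exists>g. gauge_fun g X \<and> (\<forall>x\<in>X. agree_at (regauge i g F) C x)"
proof -
  have sF: "smooth_cartan X F" using F cartan_on_def by blast
  have X: "open X" using smooth_cartanD(1)[OF sF] .
  \<comment> \<open>Both data satisfy the equation for the third form with the same constant
    \<open>i\<close>; comparing them on \<open>A1 x\<close> and \<open>A2 x\<close> fixes the scale
    of that form.\<close>
  have h: "h x = \<beta> x * \<beta>' x" if x: "x \<in> X" for x
  proof -
    note d = dual[OF x, unfolded dual_at_def]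
    have d': "\<beta> x * t1 F x (A1 x) + \<gamma> x * t3 F x (A1 x) = 1" "\<beta> x * t1 F x (A2 x) + \<gamma> x * t3 F x (A2 x) = 0"
      "\<beta>' x * t2 F x (A1 x) + \<gamma>' x * t3 F x (A1 x) = 0" "\<beta>' x * t2 F x (A2 x) + \<gamma>' x * t3 F x (A2 x) = 1"
      "h x * t3 F x (A1 x) = 0" "h x * t3 F x (A2 x) = 0"
      using d th[OF x] by (simp_all add: blinfun.add_left blinfun.scaleR_left)
    have t3: "t3 F x (A1 x) = 0" "t3 F x (A2 x) = 0" using d'(5,6) nz[OF x] by simp_all
    have t: "\<beta> x * t1 F x (A1 x) = 1" "t1 F x (A2 x) = 0" "t2 F x (A1 x) = 0" "\<beta>' x * t2 F x (A2 x) = 1"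
      using d' t3 nz[OF x] by simp_all
    have "i = ext_d (t3 C) x (A1 x) (A2 x)"
      using C x d unfolding cartan_on_def eqs_at_def by (simp add: wedge_def)
    also have "\<dots> = ext_d (\<lambda>x. h x *\<^sub>R t3 F x) x (A1 x) (A2 x)"
      using ext_d_cong[OF X x, of "t3 C" "\<lambda>x. h x *\<^sub>R t3 F x"] th by simp
    also have "\<dots> = h x * ext_d (t3 F) x (A1 x) (A2 x)"
      by (simp add: ext_d_scaleR smooth_on_differentiable[OF sm(5) x] smooth_on_differentiable[OF smooth_cartanD(4)[OF sF] x]
          wedge_def t3)
    also have "\<dots> = h x * (i * (t1 F x (A1 x) * t2 F x (A2 x)))"
      using F x unfolding cartan_on_def eqs_at_def by (simp add: wedge_def t3 t)
    finally have "1 = h x * (t1 F x (A1 x) * t2 F x (A2 x))" using i by simp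
    then have "\<beta> x * \<beta>' x = h x * ((\<beta> x * t1 F x (A1 x)) * (\<beta>' x * t2 F x (A2 x)))" by algebra
    then show ?thesis unfolding t by simp
  qed
  \<comment> \<open>The shear parameters are divided by \<open>h\<close> because
    \<open>gauge_theta\<close> multiplies them by \<open>g 0 x * g 1 x\<close>, which equals
    \<open>h x\<close>. Parameter 4 starts at 0 and is replaced by the twist function found
    below.\<close>
  define g where "g j = (if j = 0 then \<beta> else if j = 1 then \<beta>' else if j = 2 then (\<lambda>x. \<gamma> x * inverse (h x))
     else if j = 3 then (\<lambda>x. \<gamma>' x * inverse (h x)) else (\<lambda>_. 0))" for j :: nat
  have gs: "g 0 = \<beta>" "g 1 = \<beta>'" "g 2 = (\<lambda>x. \<gamma> x * inverse (h x))" "g 3 = (\<lambda>x. \<gamma>' x * inverse (h x))" "g 4 = (\<lambda>_. 0)"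
    by (simp_all add: g_def)
  have sg: "smooth_on (g j) X" for j
  proof -
    have "smooth_on (\<lambda>x. \<gamma> x * inverse (h x)) X" "smooth_on (\<lambda>x. \<gamma>' x * inverse (h x)) X"
      using nz by (intro smooth_on_mult smooth_on_inverse X sm; simp)+
    then show ?thesis
      using sm smooth_on_const[OF X, of "0::real"] unfolding g_def by simp
  qed
  have gf: "gauge_fun g X"
    unfolding gauge_fun_def using X sg nz by (simp add: gs del: One_nat_def)
  have C0: "cartan_on i X (regauge i g F)" by (rule cartan_on_gauge[OF F gf])
  have th0: "t1 (regauge i g F) x = t1 C x \<and> t2 (regauge i g F) x = t2 C x \<and> t3 (regauge i g F) x = t3 C x" if x: "x \<in> X" for x
  proof -
    have "\<beta> x * \<beta>' x = h x" "h x \<noteq> 0" using h[OF x] nz[OF x] by simp_all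
    then have "\<gamma> x * inverse (h x) * \<beta> x * \<beta>' x = \<gamma> x" "\<gamma>' x * inverse (h x) * \<beta> x * \<beta>' x = \<gamma>' x"
      by (simp_all add: mult.assoc)
    then show ?thesis
      unfolding gauge_theta gs using th[OF x] h[OF x] by simp
  qed
  have dual0: "dual_at (regauge i g F) x (A1 x) (A2 x) (A3 x)" if "x \<in> X" for x
    using dual[OF that] th0[OF that] by (simp add: dual_at_def)
  show ?thesis
  proof (rule cartan_unique[OF i C0 C th0 dual0 A3])
    fix r assume r: "smooth_on r X" and agree: "\<And>x. x \<in> X \<Longrightarrow> agree_at (twist r (regauge i g F)) C x"
    have "gauge_fun (g(4 := r)) X"
      using gf r unfolding gauge_fun_def by auto
    moreover have "agree_at (regauge i (g(4 := r)) F) C x" if x: "x \<in> X" for x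
    proof -
      have "agree_at (twist r (regauge i g F)) (regauge i (g(4 := r)) F) x"
        by (rule gauge_twist[OF _ X x]) (simp add: gs)
      then show ?thesis by (rule agree_at_trans[OF agree_at_sym agree[OF x]])
    qed
    ultimately show ?thesis by blast
  qed
qed

lemma local_diffeo_smooth: "local_diffeo f U V \<Longrightarrow> smooth_on f U"
  by (rule smooth_on_local) (auto simp: local_diffeo_def)

text \<open>On the total space the thetas of \<open>B\<close> and the pulled back base forms are
  both expressed through the same three forms on the source base, by \<open>adapted_coframe\<close>
  and by \<open>point_equivalence\<close>. Eliminating these gives the change of forms that
  \<open>gauge_exists\<close> expects.\<close>

lemma lift_gauge_exists:
  assumes i: "i \<noteq> 0" and ode': "ode_structure N' lam' \<mu>' \<mu>b'"
    and pe: "point_equivalence \<phi> N' lam' \<mu>' \<mu>b' N lam \<mu> \<mu>b"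
    and cb: "cartan_bundle i N' lam' \<mu>' \<mu>b' B"
    and C: "cartan_on i N E" and k: "smooth_on k N"
    and E: "\<And>x. x \<in> N \<Longrightarrow> k x \<noteq> 0 \<and> t1 E x = \<mu> x \<and> t2 E x = \<mu>b x \<and> t3 E x = k x *\<^sub>R lam x"
  shows "\<exists>g. gauge_fun g (total_space B) \<and>
    (\<forall>p\<in>total_space B. agree_at (regauge i g (pull (\<lambda>p. \<phi> (base_proj B p)) E)) (cartan_of B) p)"
    and "smooth_on (\<lambda>p. \<phi> (base_proj B p)) (total_space B)" and "(\<lambda>p. \<phi> (base_proj B p)) ` total_space B \<subseteq> N"
proof -
  let ?P = "total_space B" and ?\<pi> = "base_proj B"
  let ?\<sigma> = "\<lambda>p. \<phi> (?\<pi> p)"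
  have N: "open N" using C unfolding cartan_on_def smooth_cartan_def by blast
  have N': "open N'" using ode' by (simp add: ode_structure_def)
  have fib: "fibred_over B N'" and ac: "adapted_coframe B lam' \<mu>' \<mu>b'" using cb by (simp_all add: cartan_bundle_def)
  have P: "open ?P" and s\<pi>: "smooth_on ?\<pi> ?P" and \<pi>: "?\<pi> ` ?P = N'" using fib by (simp_all add: fibred_over_def)
  have ld: "local_diffeo \<phi> N' N" using pe by (simp add: point_equivalence_def)
  have s\<phi>: "smooth_on \<phi> N'" by (rule local_diffeo_smooth[OF ld])
  have \<phi>N: "\<phi> ` N' \<subseteq> N" using ld by (simp add: local_diffeo_def)
  show s\<sigma>: "smooth_on ?\<sigma> ?P"
    by (rule smooth_on_compose[OF P N' _ s\<pi> s\<phi>]) (simp add: \<pi>)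
  show \<sigma>N: "?\<sigma> ` ?P \<subseteq> N" using \<pi> \<phi>N by auto
  obtain a b bb c cb where abc: "smooth_on a N'" "smooth_on b N'" "smooth_on bb N'" "smooth_on c N'" "smooth_on cb N'"
    and e: "\<forall>x\<in>N'. a x * b x * bb x \<noteq> 0 \<and> pullback \<phi> lam x = a x *\<^sub>R lam' x \<and>
           pullback \<phi> \<mu> x = b x *\<^sub>R \<mu>' x + c x *\<^sub>R lam' x \<and>
           pullback \<phi> \<mu>b x = bb x *\<^sub>R \<mu>b' x + cb x *\<^sub>R lam' x"
    using pe unfolding point_equivalence_def by auto
  obtain a' b' bb' c' cb' where abc': "smooth_on a' ?P" "smooth_on b' ?P" "smooth_on bb' ?P" "smooth_on c' ?P" "smooth_on cb' ?P"
    and e': "\<forall>p\<in>?P. a' p * b' p * bb' p \<noteq> 0 \<and>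
           theta1 B p = b' p *\<^sub>R pullback ?\<pi> \<mu>' p + c' p *\<^sub>R pullback ?\<pi> lam' p \<and>
           theta2 B p = bb' p *\<^sub>R pullback ?\<pi> \<mu>b' p + cb' p *\<^sub>R pullback ?\<pi> lam' p \<and>
           theta3 B p = a' p *\<^sub>R pullback ?\<pi> lam' p"
    using ac unfolding adapted_coframe_def by auto
  have s\<pi>': "smooth_on (\<lambda>p. f (?\<pi> p)) ?P" if "smooth_on f N'" for f :: "real^3 \<Rightarrow> real"
    by (rule smooth_on_compose[OF P N' _ s\<pi> that]) (simp add: \<pi>)
  have sk: "smooth_on (\<lambda>p. k (?\<sigma> p)) ?P" by (rule smooth_on_compose[OF P N \<sigma>N s\<sigma> k])
  note sabc = abc[THEN s\<pi>']
  have nz: "a (?\<pi> p) \<noteq> 0" "b (?\<pi> p) \<noteq> 0" "bb (?\<pi> p) \<noteq> 0" "a' p \<noteq> 0" "b' p \<noteq> 0" "bb' p \<noteq> 0" "k (?\<sigma> p) \<noteq> 0"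
    if "p \<in> ?P" for p
  proof -
    have "?\<pi> p \<in> N'" "?\<sigma> p \<in> N" using that \<pi> \<sigma>N by auto
    then show "a (?\<pi> p) \<noteq> 0" "b (?\<pi> p) \<noteq> 0" "bb (?\<pi> p) \<noteq> 0" "a' p \<noteq> 0" "b' p \<noteq> 0" "bb' p \<noteq> 0" "k (?\<sigma> p) \<noteq> 0"
      using bspec[OF e, of "?\<pi> p"] bspec[OF e' that] E[of "?\<sigma> p"] by auto
  qed
  \<comment> \<open>Quotients of the two sets of coefficients; \<open>k\<close> enters because the
    third base form is \<open>k\<close> times \<open>lam\<close>, and the corrections by
    \<open>c\<close> and \<open>cb\<close> remove the \<open>lam'\<close> terms that
    \<open>\<phi>\<close> itself produces.\<close>
  define \<beta> where "\<beta> p = b' p * inverse (b (?\<pi> p))" for p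
  define \<beta>' where "\<beta>' p = bb' p * inverse (bb (?\<pi> p))" for p
  define h where "h p = a' p * inverse (a (?\<pi> p)) * inverse (k (?\<sigma> p))" for p
  define \<gamma> where "\<gamma> p = (c' p - \<beta> p * c (?\<pi> p)) * inverse (a (?\<pi> p)) * inverse (k (?\<sigma> p))" for p
  define \<gamma>' where "\<gamma>' p = (cb' p - \<beta>' p * cb (?\<pi> p)) * inverse (a (?\<pi> p)) * inverse (k (?\<sigma> p))" for p
  have s\<beta>: "smooth_on \<beta> ?P" "smooth_on \<beta>' ?P" "smooth_on h ?P"
    unfolding \<beta>_def \<beta>'_def h_def by (intro smooth_on_mult smooth_on_inverse P abc' sabc sk nz; assumption)+
  have s\<gamma>: "smooth_on \<gamma> ?P" "smooth_on \<gamma>' ?P"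
    unfolding \<gamma>_def \<gamma>'_def by (intro smooth_on_mult smooth_on_diff smooth_on_inverse P abc' sabc sk nz s\<beta>; assumption)+
  let ?F = "pull ?\<sigma> E" and ?C = "cartan_of B"
  have th: "t1 ?C p = \<beta> p *\<^sub>R t1 ?F p + \<gamma> p *\<^sub>R t3 ?F p \<and>
      t2 ?C p = \<beta>' p *\<^sub>R t2 ?F p + \<gamma>' p *\<^sub>R t3 ?F p \<and> t3 ?C p = h p *\<^sub>R t3 ?F p" if p: "p \<in> ?P" for p
  proof -
    have \<pi>p: "?\<pi> p \<in> N'" and \<sigma>p: "?\<sigma> p \<in> N" using p \<pi> \<sigma>N by auto
    let ?L = "pullback ?\<pi> lam' p"
    have pb: "pullback ?\<sigma> \<alpha> p = pullback ?\<pi> (pullback \<phi> \<alpha>) p" for \<alpha>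
      by (rule pullback_pullback[OF smooth_on_differentiable[OF s\<pi> p] smooth_on_differentiable[OF s\<phi> \<pi>p], symmetric])
    note ex = bspec[OF e \<pi>p]
    have "pullback ?\<sigma> lam p = a (?\<pi> p) *\<^sub>R ?L"
      "pullback ?\<sigma> \<mu> p = b (?\<pi> p) *\<^sub>R pullback ?\<pi> \<mu>' p + c (?\<pi> p) *\<^sub>R ?L"
      "pullback ?\<sigma> \<mu>b p = bb (?\<pi> p) *\<^sub>R pullback ?\<pi> \<mu>b' p + cb (?\<pi> p) *\<^sub>R ?L"
      unfolding pb using ex
      by (simp_all add: pullback_def[of ?\<pi>] bounded_bilinear.scaleR_left[OF bounded_bilinear_blinfun_compose]
          bounded_bilinear.add_left[OF bounded_bilinear_blinfun_compose])
    moreover have "t1 ?F p = pullback ?\<sigma> \<mu> p" "t2 ?F p = pullback ?\<sigma> \<mu>b p" "t3 ?F p = k (?\<sigma> p) *\<^sub>R pullback ?\<sigma> lam p"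
      using E[OF \<sigma>p] pullback_cong_at[of "t1 E" ?\<sigma> p \<mu>] pullback_cong_at[of "t2 E" ?\<sigma> p \<mu>b]
        pullback_cong_at[of "t3 E" ?\<sigma> p "\<lambda>x. k x *\<^sub>R lam x"]
      by (simp_all add: pull_def pullback_scaleR)
    ultimately have F: "t1 ?F p = b (?\<pi> p) *\<^sub>R pullback ?\<pi> \<mu>' p + c (?\<pi> p) *\<^sub>R ?L"
      "t2 ?F p = bb (?\<pi> p) *\<^sub>R pullback ?\<pi> \<mu>b' p + cb (?\<pi> p) *\<^sub>R ?L" "t3 ?F p = (k (?\<sigma> p) * a (?\<pi> p)) *\<^sub>R ?L"
      by simp_all
    have "\<beta> p * b (?\<pi> p) = b' p" "\<beta>' p * bb (?\<pi> p) = bb' p" "h p * (k (?\<sigma> p) * a (?\<pi> p)) = a' p"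
      "\<gamma> p * (k (?\<sigma> p) * a (?\<pi> p)) = c' p - \<beta> p * c (?\<pi> p)" "\<gamma>' p * (k (?\<sigma> p) * a (?\<pi> p)) = cb' p - \<beta>' p * cb (?\<pi> p)"
      using nz[OF p] by (simp_all add: \<beta>_def \<beta>'_def h_def \<gamma>_def \<gamma>'_def field_simps)
    moreover have "t1 ?C p = b' p *\<^sub>R pullback ?\<pi> \<mu>' p + c' p *\<^sub>R ?L" "t2 ?C p = bb' p *\<^sub>R pullback ?\<pi> \<mu>b' p + cb' p *\<^sub>R ?L"
      "t3 ?C p = a' p *\<^sub>R ?L"
      using bspec[OF e' p] by (simp_all add: cartan_of_def)
    ultimately show ?thesis
      by (simp add: F scaleR_add_right scaleR_diff_left)
  qed
  have nz': "\<beta> p \<noteq> 0 \<and> \<beta>' p \<noteq> 0 \<and> h p \<noteq> 0" if "p \<in> ?P" for p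
    using nz[OF that] by (simp add: \<beta>_def \<beta>'_def h_def)
  show "\<exists>g. gauge_fun g ?P \<and> (\<forall>p\<in>?P. agree_at (regauge i g ?F) ?C p)"
  proof (rule coframe_dual_at[OF P coframe_on_bundle[OF cb]])
    fix A1 A2 A3 assume A: "smooth_on A1 ?P" "smooth_on A2 ?P" "smooth_on A3 ?P"
      and dual: "\<And>x. x \<in> ?P \<Longrightarrow> dual_at ?C x (A1 x) (A2 x) (A3 x)"
    show ?thesis
      by (rule gauge_exists[OF i cartan_on_pull[OF P s\<sigma> \<sigma>N C] cartan_on_bundle[OF cb] s\<beta>(1,2) s\<gamma> s\<beta>(3) nz' th dual A(3)])
  qed
qed

text \<open>The pullback of the tautological data along a map depends only on its base component and
  its fibre coordinates, the latter taking the role of gauge functions. Existence and uniqueness of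
  lifts thus become statements about gauge functions.\<close>

lemma pull_bundle_cartan:
  assumes "open U" "smooth_on \<Phi> U" "p \<in> U" "\<And>q. q \<in> U \<Longrightarrow> proj (\<Phi> q) = \<sigma> q"
    "\<And>j q. j < 5 \<Longrightarrow> q \<in> U \<Longrightarrow> fibre_crd j (\<Phi> q) = g j q"
  shows "agree_at (pull \<Phi> (bundle_cartan i E)) (regauge i g (pull \<sigma> E)) p"
proof -
  note d = smooth_on_differentiable[OF assms(2,3)]
  have fc: "fibre_crd j differentiable (at x)" for j x
    by (rule smooth_on_differentiable[OF smooth_on_fibre_crd[OF open_UNIV] UNIV_I])
  have "agree_at (pull \<Phi> (bundle_cartan i E)) (regauge i (\<lambda>j q. fibre_crd j (\<Phi> q)) (pull \<Phi> (pull proj E))) p"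
    unfolding bundle_cartan_def by (rule pull_gauge[OF d fc])
  moreover have "agree_at (pull \<Phi> (pull proj E)) (pull \<sigma> E) p"
    by (rule agree_at_trans[OF pull_pull[OF d proj_differentiable] pull_cong[OF assms(1,3,4)]])
  then have "agree_at (regauge i (\<lambda>j q. fibre_crd j (\<Phi> q)) (pull \<Phi> (pull proj E))) (regauge i g (pull \<sigma> E)) p"
    by (rule gauge_cong[OF assms(1,3) _ assms(5)])
  ultimately show ?thesis by (rule agree_at_trans)
qed

theorem theorem2:
  fixes i :: real
    and N :: "(real^3) set"
    and lam \<mu> \<mu>b :: "(real^3) one_form"
  assumes "i \<noteq> 0"
    and "ode_structure N lam \<mu> \<mu>b"
  shows "\<exists>B. cartan_bundle i N lam \<mu> \<mu>b B \<and>
    (\<forall>N' lam' \<mu>' \<mu>b' \<phi> B'.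
       ode_structure N' lam' \<mu>' \<mu>b' \<and>
       point_equivalence \<phi> N' lam' \<mu>' \<mu>b' N lam \<mu> \<mu>b \<and>
       cartan_bundle i N' lam' \<mu>' \<mu>b' B' \<longrightarrow>
       (\<exists>\<Phi>. bundle_lift \<phi> B' B \<Phi> \<and>
          (\<forall>\<Psi>. bundle_lift \<phi> B' B \<Psi> \<longrightarrow> (\<forall>p\<in>total_space B'. \<Psi> p = \<Phi> p))))"
proof (rule ode_base_cartan[OF assms])
  fix E k
  assume E: "cartan_on i N E" "smooth_on k N"
    "\<And>x. x \<in> N \<Longrightarrow> k x \<noteq> 0 \<and> t1 E x = \<mu> x \<and> t2 E x = \<mu>b x \<and> t3 E x = k x *\<^sub>R lam x"
    and sep: "\<And>x w. x \<in> N \<Longrightarrow> t1 E x w = 0 \<Longrightarrow> t2 E x w = 0 \<Longrightarrow> t3 E x w = 0 \<Longrightarrow> w = 0"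
  have N: "open N" using assms(2) by (simp add: ode_structure_def)
  let ?B = "bundle_of i N E"
  show ?thesis
  proof (intro exI[of _ ?B] conjI allI impI)
    show "cartan_bundle i N lam \<mu> \<mu>b ?B"
      by (rule cartan_bundle_bundle_of[OF E sep])
    fix N' lam' \<mu>' \<mu>b' \<phi> B'
    assume asm: "ode_structure N' lam' \<mu>' \<mu>b' \<and> point_equivalence \<phi> N' lam' \<mu>' \<mu>b' N lam \<mu> \<mu>b \<and>
       cartan_bundle i N' lam' \<mu>' \<mu>b' B'"
    let ?P = "total_space B'"
    let ?\<sigma> = "\<lambda>p. \<phi> (base_proj B' p)"
    have cb: "cartan_bundle i N' lam' \<mu>' \<mu>b' B'" using asm by blast
    note lift = lift_gauge_exists[OF assms(1) asm[THEN conjunct1] asm[THEN conjunct2, THEN conjunct1] cb E]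
    have P: "open ?P" using cb by (simp add: cartan_bundle_def fibred_over_def)
    note cf = coframe_on_bundle[OF cb]
    obtain g where g: "gauge_fun g ?P" and agree: "\<And>p. p \<in> ?P \<Longrightarrow> agree_at (regauge i g (pull ?\<sigma> E)) (cartan_of B') p"
      using lift(1) by blast
    \<comment> \<open>The fibre coordinates of the lift are the gauge functions carrying the pulled
      back base data to the data of \<open>B'\<close>.\<close>
    define \<Phi> where "\<Phi> p = point (?\<sigma> p) (\<lambda>j. g j p)" for p
    have s\<Phi>: "smooth_on \<Phi> ?P"
      unfolding \<Phi>_def
    proof (rule smooth_on_point[OF P lift(2)])
      show "smooth_on (g j) ?P" if "j < 5" for j
        using g that unfolding gauge_fun_def by blast
    qed
    have im: "\<Phi> ` ?P \<subseteq> bundle_over N"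
      using lift(3) g by (auto simp: \<Phi>_def bundle_over_def proj_point fibre_crd_point gauge_fun_def)
    have agree\<Phi>: "agree_at (pull \<Phi> (bundle_cartan i E)) (cartan_of B') p" if p: "p \<in> ?P" for p
    proof (rule agree_at_trans[OF _ agree[OF p]])
      show "agree_at (pull \<Phi> (bundle_cartan i E)) (regauge i g (pull ?\<sigma> E)) p"
        by (rule pull_bundle_cartan[OF P s\<Phi> p]) (simp_all add: \<Phi>_def proj_point fibre_crd_point)
    qed
    have cf0: "coframe_on (cforms (bundle_cartan i E)) (bundle_over N)"
      by (rule coframe_on_bundle_cartan[OF E(1) sep])
    have ld: "local_diffeo \<Phi> ?P (bundle_over N)"
    proof (rule coframe_local_diffeo[OF P cf open_bundle_over[OF N] _ _ s\<Phi> im])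
      show "smooth_on \<beta> (bundle_over N)" if "\<beta> \<in> set (cforms (bundle_cartan i E))" for \<beta>
        using cf0 that by (simp add: coframe_on_def)
      show "length (cforms (bundle_cartan i E)) = CARD(8)" by (simp add: cforms_def)
      fix j p assume j: "j < CARD(8)" and p: "p \<in> ?P"
      have "j \<in> {0, 1, 2, 3, 4, 5, 6, 7}" using j by auto
      then show "pullback \<Phi> (cforms (bundle_cartan i E) ! j) p = (cforms (cartan_of B') ! j) p"
        using agree\<Phi>[OF p] by (auto simp: agree_at_def pull_def cforms_def)
    qed
    show "\<exists>\<Phi>. bundle_lift \<phi> B' ?B \<Phi> \<and> (\<forall>\<Psi>. bundle_lift \<phi> B' ?B \<Psi> \<longrightarrow> (\<forall>p\<in>?P. \<Psi> p = \<Phi> p))"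
    proof (intro exI[of _ \<Phi>] conjI allI impI ballI)
      show "bundle_lift \<phi> B' ?B \<Phi>"
        unfolding bundle_lift_iff bundle_of_simps using ld agree\<Phi> by (simp add: \<Phi>_def proj_point)
      fix \<Psi> p assume "bundle_lift \<phi> B' ?B \<Psi>" and p: "p \<in> ?P"
      then have ld\<Psi>: "local_diffeo \<Psi> ?P (bundle_over N)"
        and \<Psi>: "\<And>q. q \<in> ?P \<Longrightarrow> proj (\<Psi> q) = ?\<sigma> q" "\<And>q. q \<in> ?P \<Longrightarrow> agree_at (pull \<Psi> (bundle_cartan i E)) (cartan_of B') q"
        unfolding bundle_lift_iff bundle_of_simps by blast+
      let ?h = "\<lambda>j q. fibre_crd j (\<Psi> q)"
      \<comment> \<open>The fibre coordinates of an arbitrary lift \<open>\<Psi>\<close> form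
        another family of gauge functions with the same effect as \<open>g\<close>, so
        \<open>gauge_inj\<close> identifies the two.\<close>
      have a: "agree_at (regauge i ?h (pull ?\<sigma> E)) (regauge i g (pull ?\<sigma> E)) q" if q: "q \<in> ?P" for q
      proof -
        have "agree_at (pull \<Psi> (bundle_cartan i E)) (regauge i ?h (pull ?\<sigma> E)) q"
          by (rule pull_bundle_cartan[OF P local_diffeo_smooth[OF ld\<Psi>] q \<Psi>(1) refl])
        then show ?thesis
          using agree_at_trans[OF agree_at_sym agree_at_trans[OF \<Psi>(2)[OF q] agree_at_sym[OF agree[OF q]]]] by blast
      qed
      show "\<Psi> p = \<Phi> p"
      proof (rule point_eqI)
        show "proj (\<Psi> p) = proj (\<Phi> p)" using \<Psi>(1)[OF p] by (simp add: \<Phi>_def proj_point)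
        fix j :: nat assume j: "j < 5"
        show "fibre_crd j (\<Psi> p) = fibre_crd j (\<Phi> p)"
        proof (rule coframe_dual_at[OF P cf])
          fix A1 A2 A3 assume dual: "\<And>x. x \<in> ?P \<Longrightarrow> dual_at (cartan_of B') x (A1 x) (A2 x) (A3 x)"
          have dual': "dual_at (regauge i g (pull ?\<sigma> E)) x (A1 x) (A2 x) (A3 x)" if "x \<in> ?P" for x
            using dual[OF that] agree[OF that] by (simp add: dual_at_def agree_at_def)
          have nz: "g 0 x \<noteq> 0 \<and> g 1 x \<noteq> 0" if "x \<in> ?P" for x
            using g that by (simp add: gauge_fun_def)
          show ?thesis
            using gauge_inj[OF P p j nz a dual'] by (simp add: \<Phi>_def fibre_crd_point[OF j])
        qed
      qed
    qed
  qed
qed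


end
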